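(* Let $\gamma>3/4$ and let $v$ be a real-valued function on $(0,\infty)$ with $|v(t)|\lesssim t^{-\gamma}$. Let $x(t,k)=(x_n(t,k))_{n\ge0}$, $k\in\mathbb{R}$, be the $\ell^2$-valued solution of $$x_n'=ikn^2x_n+iv(t)(x_{n-1}+x_{n+1})\ (n\ge1),\qquad x_0'=iv(t)x_1,\qquad x_n(0,k)=\delta_{n,0}.$$ Then, for a.e. $k$, $$\sup_{t>0}\sum_{n\ge0}n^s|x_n(t,k)|^2<\infty\qquad\text{for all } s\in\mathbb{N}.$$ Moreover, fix any finite interval $(a,b)$ not containing $0$. Then, for any $s\ge1$, $$\left\|\sup_{t\le T}\sum_{n=1}^\infty n^s|x_n(t,k)|^2\right\|_{L^{2/s}((a,b),dk)}\lesssim C_1^s(T)C_2^s(T)+1,$$ where $$C_1(T)=\left(\int_0^T\langle\tau\rangle^{2\alpha}v^2(\tau)d\tau\right)^{1/2},\qquad C_2(T)=\int_0^T\sigma_\alpha(\tau)d\tau,\qquad 1-\gamma<\alpha<\gamma-1/2,\ \alpha\ge0,$$ and $\sigma_\alpha(t)=\langle t\rangle^{-1-\alpha}+\langle t\rangle^{-\alpha}|v(t)|$.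
   Context: $\langle t\rangle=(1+t^2)^{1/2}$. For nonnegative $f_1,f_2$, $f_1\lesssim f_2$ means $f_1\le Cf_2$ for some constant $C$; in the last estimate $C$ does not depend on $T$. The system is the evolution $x_t=ik\Lambda x+iQ(t)x$, $x(0,k)=\delta_0$, in $\ell^2(\mathbb{Z}_{\ge 0})$, where $\Lambda$ is diagonal with eigenvalues $n^2$, $n=0,1,\dots$, and $Q(t)$ is the symmetric Toeplitz operator with $Q_{mn}(t)=v(t)$ if $|m-n|=1$ and $Q_{mn}(t)=0$ otherwise. Here $v$ is locally integrable on $[0,\infty)$ and solutions are understood in the weak (Duhamel) sense: $x(t,k)=e^{ikt\Lambda}\delta_0+i\int_0^te^{ik(t-\tau)\Lambda}Q(\tau)x(\tau,k)d\tau$. For $2/s<1$, $\|\cdot\|_{L^{2/s}}$ denotes the usual quasi-norm. *)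

theory Defs
  imports "HOL-Analysis.Analysis"
begin

section \<open>The space of square-summable sequences indexed by the nonnegative integers\<close>

definition ell2 :: "(nat \<Rightarrow> complex) set" where
  "ell2 = {y. summable (\<lambda>n. (cmod (y n))\<^sup>2)}"

definition ell2_norm :: "(nat \<Rightarrow> complex) \<Rightarrow> real" where
  "ell2_norm y = sqrt (\<Sum>n. (cmod (y n))\<^sup>2)"

definition ell2_continuous_on :: "real set \<Rightarrow> (real \<Rightarrow> nat \<Rightarrow> complex) \<Rightarrow> bool" where
  "ell2_continuous_on S X \<longleftrightarrow>
     (\<forall>t\<in>S. X t \<in> ell2 \<and>
        ((\<lambda>\<tau>. ell2_norm (\<lambda>n. X \<tau> n - X t n)) \<longlongrightarrow> 0) (at t within S))"

definition delta0 :: "nat \<Rightarrow> complex" where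
  "delta0 n = (if n = 0 then 1 else 0)"


section \<open>The evolution equation\<close>

text \<open>The operator \<open>exp (i k t \<Lambda>)\<close>, where \<open>\<Lambda>\<close> is diagonal with eigenvalues \<open>n\<^sup>2\<close>.\<close>

definition free_evol :: "real \<Rightarrow> real \<Rightarrow> (nat \<Rightarrow> complex) \<Rightarrow> nat \<Rightarrow> complex" where
  "free_evol k t y n = exp (\<i> * of_real (k * t * (real n)\<^sup>2)) * y n"

text \<open>The symmetric Toeplitz operator with entries \<open>c\<close> where the indices differ by 1, and 0
  elsewhere.\<close>

definition toeplitz :: "real \<Rightarrow> (nat \<Rightarrow> complex) \<Rightarrow> nat \<Rightarrow> complex" where
  "toeplitz c y n = of_real c * ((if n = 0 then 0 else y (n - 1)) + y (n + 1))"

text \<open>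
  The solution \<open>X\<close> of \<open>X' = i k \<Lambda> X + i Q(t) X\<close>, \<open>X(0) = \<delta>\<^sub>0\<close>, with \<open>Q(t)\<close> the Toeplitz operator
  for \<open>v(t)\<close>, in the Duhamel sense. The vector-valued integral is written out in coordinates. Since
  \<open>v\<close> is locally integrable and \<open>X\<close> is norm continuous, the integrand is Bochner integrable on
  \<open>[0, t]\<close>, so this is the same as the identity for the Bochner integral; conversely that identity
  forces norm continuity of \<open>X\<close>. The initial condition is the case \<open>t = 0\<close>.
\<close>

definition duhamel_solution :: "(real \<Rightarrow> real) \<Rightarrow> real \<Rightarrow> (real \<Rightarrow> nat \<Rightarrow> complex) \<Rightarrow> bool" where
  "duhamel_solution v k X \<longleftrightarrow>
     ell2_continuous_on {0..} X \<and>
     (\<forall>t\<ge>0. \<forall>n. X t n = free_evol k t delta0 n +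
        \<i> * (LINT \<tau>:{0..t}|lebesgue. free_evol k (t - \<tau>) (toeplitz (v \<tau>) (X \<tau>)) n))"


section \<open>Norms and the quantities in the estimate\<close>

text \<open>Real powers, used only for positive exponents. Working in \<^typ>\<open>ennreal\<close> keeps divergent
  integrals equal to infinity; for instance \<open>C1\<close> below is infinite when \<open>v\<close> is not
  square-integrable near 0.\<close>

definition ennreal_powr :: "ennreal \<Rightarrow> real \<Rightarrow> ennreal" where
  "ennreal_powr x p = (if x = top then top else ennreal (enn2real x powr p))"

definition Lp_quasinorm :: "real \<Rightarrow> 'a measure \<Rightarrow> ('a \<Rightarrow> ennreal) \<Rightarrow> ennreal" where
  "Lp_quasinorm p M f = ennreal_powr (\<integral>\<^sup>+ x. ennreal_powr (f x) p \<partial>M) (1 / p)"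

definition japanese_bracket :: "real \<Rightarrow> real" where
  "japanese_bracket t = sqrt (1 + t\<^sup>2)"

definition sigma :: "real \<Rightarrow> (real \<Rightarrow> real) \<Rightarrow> real \<Rightarrow> real" where
  "sigma \<alpha> v t =
     japanese_bracket t powr (- 1 - \<alpha>) + japanese_bracket t powr (- \<alpha>) * \<bar>v t\<bar>"

definition C1 :: "real \<Rightarrow> (real \<Rightarrow> real) \<Rightarrow> real \<Rightarrow> ennreal" where
  "C1 \<alpha> v T = ennreal_powr
     (\<integral>\<^sup>+ \<tau>\<in>{0..T}. ennreal (japanese_bracket \<tau> powr (2 * \<alpha>) * (v \<tau>)\<^sup>2) \<partial>lebesgue) (1 / 2)"

definition C2 :: "real \<Rightarrow> (real \<Rightarrow> real) \<Rightarrow> real \<Rightarrow> ennreal" where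
  "C2 \<alpha> v T = (\<integral>\<^sup>+ \<tau>\<in>{0..T}. ennreal (sigma \<alpha> v \<tau>) \<partial>lebesgue)"

end

theory Submission
  imports Defs "HOL-Probability.Probability"
begin

text \<open>
  In the interaction picture \<open>y\<^sub>n = exp (- i k n\<^sup>2 t) x\<^sub>n\<close> the equation becomes
  \<open>y\<^sub>n' = i (cnj z\<^sub>n\<^sub>-\<^sub>1 y\<^sub>n\<^sub>-\<^sub>1 + z\<^sub>n y\<^sub>n\<^sub>+\<^sub>1)\<close> with \<open>z\<^sub>n(t) = v(t) exp (i (2n+1) k t)\<close>. The mass \<open>|y\<^sub>n|\<^sup>2\<close> is
  transported along the links \<open>n \<leftrightarrow> n+1\<close>, and the flux through a link is, up to the factor \<open>-2\<close>, the
  imaginary part of \<open>z\<^sub>n\<close> times the coherence \<open>c\<^sub>n = cnj y\<^sub>n y\<^sub>n\<^sub>+\<^sub>1\<close>. The first factor oscillates, the second one moves at the slow rate \<open>|v|\<close>, so the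
  time integral of the flux gains by cancellation. The total mass is \<open>1\<close>, and a moment
  \<open>\<Sum> (n+1)^m |y\<^sub>n|\<^sup>2\<close> changes only by the fluxes weighted with the increments of \<open>(n+1)^m\<close>, which are
  of order \<open>(n+1)^(m-1)\<close>. One integration by parts therefore bounds the moment of order \<open>m\<close> by a factor
  \<open>R\<close> times the largest value of the moment of order \<open>m-1\<close>, and hence by a constant times \<open>R^m\<close> (\<open>moment_bound\<close>).

  The integration by parts is done on the blocks \<open>[j\<^sup>2, (j+1)\<^sup>2]\<close> of time, as a summation by parts, and
  \<open>R\<close> involves two sequences: the integrals of \<open>|v|\<close> over the blocks, of size at most \<open>j^(1-2\<gamma>)\<close>, and the tails
  \<open>E\<^sub>j = \<integral> z\<^sub>n\<close> over \<open>[j\<^sup>2, N\<^sup>2]\<close>, taken at their largest over \<open>n\<close>. The first sequence is square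
  summable because \<open>\<gamma> > 3/4\<close>. The second one is so in mean square over \<open>k\<close>, since a tail is the
  Fourier transform of \<open>v\<close> cut off to \<open>[j\<^sup>2, N\<^sup>2]\<close>, taken at \<open>(2n+1) k\<close>, and Plancherel bounds it in
  \<open>L\<^sup>2\<close> by the norm of \<open>v\<close> on \<open>[j\<^sup>2, \<infinity>)\<close>, which is again of size at most \<open>j^(1-2\<gamma>)\<close>. Cauchy-Schwarz then
  controls all the terms of \<open>R\<close> (\<open>weighted_oscillation\<close>, \<open>plancherel_inequality\<close>).

  The supremum over \<open>n\<close> is replaced by a sum over \<open>n\<close>. For nonnegative \<open>f\<close> in \<open>L\<^sup>1\<close> the functions \<open>f((2n+1) k)\<close>
  have integrals of size \<open>1/(2n+1)\<close>, whose sum diverges; the divergence comes from small \<open>k\<close> and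
  disappears if a weight \<open>|k|^p\<close> with \<open>p > 0\<close> is present (\<open>odd_dilates_average\<close>). The weight costs
  little: the blocks are used only for \<open>j\<^sup>2 |k| \<ge> 1\<close>, so \<open>1\<close> may be replaced by \<open>(j\<^sup>2 |k|)^p\<close>, and with
  \<open>p = \<gamma> - 3/4\<close> the extra factor \<open>j^(2p)\<close> leaves the series convergent. The time before the first
  block contributes to \<open>R\<close> the integral of \<open>|v|\<close> up to \<open>J\<^sup>2\<close>, where \<open>J\<close> is of size \<open>1 + |k|^(-1/2)\<close>; this is at
  most of size \<open>J^(1/2)\<close>, whose square is integrable in \<open>k\<close>. So the square of \<open>R\<close> is bounded by
  \<open>growth_square\<close>, whose integral over bounded sets of \<open>k\<close> is bounded uniformly in \<open>N\<close>.

  Both claims follow. Fatou's lemma makes \<open>growth_square\<close> bounded along a subsequence of \<open>N\<close> for almost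
  every \<open>k\<close>, which bounds all moments for all times. The moment of real order \<open>s\<close> is at most a
  constant times \<open>R^s\<close> by interpolation with the mass, so its power \<open>2/s\<close> is of order \<open>R\<^sup>2\<close>, and its
  \<open>L^(2/s)\<close> quasinorm is bounded uniformly in \<open>T\<close>; this bound serves as the constant, since the factor
  next to the constant is at least \<open>1\<close>.
\<close>

section \<open>A product rule for indefinite integrals\<close>

text \<open>
  Over a partition of \<open>[a, b]\<close> that is fine for the uniform continuity of \<open>m\<close>, the squares of the
  increments of \<open>m\<close> add up to at most \<open>e\<close> times the total increment of \<open>m\<close>.
\<close>

lemma quadratic_increments_imp_eq:
  fixes H :: "real \<Rightarrow> 'a::real_normed_vector" and m :: "real \<Rightarrow> real"
  assumes ab: "a \<le> b"
    and cont: "continuous_on {a..b} m"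
    and inc: "\<And>s t. a \<le> s \<Longrightarrow> s \<le> t \<Longrightarrow> t \<le> b \<Longrightarrow> m s \<le> m t"
    and quad: "\<And>s t. a \<le> s \<Longrightarrow> s \<le> t \<Longrightarrow> t \<le> b \<Longrightarrow> norm (H t - H s) \<le> (m t - m s)\<^sup>2"
  shows "H b = H a"
proof -
  have small: "norm (H b - H a) \<le> e * (m b - m a)" if e: "e > 0" for e
  proof -
    have "uniformly_continuous_on {a..b} m"
      using cont by (intro compact_uniformly_continuous) auto
    then obtain d where d: "d > 0"
      and osc: "\<And>s t. s \<in> {a..b} \<Longrightarrow> t \<in> {a..b} \<Longrightarrow> dist t s < d \<Longrightarrow> dist (m t) (m s) < e"
      using e unfolding uniformly_continuous_on_def by metis
    obtain N :: nat where N: "(b - a) / d < real N"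
      using reals_Archimedean2 by blast
    have "(b - a) / d \<ge> 0"
      using d ab by simp
    then have N0: "real N > 0"
      using N by linarith
    define g where "g i = a + real i * ((b - a) / real N)" for i :: nat
    have step: "g (Suc i) = g i + (b - a) / real N" for i
      by (simp add: g_def distrib_right add_divide_distrib)
    have le: "g i \<le> g (Suc i)" for i
      using ab N0 by (simp add: step)
    have lo: "a \<le> g i" for i
      using ab N0 by (simp add: g_def)
    have gN: "g N = b"
      using N0 by (simp add: g_def)
    have hi: "g i \<le> b" if "i \<le> N" for i
      using lift_Suc_mono_le[of g, OF le that] gN by simp
    have len: "(b - a) / real N < d"
      using N d N0 by (simp add: field_simps)
    have one: "norm (H (g (Suc i)) - H (g i)) \<le> e * (m (g (Suc i)) - m (g i))" if i: "i < N" for i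
    proof -
      have mem: "g i \<in> {a..b}" "g (Suc i) \<in> {a..b}"
        using lo hi i by auto
      have "dist (g (Suc i)) (g i) < d"
        using len le[of i] by (simp add: step dist_real_def)
      from osc[OF mem this] have up: "m (g (Suc i)) - m (g i) \<le> e"
        by (simp add: dist_real_def)
      have nn: "0 \<le> m (g (Suc i)) - m (g i)"
        using inc[of "g i" "g (Suc i)"] le mem by auto
      have "norm (H (g (Suc i)) - H (g i)) \<le> (m (g (Suc i)) - m (g i))\<^sup>2"
        using quad[of "g i" "g (Suc i)"] le mem by auto
      also have "\<dots> \<le> e * (m (g (Suc i)) - m (g i))"
        unfolding power2_eq_square using up nn by (rule mult_right_mono)
      finally show ?thesis .
    qed
    have "norm (H b - H a) = norm (\<Sum>i<N. H (g (Suc i)) - H (g i))"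
      using sum_lessThan_telescope[of "\<lambda>i. H (g i)" N] gN by (simp add: g_def)
    also have "\<dots> \<le> (\<Sum>i<N. e * (m (g (Suc i)) - m (g i)))"
      by (rule order_trans[OF norm_sum sum_mono]) (use one in auto)
    also have "\<dots> = e * (m b - m a)"
      using sum_lessThan_telescope[of "\<lambda>i. m (g i)" N] gN
      by (simp add: sum_distrib_left[symmetric] g_def)
    finally show ?thesis .
  qed
  have mm: "0 \<le> m b - m a"
    using inc[of a b] ab by simp
  have "norm (H b - H a) \<le> 0 + e" if "e > 0" for e :: real
  proof -
    have "norm (H b - H a) \<le> e / (m b - m a + 1) * (m b - m a)"
      using small[of "e / (m b - m a + 1)"] that mm by simp
    also have "\<dots> \<le> e"
      using that mm by (simp add: field_simps)
    finally show ?thesis by simp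
  qed
  then have "norm (H b - H a) \<le> 0"
    using field_le_epsilon by blast
  then show ?thesis by simp
qed

lemma absolutely_integrable_mult_continuous:
  fixes f g :: "real \<Rightarrow> complex"
  assumes "continuous_on {a..b} f" "g absolutely_integrable_on {a..b}"
  shows "(\<lambda>t. f t * g t) absolutely_integrable_on {a..b}" "(\<lambda>t. g t * f t) absolutely_integrable_on {a..b}"
proof -
  show 1: "(\<lambda>t. f t * g t) absolutely_integrable_on {a..b}"
  proof (rule absolutely_integrable_bounded_measurable_product[where h="(*)"])
    show "bilinear ((*) :: complex \<Rightarrow> complex \<Rightarrow> complex)"
      by (rule bilinear_times)
    show "f \<in> borel_measurable (lebesgue_on {a..b})"
      using assms(1) by (intro continuous_imp_measurable_on_sets_lebesgue) auto
    show "bounded (f ` {a..b})"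
      using assms(1) by (intro compact_imp_bounded compact_continuous_image) auto
  qed (use assms in auto)
  then show "(\<lambda>t. g t * f t) absolutely_integrable_on {a..b}"
    by (simp add: mult.commute)
qed

lemma absolutely_integrable_mult_continuous_real:
  fixes f g :: "real \<Rightarrow> real"
  assumes "continuous_on {a..b} f" "g absolutely_integrable_on {a..b}"
  shows "(\<lambda>t. f t * g t) absolutely_integrable_on {a..b}" "(\<lambda>t. g t * f t) absolutely_integrable_on {a..b}"
proof -
  show 1: "(\<lambda>t. f t * g t) absolutely_integrable_on {a..b}"
  proof (rule absolutely_integrable_bounded_measurable_product_real)
    show "f \<in> borel_measurable (lebesgue_on {a..b})"
      using assms(1) by (intro continuous_imp_measurable_on_sets_lebesgue) auto
    show "bounded (f ` {a..b})"
      using assms(1) by (intro compact_imp_bounded compact_continuous_image) auto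
  qed (use assms in auto)
  then show "(\<lambda>t. g t * f t) absolutely_integrable_on {a..b}"
    by (simp add: mult.commute)
qed

lemma absolutely_integrable_of_real:
  fixes v :: "real \<Rightarrow> real"
  assumes "v absolutely_integrable_on S"
  shows "(\<lambda>t. complex_of_real (v t)) absolutely_integrable_on S"
  using absolutely_integrable_linear[OF assms bounded_linear_of_real] by (simp add: comp_def)

lemma absolutely_integrable_cnj:
  fixes f :: "real \<Rightarrow> complex"
  shows "f absolutely_integrable_on S \<Longrightarrow> (\<lambda>t. cnj (f t)) absolutely_integrable_on S"
  using absolutely_integrable_linear[OF _ bounded_linear_cnj] by (simp add: comp_def)

text \<open>
  The functions \<open>P\<close> and \<open>Q\<close> are indefinite integrals of merely integrable functions, so there are no
  derivatives at every point to work with. Instead, the difference of the two sides, as a function of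
  the right end point, has increments bounded by the square of those of \<open>\<integral> (|p| + |q|)\<close>: both factors
  vary by at most this much over a short interval. So the difference is constant.
\<close>

lemma integral_product_rule:
  fixes P Q p q :: "real \<Rightarrow> complex"
  assumes ab: "a \<le> b"
    and p: "p absolutely_integrable_on {a..b}" and q: "q absolutely_integrable_on {a..b}"
    and P: "\<And>t. t \<in> {a..b} \<Longrightarrow> P t = P a + integral {a..t} p"
    and Q: "\<And>t. t \<in> {a..b} \<Longrightarrow> Q t = Q a + integral {a..t} q"
  shows "((\<lambda>t. p t * Q t + P t * q t) has_integral (P b * Q b - P a * Q a)) {a..b}"
proof -
  have pi: "p integrable_on {a..b}" and qi: "q integrable_on {a..b}"
    by (rule set_lebesgue_integral_eq_integral(1)[OF p], rule set_lebesgue_integral_eq_integral(1)[OF q])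
  have contP: "continuous_on {a..b} P"
  proof (rule continuous_on_eq)
    show "continuous_on {a..b} (\<lambda>t. P a + integral {a..t} p)"
      by (intro continuous_on_add continuous_on_const indefinite_integral_continuous_1 pi)
    show "\<And>t. t \<in> {a..b} \<Longrightarrow> P a + integral {a..t} p = P t"
      using P by (metis)
  qed
  have contQ: "continuous_on {a..b} Q"
  proof (rule continuous_on_eq)
    show "continuous_on {a..b} (\<lambda>t. Q a + integral {a..t} q)"
      by (intro continuous_on_add continuous_on_const indefinite_integral_continuous_1 qi)
    show "\<And>t. t \<in> {a..b} \<Longrightarrow> Q a + integral {a..t} q = Q t"
      using Q by (metis)
  qed
  have pQ: "(\<lambda>t. p t * Q t) absolutely_integrable_on {a..b}"
    and Pq: "(\<lambda>t. P t * q t) absolutely_integrable_on {a..b}"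
    by (rule absolutely_integrable_mult_continuous(2)[OF contQ p],
        rule absolutely_integrable_mult_continuous(1)[OF contP q])
  define h where "h t = p t * Q t + P t * q t" for t
  have hi: "h integrable_on {a..b}"
    unfolding h_def
    using set_lebesgue_integral_eq_integral(1)[OF pQ] set_lebesgue_integral_eq_integral(1)[OF Pq]
    by (rule integrable_add)
  define N where "N t = norm (p t) + norm (q t)" for t
  have Ni: "N integrable_on {a..b}"
    unfolding N_def using p q by (intro integrable_add) (auto simp: absolutely_integrable_on_def)
  have sub: "f integrable_on {s..t}" if "f integrable_on {a..b}" "a \<le> s" "t \<le> b"
    for f :: "real \<Rightarrow> 'c::banach" and s t
    using that by (intro integrable_on_subinterval[OF that(1)]) auto
  have cut: "integral {a..t} f - integral {a..s} f = integral {s..t} f"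
    if "f integrable_on {a..b}" "a \<le> s" "s \<le> t" "t \<le> b" for f :: "real \<Rightarrow> 'c::banach" and s t
    using Henstock_Kurzweil_Integration.integral_combine[of a s t f] sub[OF that(1), of a t] that by (auto simp: algebra_simps)
  have "P b * Q b - integral {a..b} h = P a * Q a - integral {a..a} h"
  proof (rule quadratic_increments_imp_eq[where m="\<lambda>t. integral {a..t} N"])
    show "continuous_on {a..b} (\<lambda>t. integral {a..t} N)"
      by (rule indefinite_integral_continuous_1[OF Ni])
  next
    fix s t assume st: "a \<le> s" "s \<le> t" "t \<le> b"
    show "integral {a..s} N \<le> integral {a..t} N"
      using cut[OF Ni st] Henstock_Kurzweil_Integration.integral_nonneg[OF sub[OF Ni st(1,3)]]
      by (auto simp: N_def)
  next
    fix s t assume st: "a \<le> s" "s \<le> t" "t \<le> b"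
    note pst = sub[OF pi st(1,3)] and qst = sub[OF qi st(1,3)]
    define M where "M = integral {s..t} N"
    have PP: "norm (P s - P r) \<le> M" if r: "r \<in> {s..t}" for r
    proof -
      have "P r - P s = integral {s..r} p"
        using P[of r] P[of s] cut[OF pi, of s r] r st by auto
      then have "norm (P s - P r) = norm (integral {s..r} p)"
        by (metis norm_minus_commute)
      also have "\<dots> \<le> integral {s..r} N"
        by (rule Henstock_Kurzweil_Integration.integral_norm_bound_integral)
           (use r st in \<open>auto simp: N_def intro: sub[OF pi] sub[OF Ni]\<close>)
      also have "\<dots> \<le> M"
        unfolding M_def
        by (rule Henstock_Kurzweil_Integration.integral_subset_le)
           (use r st in \<open>auto simp: N_def intro: sub[OF Ni]\<close>)
      finally show ?thesis .
    qed
    have QQ: "norm (Q t - Q r) \<le> M" if r: "r \<in> {s..t}" for r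
    proof -
      have "Q t - Q r = integral {r..t} q"
        using Q[of r] Q[of t] cut[OF qi, of r t] r st by auto
      then have "norm (Q t - Q r) = norm (integral {r..t} q)"
        by simp
      also have "\<dots> \<le> integral {r..t} N"
        by (rule Henstock_Kurzweil_Integration.integral_norm_bound_integral)
           (use r st in \<open>auto simp: N_def intro: sub[OF qi] sub[OF Ni]\<close>)
      also have "\<dots> \<le> M"
        unfolding M_def
        by (rule Henstock_Kurzweil_Integration.integral_subset_le)
           (use r st in \<open>auto simp: N_def intro: sub[OF Ni]\<close>)
      finally show ?thesis .
    qed
    have "P t * Q t - integral {a..t} h - (P s * Q s - integral {a..s} h)
          = (P t - P s) * Q t + P s * (Q t - Q s) - integral {s..t} h"
      using cut[OF hi st] by (simp add: algebra_simps)
    also have "P t - P s = integral {s..t} p"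
      using P[of t] P[of s] cut[OF pi st] st by auto
    also have "Q t - Q s = integral {s..t} q"
      using Q[of t] Q[of s] cut[OF qi st] st by auto
    also have "integral {s..t} p * Q t + P s * integral {s..t} q - integral {s..t} h
         = integral {s..t} (\<lambda>r. p r * (Q t - Q r) + (P s - P r) * q r)"
    proof -
      have "((\<lambda>r. p r * Q t + P s * q r - h r) has_integral
            (integral {s..t} p * Q t + P s * integral {s..t} q - integral {s..t} h)) {s..t}"
        using pst qst sub[OF hi st(1,3)]
        by (intro has_integral_diff has_integral_add has_integral_mult_left has_integral_mult_right)
           (auto intro: integrable_integral)
      then have "integral {s..t} (\<lambda>r. p r * Q t + P s * q r - h r)
         = integral {s..t} p * Q t + P s * integral {s..t} q - integral {s..t} h"
        by (rule integral_unique)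
      then show ?thesis
        by (simp add: h_def algebra_simps)
    qed
    finally have eq: "P t * Q t - integral {a..t} h - (P s * Q s - integral {a..s} h)
         = integral {s..t} (\<lambda>r. p r * (Q t - Q r) + (P s - P r) * q r)" .
    have int: "(\<lambda>r. p r * (Q t - Q r) + (P s - P r) * q r) integrable_on {s..t}"
    proof -
      have "(\<lambda>r. p r * Q t + P s * q r - h r) integrable_on {s..t}"
        using pst qst sub[OF hi st(1,3)]
        by (intro integrable_diff integrable_add integrable_on_mult_left integrable_on_mult_right) auto
      then show ?thesis
        by (simp add: h_def algebra_simps)
    qed
    have "norm (integral {s..t} (\<lambda>r. p r * (Q t - Q r) + (P s - P r) * q r))
          \<le> integral {s..t} (\<lambda>r. M * N r)"
    proof (rule Henstock_Kurzweil_Integration.integral_norm_bound_integral[OF int])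
      show "(\<lambda>r. M * N r) integrable_on {s..t}"
        using sub[OF Ni st(1,3)] by (rule integrable_on_mult_right)
      fix r assume r: "r \<in> {s..t}"
      have "norm (p r * (Q t - Q r) + (P s - P r) * q r)
          \<le> norm (p r) * norm (Q t - Q r) + norm (P s - P r) * norm (q r)"
        by (metis norm_triangle_ineq norm_mult)
      also have "\<dots> \<le> norm (p r) * M + M * norm (q r)"
        using PP[OF r] QQ[OF r] by (intro add_mono mult_left_mono mult_right_mono) auto
      also have "\<dots> = M * N r"
        by (simp add: N_def algebra_simps)
      finally show "norm (p r * (Q t - Q r) + (P s - P r) * q r) \<le> M * N r" .
    qed
    also have "\<dots> = M * M"
      by (simp add: M_def)
    also have "\<dots> = (integral {a..t} N - integral {a..s} N)\<^sup>2"
      using cut[OF Ni st] by (simp add: M_def power2_eq_square)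
    finally show "norm (P t * Q t - integral {a..t} h - (P s * Q s - integral {a..s} h))
        \<le> (integral {a..t} N - integral {a..s} N)\<^sup>2"
      unfolding eq .
  qed (rule ab)
  then have "P b * Q b - P a * Q a = integral {a..b} h"
    by (simp add: algebra_simps)
  moreover have "(\<lambda>t. p t * Q t + P t * q t) = h"
    by (simp add: h_def fun_eq_iff)
  ultimately show ?thesis
    using integrable_integral[OF hi] by simp
qed


section \<open>Tridiagonal Hamiltonian flows\<close>

text \<open>
  The integral form of \<open>y\<^sub>n' = i (cnj z\<^sub>n\<^sub>-\<^sub>1 y\<^sub>n\<^sub>-\<^sub>1 + z\<^sub>n y\<^sub>n\<^sub>+\<^sub>1)\<close>, started at the site \<open>0\<close>, with couplings
  dominated by a locally integrable \<open>v\<close>. The couplings are left general here, because the transport of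
  mass depends on them only through their size and through their integrals over blocks of time.
\<close>

locale jacobi_flow =
  fixes v :: "real \<Rightarrow> real" and z :: "nat \<Rightarrow> real \<Rightarrow> complex" and y :: "nat \<Rightarrow> real \<Rightarrow> complex"
  assumes v_int: "v absolutely_integrable_on {0..T}"
    and z_int: "z n absolutely_integrable_on {0..T}"
    and z_le: "cmod (z n t) \<le> \<bar>v t\<bar>"
    and y_cont: "continuous_on {0..} (y n)"
    and y_summable: "0 \<le> t \<Longrightarrow> summable (\<lambda>n. (cmod (y n t))\<^sup>2)"
    and y_bdd: "\<exists>B. \<forall>t\<in>{0..T}. \<forall>n. cmod (y n t) \<le> B"
    and y_eq: "0 \<le> t \<Longrightarrow> y n t = of_bool (n = 0) + integral {0..t}
          (\<lambda>s. \<i> * ((if n = 0 then 0 else cnj (z (n - 1) s) * y (n - 1) s) + z n s * y (Suc n) s))"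
begin

definition y_prev :: "nat \<Rightarrow> real \<Rightarrow> complex" where
  "y_prev n t = (if n = 0 then 0 else y (n - 1) t)"

definition rhs :: "nat \<Rightarrow> real \<Rightarrow> complex" where
  "rhs n s = \<i> * ((if n = 0 then 0 else cnj (z (n - 1) s) * y (n - 1) s) + z n s * y (Suc n) s)"

text \<open>
  The off-diagonal entry \<open>(n, n+1)\<close> of the density matrix of \<open>y\<close>. It is the slowly varying factor of the
  flux.
\<close>

definition coherence :: "nat \<Rightarrow> real \<Rightarrow> complex" where
  "coherence n t = cnj (y n t) * y (Suc n) t"

text \<open>
  The rate at which mass enters the sites \<open>0, ..., n\<close> through the link between \<open>n\<close> and \<open>n+1\<close>.
\<close>

definition flux :: "nat \<Rightarrow> real \<Rightarrow> real" where
  "flux n t = - 2 * Im (z n t * coherence n t)"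

text \<open>
  The masses of the four sites that occur in the derivative of \<open>coherence n\<close>; the factor \<open>2\<close> absorbs the
  constants of the arithmetic-geometric mean inequality.
\<close>

definition nearby_mass :: "nat \<Rightarrow> real \<Rightarrow> real" where
  "nearby_mass n t = 2 * ((cmod (y_prev n t))\<^sup>2 + (cmod (y n t))\<^sup>2 + (cmod (y (Suc n) t))\<^sup>2 + (cmod (y (Suc (Suc n)) t))\<^sup>2)"

lemma subinterval:
  fixes f :: "real \<Rightarrow> 'b::euclidean_space"
  assumes "\<And>T. f absolutely_integrable_on {0..T::real}" "0 \<le> s"
  shows "f absolutely_integrable_on {s..t}"
  by (rule absolutely_integrable_on_subinterval[OF assms(1)[of t]]) (use assms(2) in auto)

lemma integrable_sub:
  fixes f :: "real \<Rightarrow> 'b::euclidean_space"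
  assumes "\<And>T. f absolutely_integrable_on {0..T::real}" "0 \<le> s"
  shows "f integrable_on {s..t}"
  by (rule set_lebesgue_integral_eq_integral(1)[OF subinterval[OF assms]])

lemma integral_split:
  fixes f :: "real \<Rightarrow> 'b::euclidean_space"
  assumes "\<And>T. f absolutely_integrable_on {0..T::real}" "0 \<le> r" "r \<le> s" "s \<le> t"
  shows "integral {r..t} f = integral {r..s} f + integral {s..t} f"
  using Henstock_Kurzweil_Integration.integral_combine[OF assms(3,4) integrable_sub[OF assms(1,2)]] by simp

lemma v_abs_int: "(\<lambda>t. \<bar>v t\<bar>) absolutely_integrable_on {0..T}"
  using absolutely_integrable_norm[OF v_int, of T] by (simp add: comp_def)

lemma y_cont': "continuous_on {0..T} (y n)"
  by (rule continuous_on_subset[OF y_cont]) auto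

lemma coherence_cont: "continuous_on {0..T} (coherence n)"
  unfolding coherence_def by (intro continuous_intros y_cont')

lemma nearby_mass_cont: "continuous_on {0..T} (nearby_mass n)"
  by (cases "n = 0") (auto simp: nearby_mass_def y_prev_def intro!: continuous_intros y_cont')

lemma z_coherence_int: "(\<lambda>t. z n t * coherence n t) absolutely_integrable_on {0..T}"
  by (rule absolutely_integrable_mult_continuous(2)[OF coherence_cont z_int])

lemma v_nearby_mass_int: "(\<lambda>t. \<bar>v t\<bar> * nearby_mass n t) absolutely_integrable_on {0..T}"
  by (rule absolutely_integrable_mult_continuous_real(2)[OF nearby_mass_cont v_abs_int])

lemma rhs_int: "rhs n absolutely_integrable_on {0..T}"
proof -
  have 1: "(\<lambda>s. z n s * y (Suc n) s) absolutely_integrable_on {0..T}"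
    by (rule absolutely_integrable_mult_continuous(2)[OF y_cont' z_int])
  have 2: "(\<lambda>s. cnj (z (n - 1) s) * y (n - 1) s) absolutely_integrable_on {0..T}"
    by (rule absolutely_integrable_mult_continuous(2)[OF y_cont' absolutely_integrable_cnj[OF z_int]])
  have 3: "(\<lambda>s. if n = 0 then 0 else cnj (z (n - 1) s) * y (n - 1) s) absolutely_integrable_on {0..T}"
    using 2 by (cases "n = 0") auto
  have 4: "(\<lambda>s. (if n = 0 then 0 else cnj (z (n - 1) s) * y (n - 1) s) + z n s * y (Suc n) s)
             absolutely_integrable_on {0..T}"
    by (rule set_integral_add(1)[OF 3 1])
  have "(\<lambda>s. \<i> * ((if n = 0 then 0 else cnj (z (n - 1) s) * y (n - 1) s) + z n s * y (Suc n) s))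
             absolutely_integrable_on {0..T}"
    by (rule absolutely_integrable_mult_continuous(1)[OF continuous_on_const 4])
  then show ?thesis
    by (simp add: rhs_def[abs_def])
qed

lemma y_increment:
  assumes "0 \<le> s" "s \<le> t"
  shows "y n t = y n s + integral {s..t} (rhs n)"
proof -
  have "y n t = of_bool (n = 0) + integral {0..t} (rhs n)"
    if "0 \<le> t" for t n
    using y_eq[OF that, of n] by (simp only: rhs_def[abs_def])
  then show ?thesis
    using assms integral_split[OF rhs_int _ assms, of n] by simp
qed

lemma cnj_y_increment:
  assumes "0 \<le> s" "s \<le> t"
  shows "cnj (y n t) = cnj (y n s) + integral {s..t} (\<lambda>r. cnj (rhs n r))"
  by (subst y_increment[OF assms])
     (simp add: Henstock_Kurzweil_Integration.integral_cnj)

lemma cnj_rhs_int: "(\<lambda>t. cnj (rhs n t)) absolutely_integrable_on {0..T}"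
  by (rule absolutely_integrable_cnj[OF rhs_int])

lemma coherence_has_integral:
  assumes "0 \<le> s" "s \<le> t"
  shows "((\<lambda>r. cnj (rhs m r) * y n r + cnj (y m r) * rhs n r) has_integral
            (cnj (y m t) * y n t - cnj (y m s) * y n s)) {s..t}"
  by (rule integral_product_rule[OF assms(2)
        subinterval[OF cnj_rhs_int assms(1)] subinterval[OF rhs_int assms(1)]])
     (use assms in \<open>auto intro!: cnj_y_increment y_increment\<close>)

lemma flux_int: "flux n absolutely_integrable_on {0..T}"
proof -
  have "(\<lambda>t. Im (z n t * coherence n t)) absolutely_integrable_on {0..T}"
    using absolutely_integrable_linear[OF z_coherence_int bounded_linear_Im] by (simp add: comp_def)
  then have "(\<lambda>t. (- 2) * Im (z n t * coherence n t)) absolutely_integrable_on {0..T}"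
    by (rule set_integrable_mult_right)
  then show ?thesis
    by (simp add: flux_def[abs_def])
qed

lemma flux_identity:
  "cnj (rhs n r) * y n r + cnj (y n r) * rhs n r
     = complex_of_real (flux n r - (if n = 0 then 0 else flux (n - 1) r))"
  by (cases n) (auto simp: rhs_def flux_def coherence_def complex_eq_iff algebra_simps)

lemma initial: "y n 0 = of_bool (n = 0)"
  using y_eq[of 0 n] by simp

lemma mass_flux:
  assumes t: "0 \<le> t"
  shows "(cmod (y n t))\<^sup>2 = of_bool (n = 0) + integral {0..t} (flux n)
           - (if n = 0 then 0 else integral {0..t} (flux (n - 1)))"
proof -
  have sq: "cnj a * a = complex_of_real ((cmod a)\<^sup>2)" for a
    by (metis complex_norm_square mult.commute)
  have "cnj (y n t) * y n t - cnj (y n 0) * y n 0 = complex_of_real ((cmod (y n t))\<^sup>2 - of_bool (n = 0))"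
    unfolding sq by (simp add: initial)
  note diff = this
  have "((\<lambda>r. complex_of_real (flux n r - (if n = 0 then 0 else flux (n - 1) r))) has_integral
       complex_of_real ((cmod (y n t))\<^sup>2 - of_bool (n = 0))) {0..t}"
    using coherence_has_integral[OF order_refl t, of n n]
    unfolding flux_identity diff .
  from has_integral_Re[OF this]
  have "((\<lambda>r. flux n r - (if n = 0 then 0 else flux (n - 1) r)) has_integral
       ((cmod (y n t))\<^sup>2 - of_bool (n = 0))) {0..t}"
    by simp
  moreover have "((\<lambda>r. flux n r - (if n = 0 then 0 else flux (n - 1) r)) has_integral
       (integral {0..t} (flux n) - (if n = 0 then 0 else integral {0..t} (flux (n - 1))))) {0..t}"
    by (cases n) (auto intro!: has_integral_diff integrable_integral integrable_sub flux_int)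
  ultimately have "(cmod (y n t))\<^sup>2 - of_bool (n = 0)
      = integral {0..t} (flux n) - (if n = 0 then 0 else integral {0..t} (flux (n - 1)))"
    by (rule has_integral_unique)
  then show ?thesis by simp
qed

lemma partial_mass:
  assumes t: "0 \<le> t"
  shows "(\<Sum>n<Suc N. (cmod (y n t))\<^sup>2) = 1 + integral {0..t} (flux N)"
  by (induction N) (simp_all add: mass_flux[OF t])

lemma coherence_le_nearby_mass: "cmod (coherence n t) \<le> nearby_mass n t"
proof -
  have "cmod (coherence n t) = cmod (y n t) * cmod (y (Suc n) t)"
    by (simp add: coherence_def norm_mult)
  also have "\<dots> \<le> (cmod (y n t))\<^sup>2 + (cmod (y (Suc n) t))\<^sup>2"
    using sum_squares_bound[of "cmod (y n t)" "cmod (y (Suc n) t)"] 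
      mult_nonneg_nonneg[of "cmod (y n t)" "cmod (y (Suc n) t)"] by (simp del: mult_nonneg_nonneg)
  also have "\<dots> \<le> nearby_mass n t"
    unfolding nearby_mass_def by (simp add: add_increasing)
  finally show ?thesis .
qed

text \<open>
  Nothing escapes to infinity: the mass of the sites \<open>0, ..., N\<close> differs from \<open>1\<close> by the time integral
  of the flux through the link above \<open>N\<close>, which tends to zero pointwise and is dominated by a multiple of
  \<open>|v|\<close>.
\<close>

lemma total_mass:
  assumes t: "0 \<le> t"
  shows "(\<lambda>n. (cmod (y n t))\<^sup>2) sums 1"
proof -
  obtain B where B: "\<And>s n. s \<in> {0..t} \<Longrightarrow> cmod (y n s) \<le> B"
    using y_bdd[of t] by metis
  have "cmod (y 0 0) \<le> B"
    by (rule B) (use t in simp)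
  then have B0: "0 \<le> B"
    by (rule order_trans[OF norm_ge_zero])
  have "(\<lambda>N. integral {0..t} (flux N)) \<longlonglongrightarrow> integral {0..t} (\<lambda>_. 0)"
  proof (rule dominated_convergence(2))
    show "flux N integrable_on {0..t}" for N
      by (rule integrable_sub[OF flux_int order_refl])
    show "(\<lambda>s. 2 * B\<^sup>2 * \<bar>v s\<bar>) integrable_on {0..t}"
      using integrable_sub[OF v_abs_int order_refl] by (rule integrable_on_mult_right)
    fix N s assume s: "s \<in> {0..t}"
    have "\<bar>flux N s\<bar> \<le> 2 * cmod (z N s * coherence N s)"
      using abs_Im_le_cmod[of "z N s * coherence N s"] by (simp add: flux_def)
    also have "\<dots> \<le> 2 * (\<bar>v s\<bar> * (B * B))"
      unfolding norm_mult coherence_def using B[OF s] B0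
      by (intro mult_left_mono mult_mono) (auto simp: z_le)
    finally show "norm (flux N s) \<le> 2 * B\<^sup>2 * \<bar>v s\<bar>"
      by (simp add: power2_eq_square mult_ac)
  next
    fix s assume s: "s \<in> {0..t}"
    then have "(\<lambda>n. (cmod (y n s))\<^sup>2) \<longlonglongrightarrow> 0"
      using summable_LIMSEQ_zero[OF y_summable] by simp
    then have "(\<lambda>n. sqrt ((cmod (y n s))\<^sup>2)) \<longlonglongrightarrow> sqrt 0"
      by (rule tendsto_real_sqrt)
    then have 0: "(\<lambda>n. y n s) \<longlonglongrightarrow> 0"
      by (simp add: tendsto_norm_zero_iff)
    then have "(\<lambda>n. 2 * (\<bar>v s\<bar> * (cmod (y n s) * cmod (y (Suc n) s)))) \<longlonglongrightarrow> 2 * (\<bar>v s\<bar> * (0 * 0))"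
      by (intro tendsto_intros) (auto intro: tendsto_norm_zero LIMSEQ_Suc[OF tendsto_norm_zero])
    then have lim: "(\<lambda>n. 2 * (\<bar>v s\<bar> * (cmod (y n s) * cmod (y (Suc n) s)))) \<longlonglongrightarrow> 0"
      by simp
    show "(\<lambda>N. flux N s) \<longlonglongrightarrow> 0"
    proof (rule Lim_null_comparison[OF always_eventually lim], rule allI)
      fix N
      have "\<bar>flux N s\<bar> \<le> 2 * cmod (z N s * coherence N s)"
        using abs_Im_le_cmod[of "z N s * coherence N s"] by (simp add: flux_def)
      also have "\<dots> \<le> 2 * (\<bar>v s\<bar> * (cmod (y N s) * cmod (y (Suc N) s)))"
        unfolding norm_mult coherence_def complex_mod_cnj
        by (intro mult_left_mono[of _ _ 2] mult_right_mono z_le) auto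
      finally show "norm (flux N s) \<le> 2 * (\<bar>v s\<bar> * (cmod (y N s) * cmod (y (Suc N) s)))"
        by simp
    qed
  qed
  then have "(\<lambda>N. 1 + integral {0..t} (flux N)) \<longlonglongrightarrow> 1 + 0"
    by (intro tendsto_intros) simp
  then have "(\<lambda>N. \<Sum>n<Suc N. (cmod (y n t))\<^sup>2) \<longlonglongrightarrow> 1"
    by (simp add: partial_mass[OF t] del: sum.lessThan_Suc)
  then show ?thesis
    unfolding sums_def by (rule LIMSEQ_imp_Suc)
qed

lemma cmod_rhs_le: "cmod (rhs n r) \<le> \<bar>v r\<bar> * (cmod (y_prev n r) + cmod (y (Suc n) r))"
proof -
  have "cmod (rhs n r) \<le> cmod (if n = 0 then 0 else cnj (z (n - 1) r) * y (n - 1) r) + cmod (z n r * y (Suc n) r)"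
    unfolding rhs_def norm_mult[of \<i>] norm_ii mult_1 by (rule norm_triangle_ineq)
  also have "cmod (if n = 0 then 0 else cnj (z (n - 1) r) * y (n - 1) r) \<le> \<bar>v r\<bar> * cmod (y_prev n r)"
    by (auto simp: y_prev_def norm_mult z_le mult_right_mono)
  also have "cmod (z n r * y (Suc n) r) \<le> \<bar>v r\<bar> * cmod (y (Suc n) r)"
    by (auto simp: norm_mult z_le mult_right_mono)
  finally show ?thesis
    by (simp add: algebra_simps)
qed

lemma coherence_increment:
  assumes st: "0 \<le> s" "s \<le> t"
  shows "cmod (coherence n t - coherence n s) \<le> integral {s..t} (\<lambda>r. \<bar>v r\<bar> * nearby_mass n r)"
proof -
  let ?f = "\<lambda>r. cnj (rhs n r) * y (Suc n) r + cnj (y n r) * rhs (Suc n) r"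
  have hi: "(?f has_integral (coherence n t - coherence n s)) {s..t}"
    using coherence_has_integral[OF st, of n "Suc n"] by (simp add: coherence_def)
  have "cmod (coherence n t - coherence n s) = cmod (integral {s..t} ?f)"
    using hi by (simp add: integral_unique)
  also have "\<dots> \<le> integral {s..t} (\<lambda>r. \<bar>v r\<bar> * nearby_mass n r)"
  proof (rule Henstock_Kurzweil_Integration.integral_norm_bound_integral)
    show "?f integrable_on {s..t}"
      by (rule has_integral_integrable[OF hi])
    show "(\<lambda>r. \<bar>v r\<bar> * nearby_mass n r) integrable_on {s..t}"
      by (rule integrable_sub[OF v_nearby_mass_int st(1)])
    fix r
    let ?a = "cmod (y_prev n r)" and ?b = "cmod (y n r)" and ?c = "cmod (y (Suc n) r)"
      and ?d = "cmod (y (Suc (Suc n)) r)"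
    have "cmod (?f r) \<le> cmod (rhs n r) * ?c + ?b * cmod (rhs (Suc n) r)"
      by (metis (no_types, lifting) norm_triangle_ineq norm_mult complex_mod_cnj)
    also have "\<dots> \<le> (\<bar>v r\<bar> * (?a + ?c)) * ?c + ?b * (\<bar>v r\<bar> * (?b + ?d))"
      using cmod_rhs_le[of n r] cmod_rhs_le[of "Suc n" r]
      by (intro add_mono mult_left_mono mult_right_mono) (auto simp: y_prev_def)
    also have "\<dots> = \<bar>v r\<bar> * ((?a + ?c) * ?c + ?b * (?b + ?d))"
      by (simp add: algebra_simps)
    also have "\<dots> \<le> \<bar>v r\<bar> * nearby_mass n r"
    proof (rule mult_left_mono)
      have "2 * (?a * ?c) \<le> ?a\<^sup>2 + ?c\<^sup>2" "2 * (?b * ?d) \<le> ?b\<^sup>2 + ?d\<^sup>2"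
        using sum_squares_bound[of ?a ?c] sum_squares_bound[of ?b ?d] by (simp_all add: mult_ac)
      then show "(?a + ?c) * ?c + ?b * (?b + ?d) \<le> nearby_mass n r"
        using zero_le_power2[of ?a] zero_le_power2[of ?b] zero_le_power2[of ?c] zero_le_power2[of ?d]
        unfolding nearby_mass_def distrib_left distrib_right power2_eq_square by linarith
    qed simp
    finally show "norm (?f r) \<le> \<bar>v r\<bar> * nearby_mass n r" .
  qed
  finally show ?thesis .
qed

end


section \<open>Truncated moments\<close>

text \<open>
  The truncation at \<open>L\<close> makes all moments finite before anything is known about decay in \<open>n\<close>, and makes
  the sums over the increments of the weight finite. All the bounds below are uniform in \<open>L\<close>.
\<close>

definition weight :: "nat \<Rightarrow> nat \<Rightarrow> nat \<Rightarrow> real" where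
  "weight L m n = real (min (Suc n) L) ^ m"

definition weight_step :: "nat \<Rightarrow> nat \<Rightarrow> nat \<Rightarrow> real" where
  "weight_step L m n = weight L m (Suc n) - weight L m n"

lemma weight_nonneg: "0 \<le> weight L m n"
  by (simp add: weight_def)

lemma weight_step_nonneg: "0 \<le> weight_step L m n"
  by (auto simp: weight_def weight_step_def intro!: power_mono)

lemma power_diff_le:
  fixes a b :: real
  assumes "0 \<le> b" "b \<le> a"
  shows "a ^ Suc k - b ^ Suc k \<le> real (Suc k) * a ^ k * (a - b)"
proof (induction k)
  case (Suc k)
  have "a ^ Suc (Suc k) - b ^ Suc (Suc k) = a * (a ^ Suc k - b ^ Suc k) + b ^ Suc k * (a - b)"
    by (simp add: algebra_simps)
  also have "\<dots> \<le> a * (real (Suc k) * a ^ k * (a - b)) + a ^ Suc k * (a - b)"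
    using assms Suc.IH by (intro add_mono mult_left_mono mult_right_mono power_mono) auto
  also have "\<dots> = real (Suc (Suc k)) * a ^ Suc k * (a - b)"
    by (simp add: algebra_simps)
  finally show ?case .
qed simp

text \<open>
  An increment of the weight of order \<open>m+1\<close> is controlled by the weight of order \<open>m\<close>, even at the site
  \<open>n-1\<close>, where the latter is smaller. The factor \<open>3\<close> is the worst ratio of \<open>n+2\<close> to \<open>max 1 n\<close>.
\<close>

lemma weight_step_le:
  assumes "n \<le> Suc i" "0 < L"
  shows "weight_step L (Suc m) n \<le> real (Suc m) * 3 ^ m * weight L m i"
proof (cases "Suc (Suc n) \<le> L")
  case True
  then have "weight_step L (Suc m) n = real (n + 2) ^ Suc m - real (n + 1) ^ Suc m"
    by (simp add: weight_step_def weight_def min_def del: power_Suc)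
  also have "\<dots> \<le> real (Suc m) * real (n + 2) ^ m"
    using power_diff_le[of "real (n + 1)" "real (n + 2)" m] by simp
  also have "\<dots> \<le> real (Suc m) * (3 * real (min (Suc i) L)) ^ m"
  proof (intro mult_left_mono power_mono)
    have "n + 2 \<le> 3 * min (Suc i) L"
      using assms True by (auto simp: min_def)
    then show "real (n + 2) \<le> 3 * real (min (Suc i) L)"
      by linarith
  qed auto
  finally show ?thesis
    by (simp add: weight_def power_mult_distrib mult_ac)
next
  case False
  then have "weight_step L (Suc m) n = 0"
    using assms by (cases "L = Suc n") (auto simp: weight_step_def weight_def min_def)
  then show ?thesis
    by (simp add: weight_nonneg)
qed

context jacobi_flow
begin

definition moment :: "nat \<Rightarrow> nat \<Rightarrow> real \<Rightarrow> real" where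
  "moment L m t = (\<Sum>n. weight L m n * (cmod (y n t))\<^sup>2)"

lemma moment_summable:
  assumes "0 \<le> t"
  shows "summable (\<lambda>n. weight L m n * (cmod (y n t))\<^sup>2)"
proof (rule summable_comparison_test')
  show "summable (\<lambda>n. real L ^ m * (cmod (y n t))\<^sup>2)"
    using y_summable[OF assms] by (rule summable_mult)
  show "norm (weight L m n * (cmod (y n t))\<^sup>2) \<le> real L ^ m * (cmod (y n t))\<^sup>2" if "0 \<le> n" for n
    by (auto simp: weight_def abs_mult intro!: mult_right_mono power_mono)
qed

lemma moment_zero:
  assumes "0 \<le> t"
  shows "moment L 0 t = 1"
  using sums_unique[OF total_mass[OF assms]] by (simp add: moment_def weight_def)

text \<open>
  Summation by parts against the balance of mass. It serves for the weights \<open>L^m - weight L m n\<close>, which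
  vanish for large \<open>n\<close>, so that the last term drops out.
\<close>

lemma abel_mass:
  assumes "0 \<le> t"
  shows "(\<Sum>n<Suc M. u n * (cmod (y n t))\<^sup>2)
     = u 0 + (\<Sum>n<Suc M. (u n - u (Suc n)) * integral {0..t} (flux n)) + u (Suc M) * integral {0..t} (flux M)"
  by (induction M) (simp_all add: mass_flux[OF assms] algebra_simps)

text \<open>
  The truncated weight is the constant \<open>L^m\<close> minus a weight of finite support, and the mass is conserved,
  so the change of the moment is a finite sum of fluxes.
\<close>

lemma moment_eq_flux:
  assumes t: "0 \<le> t" and L: "0 < L"
  shows "moment L m t = 1 - (\<Sum>n<L. weight_step L m n * integral {0..t} (flux n))"
proof -
  obtain M where M: "L = Suc M"
    using L gr0_conv_Suc by blast
  let ?u = "\<lambda>n. real L ^ m - weight L m n"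
  have "(\<lambda>n. ?u n * (cmod (y n t))\<^sup>2) sums (\<Sum>n<L. ?u n * (cmod (y n t))\<^sup>2)"
    by (rule sums_finite) (auto simp: weight_def min_def)
  moreover have "(\<lambda>n. real L ^ m * (cmod (y n t))\<^sup>2) sums (real L ^ m * 1)"
    by (rule sums_mult[OF total_mass[OF t]])
  ultimately have "(\<lambda>n. real L ^ m * (cmod (y n t))\<^sup>2 - ?u n * (cmod (y n t))\<^sup>2) sums
      (real L ^ m * 1 - (\<Sum>n<L. ?u n * (cmod (y n t))\<^sup>2))"
    by (intro sums_diff)
  then have "moment L m t = real L ^ m - (\<Sum>n<L. ?u n * (cmod (y n t))\<^sup>2)"
    by (simp add: moment_def sums_iff algebra_simps)
  also have "(\<Sum>n<L. ?u n * (cmod (y n t))\<^sup>2)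
      = real L ^ m - 1 + (\<Sum>n<L. weight_step L m n * integral {0..t} (flux n))"
    unfolding M abel_mass[OF t, of ?u M, unfolded M]
    by (simp add: weight_step_def weight_def)
  finally show ?thesis by simp
qed

lemma weighted_nearby_mass_le_moment:
  assumes t: "0 \<le> t" and L: "0 < L"
  shows "(\<Sum>n<L. weight_step L (Suc m) n * nearby_mass n t) \<le> 8 * (real (Suc m) * 3 ^ m) * moment L m t"
proof -
  let ?K = "real (Suc m) * 3 ^ m"
  let ?f = "\<lambda>n. weight L m n * (cmod (y n t))\<^sup>2"
  have shift: "(\<Sum>n<M. ?f (n + i)) \<le> moment L m t" for M i
  proof -
    have "(\<Sum>n<M. ?f (n + i)) = sum ?f ((\<lambda>n. n + i) ` {..<M})"
      by (subst sum.reindex) (auto simp: inj_on_def)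
    also have "\<dots> \<le> moment L m t"
      unfolding moment_def using moment_summable[OF t]
      by (intro sum_le_suminf) (auto simp: weight_nonneg)
    finally show ?thesis .
  qed
  have fwd: "(\<Sum>n<L. weight_step L (Suc m) n * (cmod (y (n + i) t))\<^sup>2) \<le> ?K * moment L m t" for i
  proof -
    have "(\<Sum>n<L. weight_step L (Suc m) n * (cmod (y (n + i) t))\<^sup>2) \<le> (\<Sum>n<L. (?K * weight L m (n + i)) * (cmod (y (n + i) t))\<^sup>2)"
      by (intro sum_mono mult_right_mono weight_step_le L) auto
    also have "\<dots> = ?K * (\<Sum>n<L. ?f (n + i))"
      by (simp add: sum_distrib_left mult_ac)
    also have "\<dots> \<le> ?K * moment L m t"
      by (intro mult_left_mono shift) auto
    finally show ?thesis .
  qed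
  have bwd: "(\<Sum>n<L. weight_step L (Suc m) n * (cmod (y_prev n t))\<^sup>2) \<le> ?K * moment L m t"
  proof -
    obtain M where M: "L = Suc M"
      using L gr0_conv_Suc by blast
    have "(\<Sum>n<L. weight_step L (Suc m) n * (cmod (y_prev n t))\<^sup>2)
        = (\<Sum>n<M. weight_step L (Suc m) (Suc n) * (cmod (y n t))\<^sup>2)"
      unfolding M sum.lessThan_Suc_shift by (simp add: y_prev_def)
    also have "\<dots> \<le> (\<Sum>n<M. (?K * weight L m n) * (cmod (y n t))\<^sup>2)"
      by (intro sum_mono mult_right_mono weight_step_le L) auto
    also have "\<dots> = ?K * (\<Sum>n<M. ?f (n + 0))"
      by (simp add: sum_distrib_left mult_ac)
    also have "\<dots> \<le> ?K * moment L m t"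
      by (intro mult_left_mono shift) auto
    finally show ?thesis .
  qed
  have "(\<Sum>n<L. weight_step L (Suc m) n * nearby_mass n t)
      = 2 * ((\<Sum>n<L. weight_step L (Suc m) n * (cmod (y_prev n t))\<^sup>2)
        + (\<Sum>n<L. weight_step L (Suc m) n * (cmod (y (n + 0) t))\<^sup>2)
        + (\<Sum>n<L. weight_step L (Suc m) n * (cmod (y (n + 1) t))\<^sup>2)
        + (\<Sum>n<L. weight_step L (Suc m) n * (cmod (y (n + 2) t))\<^sup>2))"
    by (simp add: nearby_mass_def sum.distrib[symmetric] sum_distrib_left algebra_simps)
  also have "\<dots> \<le> 2 * (?K * moment L m t + ?K * moment L m t + ?K * moment L m t + ?K * moment L m t)"
    by (intro mult_left_mono add_mono bwd fwd) auto
  finally show ?thesis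
    by (simp add: algebra_simps)
qed


section \<open>Summation by parts over blocks of time\<close>

abbreviation action :: "real \<Rightarrow> real \<Rightarrow> real" where
  "action s t \<equiv> integral {s..t} (\<lambda>r. \<bar>v r\<bar>)"

lemma action_nonneg: "0 \<le> s \<Longrightarrow> 0 \<le> action s t"
  using Henstock_Kurzweil_Integration.integral_nonneg[OF integrable_sub[OF v_abs_int]] by auto

lemma action_mono:
  assumes "0 \<le> s'" "s' \<le> s" "t \<le> t'"
  shows "action s t \<le> action s' t'"
  using assms by (intro Henstock_Kurzweil_Integration.integral_subset_le integrable_sub[OF v_abs_int]) auto

text \<open>
  The integral on the left bounds both the integral of \<open>z n\<close> times the coherence and the increment of the
  coherence. The weighted sum over \<open>n\<close> has to be taken under the integral, where the hypothesis on \<open>q\<close>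
  applies at each time.
\<close>

lemma weighted_nearby_mass_integral:
  assumes st: "0 \<le> s" "s \<le> t"
    and q: "\<And>r. r \<in> {s..t} \<Longrightarrow> (\<Sum>n<L. d n * nearby_mass n r) \<le> q"
  shows "(\<Sum>n<L. d n * integral {s..t} (\<lambda>r. \<bar>v r\<bar> * nearby_mass n r)) \<le> q * action s t"
proof -
  have i1: "(\<lambda>r. d n * (\<bar>v r\<bar> * nearby_mass n r)) integrable_on {s..t}" for n
    using integrable_sub[OF v_nearby_mass_int st(1)] by (rule integrable_on_mult_right)
  have "(\<Sum>n<L. d n * integral {s..t} (\<lambda>r. \<bar>v r\<bar> * nearby_mass n r))
      = integral {s..t} (\<lambda>r. \<Sum>n<L. d n * (\<bar>v r\<bar> * nearby_mass n r))"
    by (simp add: Henstock_Kurzweil_Integration.integral_sum i1)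
  also have "\<dots> \<le> integral {s..t} (\<lambda>r. q * \<bar>v r\<bar>)"
  proof (rule integral_le)
    show "(\<lambda>r. \<Sum>n<L. d n * (\<bar>v r\<bar> * nearby_mass n r)) integrable_on {s..t}"
      by (intro integrable_sum i1) auto
    show "(\<lambda>r. q * \<bar>v r\<bar>) integrable_on {s..t}"
      using integrable_sub[OF v_abs_int st(1)] by (rule integrable_on_mult_right)
    fix r assume r: "r \<in> {s..t}"
    have "(\<Sum>n<L. d n * (\<bar>v r\<bar> * nearby_mass n r)) = (\<Sum>n<L. d n * nearby_mass n r) * \<bar>v r\<bar>"
      unfolding sum_distrib_right by (simp add: mult_ac)
    also have "\<dots> \<le> q * \<bar>v r\<bar>"
      by (rule mult_right_mono[OF q[OF r]]) simp
    finally show "(\<Sum>n<L. d n * (\<bar>v r\<bar> * nearby_mass n r)) \<le> q * \<bar>v r\<bar>" .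
  qed
  finally show ?thesis by simp
qed

lemma weighted_z_coherence:
  assumes st: "0 \<le> s" "s \<le> t" and d: "\<And>n. 0 \<le> d n"
    and q: "\<And>r. r \<in> {s..t} \<Longrightarrow> (\<Sum>n<L. d n * nearby_mass n r) \<le> q"
  shows "(\<Sum>n<L. d n * cmod (integral {s..t} (\<lambda>r. z n r * coherence n r))) \<le> q * action s t"
proof -
  have "cmod (integral {s..t} (\<lambda>r. z n r * coherence n r)) \<le> integral {s..t} (\<lambda>r. \<bar>v r\<bar> * nearby_mass n r)" for n
    by (intro Henstock_Kurzweil_Integration.integral_norm_bound_integral
         integrable_sub[OF z_coherence_int st(1)] integrable_sub[OF v_nearby_mass_int st(1)])
       (auto simp: norm_mult z_le coherence_le_nearby_mass intro!: mult_mono)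
  then have "(\<Sum>n<L. d n * cmod (integral {s..t} (\<lambda>r. z n r * coherence n r)))
     \<le> (\<Sum>n<L. d n * integral {s..t} (\<lambda>r. \<bar>v r\<bar> * nearby_mass n r))"
    by (intro sum_mono mult_left_mono d)
  also have "\<dots> \<le> q * action s t"
    by (rule weighted_nearby_mass_integral[OF st q])
  finally show ?thesis .
qed

lemma weighted_coherence_increment:
  assumes st: "0 \<le> s" "s \<le> t" and d: "\<And>n. 0 \<le> d n"
    and q: "\<And>r. r \<in> {s..t} \<Longrightarrow> (\<Sum>n<L. d n * nearby_mass n r) \<le> q"
  shows "(\<Sum>n<L. d n * cmod (coherence n t - coherence n s)) \<le> q * action s t"
proof -
  have "(\<Sum>n<L. d n * cmod (coherence n t - coherence n s))
     \<le> (\<Sum>n<L. d n * integral {s..t} (\<lambda>r. \<bar>v r\<bar> * nearby_mass n r))"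
    by (intro sum_mono mult_left_mono d coherence_increment st)
  also have "\<dots> \<le> q * action s t"
    by (rule weighted_nearby_mass_integral[OF st q])
  finally show ?thesis .
qed

lemma zdiff_int: "(\<lambda>r. z n r * (coherence n r - c)) absolutely_integrable_on {0..T}"
  by (rule absolutely_integrable_mult_continuous(2)[OF _ z_int]) (intro continuous_intros coherence_cont)

text \<open>
  The square is the gain of second order: one factor is the integral of \<open>|z n|\<close>, the other one is the
  change of the coherence since the beginning of the interval.
\<close>

lemma weighted_remainder:
  assumes st: "0 \<le> s" "s \<le> t" and d: "\<And>n. 0 \<le> d n" and q0: "0 \<le> q"
    and q: "\<And>r. r \<in> {s..t} \<Longrightarrow> (\<Sum>n<L. d n * nearby_mass n r) \<le> q"
  shows "(\<Sum>n<L. d n * cmod (integral {s..t} (\<lambda>r. z n r * (coherence n r - coherence n s)))) \<le> q * (action s t)\<^sup>2"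
proof -
  have cont: "continuous_on {s..t} (\<lambda>r. cmod (coherence n r - coherence n s))" for n
    using continuous_on_subset[OF coherence_cont[of t n], of "{s..t}"] st by (intro continuous_intros) auto
  have i1: "(\<lambda>r. \<bar>v r\<bar> * cmod (coherence n r - coherence n s)) integrable_on {s..t}" for n
    by (rule set_lebesgue_integral_eq_integral(1)[OF
          absolutely_integrable_mult_continuous_real(2)[OF cont subinterval[OF v_abs_int st(1)]]])
  have i2: "(\<lambda>r. d n * (\<bar>v r\<bar> * cmod (coherence n r - coherence n s))) integrable_on {s..t}" for n
    using i1 by (rule integrable_on_mult_right)
  have "cmod (integral {s..t} (\<lambda>r. z n r * (coherence n r - coherence n s)))
      \<le> integral {s..t} (\<lambda>r. \<bar>v r\<bar> * cmod (coherence n r - coherence n s))" for n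
    by (rule Henstock_Kurzweil_Integration.integral_norm_bound_integral[OF integrable_sub[OF zdiff_int st(1)] i1])
       (auto simp: norm_mult z_le intro!: mult_right_mono)
  then have "(\<Sum>n<L. d n * cmod (integral {s..t} (\<lambda>r. z n r * (coherence n r - coherence n s))))
     \<le> (\<Sum>n<L. d n * integral {s..t} (\<lambda>r. \<bar>v r\<bar> * cmod (coherence n r - coherence n s)))"
    by (intro sum_mono mult_left_mono d)
  also have "\<dots> = integral {s..t} (\<lambda>r. \<Sum>n<L. d n * (\<bar>v r\<bar> * cmod (coherence n r - coherence n s)))"
    by (simp add: Henstock_Kurzweil_Integration.integral_sum i2)
  also have "\<dots> \<le> integral {s..t} (\<lambda>r. (q * action s t) * \<bar>v r\<bar>)"
  proof (rule integral_le)
    show "(\<lambda>r. \<Sum>n<L. d n * (\<bar>v r\<bar> * cmod (coherence n r - coherence n s))) integrable_on {s..t}"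
      by (intro integrable_sum i2) auto
    show "(\<lambda>r. (q * action s t) * \<bar>v r\<bar>) integrable_on {s..t}"
      using integrable_sub[OF v_abs_int st(1)] by (rule integrable_on_mult_right)
    fix r assume r: "r \<in> {s..t}"
    have "(\<Sum>n<L. d n * (\<bar>v r\<bar> * cmod (coherence n r - coherence n s)))
        = (\<Sum>n<L. d n * cmod (coherence n r - coherence n s)) * \<bar>v r\<bar>"
      unfolding sum_distrib_right by (simp add: mult_ac)
    also have "\<dots> \<le> (q * action s r) * \<bar>v r\<bar>"
      by (intro mult_right_mono weighted_coherence_increment) (use st d q r in auto)
    also have "\<dots> \<le> (q * action s t) * \<bar>v r\<bar>"
      by (intro mult_right_mono mult_left_mono action_mono q0) (use st r in auto)
    finally show "(\<Sum>n<L. d n * (\<bar>v r\<bar> * cmod (coherence n r - coherence n s))) \<le> (q * action s t) * \<bar>v r\<bar>" .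
  qed
  finally show ?thesis
    by (simp add: power2_eq_square mult_ac)
qed

text \<open>
  On each block the coherence is frozen at its initial value, which leaves the remainder with
  \<open>coherence n s - coherence n (\<tau> j)\<close>; the frozen part is \<open>coherence n (\<tau> j) * (E j - E (Suc j))\<close> and is
  summed by parts. The tails \<open>E\<close> end at the last time \<open>\<tau> N\<close> rather than at infinity, so that they are
  plain integrals.
\<close>

lemma block_abel_identity:
  fixes \<tau> :: "nat \<Rightarrow> real" and n N :: nat
  defines "E j \<equiv> integral {\<tau> j..\<tau> N} (z n)"
  assumes mono: "mono \<tau>" and pos: "0 \<le> \<tau> 0" and r: "J \<le> r" "r \<le> N"
  shows "integral {\<tau> J..\<tau> r} (\<lambda>s. z n s * coherence n s)
     = coherence n (\<tau> J) * E J - coherence n (\<tau> r) * E r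
       + (\<Sum>j=J..<r. (coherence n (\<tau> (Suc j)) - coherence n (\<tau> j)) * E (Suc j)
            + integral {\<tau> j..\<tau> (Suc j)} (\<lambda>s. z n s * (coherence n s - coherence n (\<tau> j))))"
  using r
proof (induction r rule: dec_induct)
  case base
  then show ?case by simp
next
  case (step r)
  have le: "\<tau> i \<le> \<tau> j" if "i \<le> j" for i j
    using mono that by (rule monoD)
  have p: "0 \<le> \<tau> i" for i
    using pos le[of 0 i] by simp
  let ?g = "\<lambda>s. z n s * coherence n s"
  have "integral {\<tau> J..\<tau> (Suc r)} ?g = integral {\<tau> J..\<tau> r} ?g + integral {\<tau> r..\<tau> (Suc r)} ?g"
    by (rule integral_split[OF z_coherence_int]) (use step p le in auto)
  also have "integral {\<tau> r..\<tau> (Suc r)} ?g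
      = integral {\<tau> r..\<tau> (Suc r)} (\<lambda>s. coherence n (\<tau> r) * z n s)
         + integral {\<tau> r..\<tau> (Suc r)} (\<lambda>s. z n s * (coherence n s - coherence n (\<tau> r)))"
  proof (subst Henstock_Kurzweil_Integration.integral_add[symmetric])
    show "(\<lambda>s. coherence n (\<tau> r) * z n s) integrable_on {\<tau> r..\<tau> (Suc r)}"
      using integrable_sub[OF z_int p] by (rule integrable_on_mult_right)
    show "(\<lambda>s. z n s * (coherence n s - coherence n (\<tau> r))) integrable_on {\<tau> r..\<tau> (Suc r)}"
      by (rule integrable_sub[OF zdiff_int p])
  qed (simp add: algebra_simps)
  also have "integral {\<tau> r..\<tau> (Suc r)} (\<lambda>s. coherence n (\<tau> r) * z n s) = coherence n (\<tau> r) * (E r - E (Suc r))"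
    using integral_split[OF z_int, of "\<tau> r" "\<tau> (Suc r)" "\<tau> N" n] p le step
    by (simp add: E_def)
  finally show ?case
    using step by (simp add: sum.atLeastLessThan_Suc algebra_simps)
qed

text \<open>
  The time before \<open>\<tau> J\<close> and the last, incomplete block are estimated without cancellation. In between,
  the summation by parts leaves two boundary terms, the terms \<open>b j * F (Suc j)\<close>, summed by
  Cauchy-Schwarz, and the remainders \<open>(b j)\<^sup>2\<close>.
\<close>

lemma weighted_oscillation:
  fixes \<tau> b F d :: "nat \<Rightarrow> real" and L N J :: nat
  assumes mono: "mono \<tau>" and pos: "0 \<le> \<tau> 0"
    and d: "\<And>n. 0 \<le> d n" and q0: "0 \<le> q"
    and q: "\<And>r. r \<in> {0..\<tau> N} \<Longrightarrow> (\<Sum>n<L. d n * nearby_mass n r) \<le> q"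
    and b: "\<And>j. J \<le> j \<Longrightarrow> j < N \<Longrightarrow> action (\<tau> j) (\<tau> (Suc j)) \<le> b j"
    and F: "\<And>j n. J \<le> j \<Longrightarrow> j \<le> N \<Longrightarrow> cmod (integral {\<tau> j..\<tau> N} (z n)) \<le> F j"
    and \<beta>: "(\<Sum>j=J..<N. (b j)\<^sup>2) \<le> \<beta>" and \<Phi>: "(\<Sum>j=J..N. (F j)\<^sup>2) \<le> \<Phi>"
    and t: "t \<in> {0..\<tau> N}"
  shows "(\<Sum>n<L. d n * cmod (integral {0..t} (\<lambda>s. z n s * coherence n s)))
     \<le> q * (action 0 (\<tau> J) + sqrt \<beta> + \<beta> + (2 + sqrt \<beta>) * sqrt \<Phi>)"
proof -
  have le: "\<tau> i \<le> \<tau> j" if "i \<le> j" for i j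
    using mono that by (rule monoD)
  have p: "0 \<le> \<tau> i" for i
    using pos le[of 0 i] by simp
  have \<beta>0: "0 \<le> \<beta>"
    using \<beta> by (rule order_trans[OF sum_nonneg, rotated]) simp
  have \<Phi>0: "0 \<le> \<Phi>"
    using \<Phi> by (rule order_trans[OF sum_nonneg, rotated]) simp
  let ?g = "\<lambda>n s. z n s * coherence n s"
  show ?thesis
  proof (cases "t \<le> \<tau> J")
    case True
    have "(\<Sum>n<L. d n * cmod (integral {0..t} (?g n))) \<le> q * action 0 t"
      by (rule weighted_z_coherence) (use t d q in auto)
    also have "\<dots> \<le> q * (action 0 (\<tau> J) + sqrt \<beta> + \<beta> + (2 + sqrt \<beta>) * sqrt \<Phi>)"
    proof (rule mult_left_mono[OF _ q0])
      have "action 0 t \<le> action 0 (\<tau> J)"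
        using True by (intro action_mono) auto
      moreover have "0 \<le> (2 + sqrt \<beta>) * sqrt \<Phi>"
        using \<beta>0 \<Phi>0 by simp
      ultimately show "action 0 t \<le> action 0 (\<tau> J) + sqrt \<beta> + \<beta> + (2 + sqrt \<beta>) * sqrt \<Phi>"
        using \<beta>0 real_sqrt_ge_zero[OF \<beta>0] by linarith
    qed
    finally show ?thesis .
  next
    case False
    \<comment> \<open>The block that contains \<open>t\<close> begins at \<open>\<tau> r\<close>, where \<open>k = Suc r\<close>.\<close>
    define k where "k = (LEAST j. J \<le> j \<and> t \<le> \<tau> j)"
    have JN: "J \<le> N"
      using False t le[of N J] by (cases "J \<le> N") auto
    have k: "J \<le> k \<and> t \<le> \<tau> k"
      unfolding k_def by (rule LeastI[of _ N]) (use JN t in auto)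
    have kN: "k \<le> N"
      unfolding k_def by (rule Least_le) (use JN t in auto)
    have "k \<noteq> J"
      using k False by auto
    then obtain r where r: "k = Suc r" "J \<le> r"
      using k by (cases k) auto
    have "\<not> (J \<le> r \<and> t \<le> \<tau> r)"
      using not_less_Least[of r "\<lambda>j. J \<le> j \<and> t \<le> \<tau> j"] r unfolding k_def by auto
    then have tr: "\<tau> r \<le> t" "t \<le> \<tau> (Suc r)"
      using r k by auto
    have rN: "r < N"
      using r kN by simp
    have F0: "0 \<le> F j" if "J \<le> j" "j \<le> N" for j
      by (rule order_trans[OF norm_ge_zero F[OF that]])
    have b0: "0 \<le> b j" if "J \<le> j" "j < N" for j
      by (rule order_trans[OF action_nonneg b[OF that]]) (rule p)
    have sub: "(\<Sum>n<L. d n * nearby_mass n s) \<le> q" if "s \<in> {\<tau> i..\<tau> j}" "j \<le> N" for i j s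
      by (rule q) (use that p[of i] le[of j N] in auto)
    have first: "(\<Sum>n<L. d n * cmod (integral {0..\<tau> J} (?g n))) \<le> q * action 0 (\<tau> J)"
      by (rule weighted_z_coherence) (use p d q le[of J N] JN in auto)
    have last: "(\<Sum>n<L. d n * cmod (integral {\<tau> r..t} (?g n))) \<le> q * b r"
    proof -
      have "(\<Sum>n<L. d n * cmod (integral {\<tau> r..t} (?g n))) \<le> q * action (\<tau> r) t"
        by (rule weighted_z_coherence) (use p[of r] d q tr t in auto)
      also have "\<dots> \<le> q * action (\<tau> r) (\<tau> (Suc r))"
        by (intro mult_left_mono q0 action_mono p) (use tr in auto)
      also have "\<dots> \<le> q * b r"
        by (intro mult_left_mono q0 b r rN)
      finally show ?thesis .
    qed
    have coherence_q: "(\<Sum>n<L. d n * cmod (coherence n s)) \<le> q" if "s \<in> {0..\<tau> N}" for s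
      by (rule order_trans[OF sum_mono q[OF that]]) (intro mult_left_mono coherence_le_nearby_mass d)
    have boundary: "(\<Sum>n<L. d n * cmod (coherence n (\<tau> j) * integral {\<tau> j..\<tau> N} (z n))) \<le> q * F j"
      if j: "J \<le> j" "j \<le> N" for j
    proof -
      have "(\<Sum>n<L. d n * cmod (coherence n (\<tau> j) * integral {\<tau> j..\<tau> N} (z n)))
          \<le> (\<Sum>n<L. d n * (cmod (coherence n (\<tau> j)) * F j))"
        unfolding norm_mult by (intro sum_mono mult_left_mono F j d) auto
      also have "\<dots> = (\<Sum>n<L. d n * cmod (coherence n (\<tau> j))) * F j"
        unfolding sum_distrib_right by (simp add: mult_ac)
      also have "\<dots> \<le> q * F j"
        by (intro mult_right_mono coherence_q F0 j) (use p le[OF j(2)] in auto)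
      finally show ?thesis .
    qed
    have incr: "(\<Sum>n<L. d n * cmod ((coherence n (\<tau> (Suc j)) - coherence n (\<tau> j)) * integral {\<tau> (Suc j)..\<tau> N} (z n)))
         \<le> q * (b j * F (Suc j))" if j: "J \<le> j" "j < N" for j
    proof -
      have "(\<Sum>n<L. d n * cmod ((coherence n (\<tau> (Suc j)) - coherence n (\<tau> j)) * integral {\<tau> (Suc j)..\<tau> N} (z n)))
          \<le> (\<Sum>n<L. d n * (cmod (coherence n (\<tau> (Suc j)) - coherence n (\<tau> j)) * F (Suc j)))"
        unfolding norm_mult by (intro sum_mono mult_left_mono F d) (use j in auto)
      also have "\<dots> = (\<Sum>n<L. d n * cmod (coherence n (\<tau> (Suc j)) - coherence n (\<tau> j))) * F (Suc j)"
        unfolding sum_distrib_right by (simp add: mult_ac)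
      also have "\<dots> \<le> (q * action (\<tau> j) (\<tau> (Suc j))) * F (Suc j)"
        by (intro mult_right_mono weighted_coherence_increment p le d sub F0) (use j in auto)
      also have "\<dots> \<le> (q * b j) * F (Suc j)"
        by (intro mult_right_mono mult_left_mono b F0 q0) (use j in auto)
      finally show ?thesis
        by (simp add: mult_ac)
    qed
    have rem: "(\<Sum>n<L. d n * cmod (integral {\<tau> j..\<tau> (Suc j)} (\<lambda>s. z n s * (coherence n s - coherence n (\<tau> j)))))
         \<le> q * (b j)\<^sup>2" if j: "J \<le> j" "j < N" for j
    proof -
      have "(\<Sum>n<L. d n * cmod (integral {\<tau> j..\<tau> (Suc j)} (\<lambda>s. z n s * (coherence n s - coherence n (\<tau> j)))))
          \<le> q * (action (\<tau> j) (\<tau> (Suc j)))\<^sup>2"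
        by (rule weighted_remainder) (use p le d q0 sub j in auto)
      also have "\<dots> \<le> q * (b j)\<^sup>2"
        by (intro mult_left_mono power_mono b action_nonneg p q0 j)
      finally show ?thesis .
    qed
    \<comment> \<open>The estimates are applied after summation over \<open>n\<close>, so the decomposition of the time interval comes first.\<close>
    have pt: "cmod (integral {0..t} (?g n))
        \<le> cmod (integral {0..\<tau> J} (?g n)) + (cmod (coherence n (\<tau> J) * integral {\<tau> J..\<tau> N} (z n))
          + cmod (coherence n (\<tau> r) * integral {\<tau> r..\<tau> N} (z n))
          + (\<Sum>j=J..<r. cmod ((coherence n (\<tau> (Suc j)) - coherence n (\<tau> j)) * integral {\<tau> (Suc j)..\<tau> N} (z n))
            + cmod (integral {\<tau> j..\<tau> (Suc j)} (\<lambda>s. z n s * (coherence n s - coherence n (\<tau> j))))))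
          + cmod (integral {\<tau> r..t} (?g n))" for n
    proof -
      have "integral {0..t} (?g n) = integral {0..\<tau> J} (?g n) + integral {\<tau> J..\<tau> r} (?g n) + integral {\<tau> r..t} (?g n)"
        using integral_split[OF z_coherence_int, of 0 "\<tau> r" t n] integral_split[OF z_coherence_int, of 0 "\<tau> J" "\<tau> r" n] p le r tr
        by auto
      then have "cmod (integral {0..t} (?g n))
          \<le> cmod (integral {0..\<tau> J} (?g n)) + cmod (integral {\<tau> J..\<tau> r} (?g n)) + cmod (integral {\<tau> r..t} (?g n))"
        by (metis (no_types, lifting) norm_add_rule_thm order_refl)
      moreover have "cmod (integral {\<tau> J..\<tau> r} (?g n))
         \<le> cmod (coherence n (\<tau> J) * integral {\<tau> J..\<tau> N} (z n))
          + cmod (coherence n (\<tau> r) * integral {\<tau> r..\<tau> N} (z n))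
          + (\<Sum>j=J..<r. cmod ((coherence n (\<tau> (Suc j)) - coherence n (\<tau> j)) * integral {\<tau> (Suc j)..\<tau> N} (z n))
            + cmod (integral {\<tau> j..\<tau> (Suc j)} (\<lambda>s. z n s * (coherence n s - coherence n (\<tau> j)))))"
        unfolding block_abel_identity[OF mono pos r(2) less_imp_le[OF rN]]
        by (intro order_trans[OF norm_triangle_ineq] add_mono order_trans[OF norm_triangle_ineq4]
              order_trans[OF norm_sum] sum_mono norm_triangle_ineq order_refl)
      ultimately show ?thesis by linarith
    qed
    have "(\<Sum>n<L. d n * cmod (integral {0..t} (?g n)))
       \<le> (\<Sum>n<L. d n * (cmod (integral {0..\<tau> J} (?g n)) + (cmod (coherence n (\<tau> J) * integral {\<tau> J..\<tau> N} (z n))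
          + cmod (coherence n (\<tau> r) * integral {\<tau> r..\<tau> N} (z n))
          + (\<Sum>j=J..<r. cmod ((coherence n (\<tau> (Suc j)) - coherence n (\<tau> j)) * integral {\<tau> (Suc j)..\<tau> N} (z n))
            + cmod (integral {\<tau> j..\<tau> (Suc j)} (\<lambda>s. z n s * (coherence n s - coherence n (\<tau> j))))))
          + cmod (integral {\<tau> r..t} (?g n))))"
      by (intro sum_mono mult_left_mono pt d)
    also have "\<dots> = (\<Sum>n<L. d n * cmod (integral {0..\<tau> J} (?g n)))
          + ((\<Sum>n<L. d n * cmod (coherence n (\<tau> J) * integral {\<tau> J..\<tau> N} (z n)))
          + (\<Sum>n<L. d n * cmod (coherence n (\<tau> r) * integral {\<tau> r..\<tau> N} (z n)))
          + (\<Sum>j=J..<r. (\<Sum>n<L. d n * cmod ((coherence n (\<tau> (Suc j)) - coherence n (\<tau> j)) * integral {\<tau> (Suc j)..\<tau> N} (z n)))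
            + (\<Sum>n<L. d n * cmod (integral {\<tau> j..\<tau> (Suc j)} (\<lambda>s. z n s * (coherence n s - coherence n (\<tau> j)))))))
          + (\<Sum>n<L. d n * cmod (integral {\<tau> r..t} (?g n)))"
      unfolding distrib_left sum.distrib sum_distrib_left
      by (simp only: sum.swap[of _ "{J..<r}" "{..<L}"])
    also have "\<dots> \<le> q * action 0 (\<tau> J) + (q * F J + q * F r
          + (\<Sum>j=J..<r. q * (b j * F (Suc j)) + q * (b j)\<^sup>2)) + q * b r"
      by (intro add_mono first last boundary sum_mono incr rem) (use r rN JN in auto)
    also have "\<dots> = q * (action 0 (\<tau> J) + F J + F r + (\<Sum>j=J..<r. b j * F (Suc j)) + (\<Sum>j=J..<r. (b j)\<^sup>2) + b r)"
      by (simp add: algebra_simps sum.distrib sum_distrib_left)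
    also have "\<dots> \<le> q * (action 0 (\<tau> J) + sqrt \<Phi> + sqrt \<Phi> + sqrt \<beta> * sqrt \<Phi> + \<beta> + sqrt \<beta>)"
    proof (intro mult_left_mono[OF _ q0] add_mono order_refl)
      have FF: "F j \<le> sqrt \<Phi>" if "J \<le> j" "j \<le> N" for j
      proof (rule real_le_rsqrt)
        show "(F j)\<^sup>2 \<le> \<Phi>"
          by (rule order_trans[OF member_le_sum \<Phi>]) (use that in auto)
      qed
      show "F J \<le> sqrt \<Phi>" "F r \<le> sqrt \<Phi>"
        using FF r rN JN by auto
      show "b r \<le> sqrt \<beta>"
      proof (rule real_le_rsqrt)
        show "(b r)\<^sup>2 \<le> \<beta>"
          by (rule order_trans[OF member_le_sum \<beta>]) (use r rN in auto)
      qed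
      have bb: "(\<Sum>j=J..<r. (b j)\<^sup>2) \<le> \<beta>"
        by (rule order_trans[OF sum_mono2 \<beta>]) (use rN in auto)
      then show "(\<Sum>j=J..<r. (b j)\<^sup>2) \<le> \<beta>" .
      have "(\<Sum>j=J..<r. (F (Suc j))\<^sup>2) = (\<Sum>j\<in>Suc ` {J..<r}. (F j)\<^sup>2)"
        by (subst sum.reindex) auto
      also have "\<dots> \<le> \<Phi>"
        by (rule order_trans[OF sum_mono2 \<Phi>]) (use rN in auto)
      finally have ff: "(\<Sum>j=J..<r. (F (Suc j))\<^sup>2) \<le> \<Phi>" .
      have "(\<Sum>j=J..<r. b j * F (Suc j))\<^sup>2 \<le> (\<Sum>j=J..<r. (b j)\<^sup>2) * (\<Sum>j=J..<r. (F (Suc j))\<^sup>2)"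
        by (rule Cauchy_Schwarz_ineq_sum)
      also have "\<dots> \<le> \<beta> * \<Phi>"
        by (intro mult_mono bb ff \<beta>0 sum_nonneg) auto
      finally show "(\<Sum>j=J..<r. b j * F (Suc j)) \<le> sqrt \<beta> * sqrt \<Phi>"
        unfolding real_sqrt_mult[symmetric] by (rule real_le_rsqrt)
    qed
    also have "\<dots> = q * (action 0 (\<tau> J) + sqrt \<beta> + \<beta> + (2 + sqrt \<beta>) * sqrt \<Phi>)"
      by (simp add: algebra_simps)
    finally show ?thesis .
  qed
qed

end

text \<open>
  In the recursion step, \<open>16\<close> is the factor \<open>8\<close> from the nearby masses times the factor \<open>2\<close> in the flux, and
  the summand \<open>1\<close> is the initial value of the moment.
\<close>

primrec moment_const :: "nat \<Rightarrow> real" where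
  "moment_const 0 = 1"
| "moment_const (Suc m) = 1 + 16 * (real (Suc m) * 3 ^ m) * moment_const m"

lemma moment_const_ge_1: "1 \<le> moment_const m"
  by (induction m) auto

context jacobi_flow
begin

text \<open>
  By induction on \<open>m\<close>: the moment of order \<open>m+1\<close> is \<open>1\<close> minus the time integral of fluxes that are
  weighted by increments of size \<open>weight L m\<close>, so that a multiple of the bound on the moment of order \<open>m\<close>
  can serve as \<open>q\<close> in the estimate of the oscillatory integrals.
\<close>

lemma moment_bound:
  fixes \<tau> b F :: "nat \<Rightarrow> real" and L N J :: nat
  assumes mono: "mono \<tau>" and pos: "0 \<le> \<tau> 0"
    and b: "\<And>j. J \<le> j \<Longrightarrow> j < N \<Longrightarrow> action (\<tau> j) (\<tau> (Suc j)) \<le> b j"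
    and F: "\<And>j n. J \<le> j \<Longrightarrow> j \<le> N \<Longrightarrow> cmod (integral {\<tau> j..\<tau> N} (z n)) \<le> F j"
    and \<beta>: "(\<Sum>j=J..<N. (b j)\<^sup>2) \<le> \<beta>" and \<Phi>: "(\<Sum>j=J..N. (F j)\<^sup>2) \<le> \<Phi>"
    and L: "0 < L" and t: "t \<in> {0..\<tau> N}"
  shows "moment L m t
     \<le> moment_const m * (1 + (action 0 (\<tau> J) + sqrt \<beta> + \<beta> + (2 + sqrt \<beta>) * sqrt \<Phi>)) ^ m"
  using t
proof (induction m arbitrary: t)
  case 0
  then show ?case by (simp add: moment_zero)
next
  case (Suc m)
  define R where "R = action 0 (\<tau> J) + sqrt \<beta> + \<beta> + (2 + sqrt \<beta>) * sqrt \<Phi>"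
  have \<beta>0: "0 \<le> \<beta>"
    using \<beta> by (rule order_trans[OF sum_nonneg, rotated]) simp
  have \<Phi>0: "0 \<le> \<Phi>"
    using \<Phi> by (rule order_trans[OF sum_nonneg, rotated]) simp
  have R0: "0 \<le> R"
    unfolding R_def using \<beta>0 \<Phi>0 action_nonneg[of 0 "\<tau> J"] by (intro add_nonneg_nonneg mult_nonneg_nonneg) auto
  have mc: "0 \<le> moment_const m"
    using moment_const_ge_1[of m] by simp
  define K where "K = real (Suc m) * 3 ^ m"
  have K0: "0 \<le> K" by (simp add: K_def)
  let ?Q = "8 * K * (moment_const m * (1 + R) ^ m)"
  have t0: "0 \<le> t"
    using Suc.prems by simp
  have "moment L (Suc m) t = 1 - (\<Sum>n<L. weight_step L (Suc m) n * integral {0..t} (flux n))"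
    by (rule moment_eq_flux[OF t0 L])
  also have "\<dots> \<le> 1 + (\<Sum>n<L. weight_step L (Suc m) n * (2 * cmod (integral {0..t} (\<lambda>s. z n s * coherence n s))))"
  proof -
    have "- integral {0..t} (flux n) \<le> 2 * cmod (integral {0..t} (\<lambda>s. z n s * coherence n s))" for n
    proof -
      have hi: "((\<lambda>s. z n s * coherence n s) has_integral integral {0..t} (\<lambda>s. z n s * coherence n s)) {0..t}"
        by (intro integrable_integral integrable_sub[OF z_coherence_int] order_refl)
      have "(flux n has_integral (- 2) * Im (integral {0..t} (\<lambda>s. z n s * coherence n s))) {0..t}"
        unfolding flux_def[abs_def] by (rule has_integral_mult_right[OF has_integral_Im[OF hi]])
      then have "integral {0..t} (flux n) = - 2 * Im (integral {0..t} (\<lambda>s. z n s * coherence n s))"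
        by (rule integral_unique)
      then show ?thesis
        using abs_Im_le_cmod[of "integral {0..t} (\<lambda>s. z n s * coherence n s)"] by linarith
    qed
    then have "(\<Sum>n<L. weight_step L (Suc m) n * (- integral {0..t} (flux n)))
        \<le> (\<Sum>n<L. weight_step L (Suc m) n * (2 * cmod (integral {0..t} (\<lambda>s. z n s * coherence n s))))"
      by (intro sum_mono mult_left_mono weight_step_nonneg)
    then show ?thesis
      by (simp add: sum_negf)
  qed
  also have "\<dots> = 1 + 2 * (\<Sum>n<L. weight_step L (Suc m) n * cmod (integral {0..t} (\<lambda>s. z n s * coherence n s)))"
    by (simp add: sum_distrib_left mult_ac)
  also have "\<dots> \<le> 1 + 2 * (?Q * R)"
  proof (intro add_left_mono mult_left_mono)
    show "(\<Sum>n<L. weight_step L (Suc m) n * cmod (integral {0..t} (\<lambda>s. z n s * coherence n s))) \<le> ?Q * R"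
      unfolding R_def
    proof (rule weighted_oscillation[OF mono pos weight_step_nonneg _ _ b F \<beta> \<Phi> Suc.prems])
      show "0 \<le> 8 * K * (moment_const m * (1 + (action 0 (\<tau> J) + sqrt \<beta> + \<beta> + (2 + sqrt \<beta>) * sqrt \<Phi>)) ^ m)"
        using K0 mc R0 unfolding R_def[symmetric] by simp
      fix r assume r: "r \<in> {0..\<tau> N}"
      have "(\<Sum>n<L. weight_step L (Suc m) n * nearby_mass n r) \<le> 8 * K * moment L m r"
        unfolding K_def by (rule weighted_nearby_mass_le_moment) (use r L in auto)
      also have "\<dots> \<le> 8 * K * (moment_const m * (1 + R) ^ m)"
        unfolding R_def using K0 by (intro mult_left_mono Suc.IH[OF r]) auto
      finally show "(\<Sum>n<L. weight_step L (Suc m) n * nearby_mass n r)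
          \<le> 8 * K * (moment_const m * (1 + (action 0 (\<tau> J) + sqrt \<beta> + \<beta> + (2 + sqrt \<beta>) * sqrt \<Phi>)) ^ m)"
        unfolding R_def .
    qed
  qed simp
  also have "\<dots> \<le> 1 * (1 + R) ^ Suc m + 16 * K * moment_const m * (1 + R) ^ Suc m"
  proof (rule add_mono)
    show "1 \<le> 1 * (1 + R) ^ Suc m"
      using one_le_power[of "1 + R" "Suc m"] R0 by simp
    have "16 * K * moment_const m * ((1 + R) ^ m * R) \<le> 16 * K * moment_const m * ((1 + R) ^ m * (1 + R))"
      using R0 K0 mc by (intro mult_left_mono) auto
    then show "2 * (?Q * R) \<le> 16 * K * moment_const m * (1 + R) ^ Suc m"
      by (simp add: mult_ac)
  qed
  also have "\<dots> = moment_const (Suc m) * (1 + R) ^ Suc m"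
    by (simp add: K_def distrib_right)
  finally show ?case
    unfolding R_def .
qed

end


section \<open>A Plancherel inequality\<close>

definition fourier :: "(real \<Rightarrow> real) \<Rightarrow> real \<Rightarrow> complex" where
  "fourier f u = (LINT s|lborel. complex_of_real (f s) * iexp (u * s))"

lemma fourier_measurable [measurable]:
  assumes [measurable]: "f \<in> borel_measurable borel"
  shows "fourier f \<in> borel_measurable borel"
  unfolding fourier_def by measurable

lemma fourier_bound:
  assumes f: "integrable lborel f"
  shows "cmod (fourier f u) \<le> (LINT s|lborel. \<bar>f s\<bar>)"
  unfolding fourier_def
  by (rule order_trans[OF integral_norm_bound]) (simp add: norm_mult)

text \<open>
  A probability measure in one variable and an integrable function in the other one make any bounded
  measurable kernel integrable on the product.
\<close>

lemma swap_bounded_kernel: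
  fixes f :: "real \<Rightarrow> complex" and g :: "real \<Rightarrow> real \<Rightarrow> complex"
  assumes M: "prob_space M" and sM [measurable_cong]: "sets M = sets borel"
    and f: "integrable lborel f"
    and g [measurable]: "case_prod g \<in> borel_measurable (borel \<Otimes>\<^sub>M borel)"
    and B: "\<And>x s. cmod (g x s) \<le> B"
  shows "(LINT x|M. LINT s|lborel. f s * g x s) = (LINT s|lborel. f s * (LINT x|M. g x s))"
proof -
  interpret prob_space M by fact
  interpret P: pair_sigma_finite M "lborel :: real measure" ..
  have [measurable]: "f \<in> borel_measurable borel"
    using f by simp
  have B0: "0 \<le> B"
    by (rule order_trans[OF norm_ge_zero B])
  have dom: "integrable lborel (\<lambda>s. f s * g x s)" for x
  proof (rule Bochner_Integration.integrable_bound)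
    show "integrable lborel (\<lambda>s. f s * of_real B)"
      using f by simp
    show "AE s in lborel. norm (f s * g x s) \<le> norm (f s * of_real B)"
      using B B0 by (auto simp: norm_mult intro!: mult_left_mono)
  qed measurable
  have "integrable (M \<Otimes>\<^sub>M lborel) (\<lambda>(x, s). f s * g x s)"
  proof (rule P.Fubini_integrable)
    show "integrable M (\<lambda>x. LINT s|lborel. norm (case (x, s) of (x, s) \<Rightarrow> f s * g x s))"
    proof (rule integrable_const_bound[where B="B * (LINT s|lborel. cmod (f s))"])
      have "(LINT s|lborel. cmod (f s) * cmod (g x s)) \<le> B * (LINT s|lborel. cmod (f s))" for x
      proof -
        have "(LINT s|lborel. cmod (f s * g x s)) \<le> (LINT s|lborel. cmod (f s) * B)"
        proof (rule integral_mono)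
          show "integrable lborel (\<lambda>s. cmod (f s * g x s))"
            using dom[of x] by (rule integrable_norm)
          show "integrable lborel (\<lambda>s. cmod (f s) * B)"
            using f by simp
          show "cmod (f s * g x s) \<le> cmod (f s) * B" for s
            using B by (simp add: norm_mult mult_left_mono)
        qed
        then show ?thesis
          by (simp add: norm_mult mult.commute)
      qed
      then show "AE x in M. norm (LINT s|lborel. norm (case (x, s) of (x, s) \<Rightarrow> f s * g x s))
          \<le> B * (LINT s|lborel. cmod (f s))"
        by (simp add: norm_mult)
    qed measurable
    show "AE x in M. integrable lborel (\<lambda>s. case (x, s) of (x, s) \<Rightarrow> f s * g x s)"
      using dom by simp
  qed measurable
  from P.Fubini_integral[OF this] show ?thesis
    by simp
qed

text \<open>
  Expanding the square as a double integral and averaging the frequency over a Gaussian replaces the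
  oscillating kernel by the characteristic function of the Gaussian, which is positive and integrable.
\<close>

lemma gaussian_mean_fourier_square:
  assumes f: "integrable lborel f"
  shows "(LINT x|std_normal_distribution. fourier f (c * x) * cnj (fourier f (c * x)))
    = (LINT s|lborel. complex_of_real (f s) * (LINT t|lborel. complex_of_real (f t) * complex_of_real (exp (- ((c * (s - t))\<^sup>2) / 2))))"
proof -
  have M: "prob_space std_normal_distribution"
    by (simp add: prob_space_normal_density)
  have sM: "sets std_normal_distribution = sets borel"
    by simp
  have [measurable]: "f \<in> borel_measurable borel"
    using f by simp
  have cf: "integrable lborel (\<lambda>s. complex_of_real (f s))"
    using f by simp
  have char: "(LINT x|std_normal_distribution. iexp (r * x)) = complex_of_real (exp (- (r\<^sup>2) / 2))" for r
    using fun_cong[OF char_std_normal_distribution, of r] by (simp only: char_def)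
  have [measurable]: "cnj \<in> borel_measurable borel"
    by (intro borel_measurable_continuous_onI continuous_intros)
  define A where "A = (LINT s|lborel. \<bar>f s\<bar>)"
  have "(LINT x|std_normal_distribution. fourier f (c * x) * cnj (fourier f (c * x)))
      = (LINT x|std_normal_distribution. LINT s|lborel. complex_of_real (f s) * (iexp (c * x * s) * cnj (fourier f (c * x))))"
  proof (rule Bochner_Integration.integral_cong[OF refl])
    fix x
    have "fourier f (c * x) * cnj (fourier f (c * x))
        = (LINT s|lborel. (complex_of_real (f s) * iexp (c * x * s)) * cnj (fourier f (c * x)))"
      unfolding fourier_def by (rule integral_mult_left_zero[symmetric])
    then show "fourier f (c * x) * cnj (fourier f (c * x))
        = (LINT s|lborel. complex_of_real (f s) * (iexp (c * x * s) * cnj (fourier f (c * x))))"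
      by (simp add: mult.assoc)
  qed
  also have "\<dots> = (LINT s|lborel. complex_of_real (f s) *
        (LINT x|std_normal_distribution. iexp (c * x * s) * cnj (fourier f (c * x))))"
    by (rule swap_bounded_kernel[OF M sM cf, where B = A])
       (measurable, auto simp: norm_mult A_def intro: fourier_bound[OF f])
  also have "\<dots> = (LINT s|lborel. complex_of_real (f s) *
        (LINT t|lborel. complex_of_real (f t) * complex_of_real (exp (- ((c * (s - t))\<^sup>2) / 2))))"
  proof (intro Bochner_Integration.integral_cong[OF refl] arg_cong2[where f="(*)"] refl)
    fix s
    have "(LINT x|std_normal_distribution. iexp (c * x * s) * cnj (fourier f (c * x)))
       = (LINT x|std_normal_distribution. LINT t|lborel. complex_of_real (f t) * iexp (c * (s - t) * x))"
    proof (rule Bochner_Integration.integral_cong[OF refl])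
      fix x
      have "cnj (fourier f (c * x)) = (LINT t|lborel. cnj (complex_of_real (f t) * iexp (c * x * t)))"
        unfolding fourier_def by (rule Bochner_Integration.integral_cnj[symmetric])
      also have "\<dots> = (LINT t|lborel. complex_of_real (f t) * iexp (- (c * x * t)))"
        by (intro Bochner_Integration.integral_cong refl) (simp add: exp_cnj)
      finally have "iexp (c * x * s) * cnj (fourier f (c * x))
          = (LINT t|lborel. iexp (c * x * s) * (complex_of_real (f t) * iexp (- (c * x * t))))"
        by (simp only: integral_mult_right_zero)
      also have "\<dots> = (LINT t|lborel. complex_of_real (f t) * iexp (c * (s - t) * x))"
      proof (intro Bochner_Integration.integral_cong refl)
        fix t
        have "iexp (c * (s - t) * x) = iexp (c * x * s) * iexp (- (c * x * t))"
          unfolding exp_add[symmetric] by (simp add: algebra_simps)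
        then show "iexp (c * x * s) * (complex_of_real (f t) * iexp (- (c * x * t)))
          = complex_of_real (f t) * iexp (c * (s - t) * x)"
          by simp
      qed
      finally show "iexp (c * x * s) * cnj (fourier f (c * x))
          = (LINT t|lborel. complex_of_real (f t) * iexp (c * (s - t) * x))" .
    qed
    also have "\<dots> = (LINT t|lborel. complex_of_real (f t) *
          (LINT x|std_normal_distribution. iexp (c * (s - t) * x)))"
      by (rule swap_bounded_kernel[OF M sM cf, where B = 1]) auto
    also have "\<dots> = (LINT t|lborel. complex_of_real (f t) * complex_of_real (exp (- ((c * (s - t))\<^sup>2) / 2)))"
      by (simp only: char)
    finally show "(LINT x|std_normal_distribution. iexp (c * x * s) * cnj (fourier f (c * x)))
        = (LINT t|lborel. complex_of_real (f t) * complex_of_real (exp (- ((c * (s - t))\<^sup>2) / 2)))" .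
  qed
  finally show ?thesis .
qed

lemma nn_integral_gaussian:
  assumes c: "c > 0"
  shows "(\<integral>\<^sup>+ t. ennreal (exp (- ((c * (s - t))\<^sup>2) / 2)) \<partial>lborel) = ennreal (sqrt (2 * pi) / c)"
proof -
  have "exp (- ((c * (s - t))\<^sup>2) / 2) = sqrt (2 * pi) / c * normal_density s (1 / c) t" for t
    using c by (simp add: normal_density_def power2_eq_square real_sqrt_mult real_sqrt_divide field_simps)
  then have "(\<integral>\<^sup>+ t. ennreal (exp (- ((c * (s - t))\<^sup>2) / 2)) \<partial>lborel)
      = (\<integral>\<^sup>+ t. ennreal (sqrt (2 * pi) / c) * ennreal (normal_density s (1 / c) t) \<partial>lborel)"
    using c by (simp add: ennreal_mult[symmetric])
  also have "\<dots> = ennreal (sqrt (2 * pi) / c) * (\<integral>\<^sup>+ t. ennreal (normal_density s (1 / c) t) \<partial>lborel)"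
    by (rule nn_integral_cmult) simp
  also have "(\<integral>\<^sup>+ t. ennreal (normal_density s (1 / c) t) \<partial>lborel) = 1"
    using c by (subst nn_integral_eq_integral) auto
  finally show ?thesis by simp
qed

text \<open>
  Schur's test: \<open>|f s f t| \<le> (f s\<^sup>2 + f t\<^sup>2) / 2\<close>, and the kernel has the same integral in either variable.
\<close>

lemma gaussian_form_bound:
  assumes f: "integrable lborel f" and c: "c > 0"
  shows "ennreal (cmod (LINT s|lborel. complex_of_real (f s) *
            (LINT t|lborel. complex_of_real (f t) * complex_of_real (exp (- ((c * (s - t))\<^sup>2) / 2)))))
     \<le> ennreal (sqrt (2 * pi) / c) * (\<integral>\<^sup>+ s. ennreal ((f s)\<^sup>2) \<partial>lborel)"
proof -
  have [measurable]: "f \<in> borel_measurable borel"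
    using f by simp
  let ?G = "\<lambda>s t. exp (- ((c * (s - t))\<^sup>2) / 2) :: real"
  have pos: "0 \<le> ?G s t" for s t by simp
  have int: "integrable lborel (\<lambda>t::real. complex_of_real (f t) * complex_of_real (?G s t))" for s :: real
    by (rule Bochner_Integration.integrable_bound[OF f]) (auto simp: norm_mult intro!: mult_left_le)
  have "ennreal (cmod (LINT s|lborel. complex_of_real (f s) * (LINT t|lborel. complex_of_real (f t) * complex_of_real (?G s t))))
      \<le> (\<integral>\<^sup>+ s. ennreal (cmod (complex_of_real (f s) * (LINT t|lborel. complex_of_real (f t) * complex_of_real (?G s t)))) \<partial>lborel)"
    by (cases "integrable lborel (\<lambda>s. complex_of_real (f s) * (LINT t|lborel. complex_of_real (f t) * complex_of_real (?G s t)))")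
       (auto intro: integral_norm_bound_ennreal simp: not_integrable_integral_eq)
  also have "\<dots> \<le> (\<integral>\<^sup>+ s. (\<integral>\<^sup>+ t. ennreal (\<bar>f s\<bar> * \<bar>f t\<bar> * ?G s t) \<partial>lborel) \<partial>lborel)"
  proof (rule nn_integral_mono)
    fix s :: real
    have "ennreal (cmod (LINT t|lborel. complex_of_real (f t) * complex_of_real (?G s t)))
        \<le> (\<integral>\<^sup>+ t. ennreal (cmod (complex_of_real (f t) * complex_of_real (?G s t))) \<partial>lborel)"
      by (rule integral_norm_bound_ennreal[OF int])
    then have "ennreal \<bar>f s\<bar> * ennreal (cmod (LINT t|lborel. complex_of_real (f t) * complex_of_real (?G s t)))
        \<le> ennreal \<bar>f s\<bar> * (\<integral>\<^sup>+ t. ennreal (\<bar>f t\<bar> * ?G s t) \<partial>lborel)"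
      by (intro mult_left_mono) (simp_all add: norm_mult)
    also have "\<dots> = (\<integral>\<^sup>+ t. ennreal (\<bar>f s\<bar> * \<bar>f t\<bar> * ?G s t) \<partial>lborel)"
      by (subst nn_integral_cmult[symmetric]) (auto simp: ennreal_mult[symmetric] mult.assoc)
    finally show "ennreal (cmod (complex_of_real (f s) * (LINT t|lborel. complex_of_real (f t) * complex_of_real (?G s t))))
        \<le> (\<integral>\<^sup>+ t. ennreal (\<bar>f s\<bar> * \<bar>f t\<bar> * ?G s t) \<partial>lborel)"
      by (simp add: norm_mult ennreal_mult)
  qed
  also have "\<dots> \<le> (\<integral>\<^sup>+ s. (\<integral>\<^sup>+ t. ennreal ((f s)\<^sup>2 / 2) * ennreal (?G s t) + ennreal ((f t)\<^sup>2 / 2) * ennreal (?G s t) \<partial>lborel) \<partial>lborel)"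
  proof (intro nn_integral_mono)
    fix s t :: real
    have "\<bar>f s\<bar> * \<bar>f t\<bar> \<le> (f s)\<^sup>2 / 2 + (f t)\<^sup>2 / 2"
      using sum_squares_bound[of "\<bar>f s\<bar>" "\<bar>f t\<bar>"] by simp
    then have "\<bar>f s\<bar> * \<bar>f t\<bar> * ?G s t \<le> (f s)\<^sup>2 / 2 * ?G s t + (f t)\<^sup>2 / 2 * ?G s t"
      unfolding distrib_right[symmetric] by (intro mult_right_mono pos)
    then show "ennreal (\<bar>f s\<bar> * \<bar>f t\<bar> * ?G s t)
       \<le> ennreal ((f s)\<^sup>2 / 2) * ennreal (?G s t) + ennreal ((f t)\<^sup>2 / 2) * ennreal (?G s t)"
      by (simp add: ennreal_mult[symmetric] ennreal_plus[symmetric] ennreal_leI del: ennreal_plus)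
  qed
  also have "\<dots> = (\<integral>\<^sup>+ s. ennreal ((f s)\<^sup>2 / 2) * (\<integral>\<^sup>+ t. ennreal (?G s t) \<partial>lborel) \<partial>lborel)
       + (\<integral>\<^sup>+ s. (\<integral>\<^sup>+ t. ennreal ((f t)\<^sup>2 / 2) * ennreal (?G s t) \<partial>lborel) \<partial>lborel)"
    by (simp add: nn_integral_add nn_integral_cmult)
  also have "(\<integral>\<^sup>+ s. (\<integral>\<^sup>+ t. ennreal ((f t)\<^sup>2 / 2) * ennreal (?G s t) \<partial>lborel) \<partial>lborel)
       = (\<integral>\<^sup>+ t. (\<integral>\<^sup>+ s. ennreal ((f t)\<^sup>2 / 2) * ennreal (?G s t) \<partial>lborel) \<partial>lborel)"
    by (rule lborel_pair.Fubini') measurable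
  also have "\<dots> = (\<integral>\<^sup>+ t. ennreal ((f t)\<^sup>2 / 2) * (\<integral>\<^sup>+ s. ennreal (?G t s) \<partial>lborel) \<partial>lborel)"
  proof -
    have "?G s t = ?G t s" for s t
      by (simp add: power2_eq_square algebra_simps)
    then show ?thesis
      by (simp add: nn_integral_cmult)
  qed
  also have "(\<integral>\<^sup>+ s. ennreal ((f s)\<^sup>2 / 2) * (\<integral>\<^sup>+ t. ennreal (?G s t) \<partial>lborel) \<partial>lborel)
     + (\<integral>\<^sup>+ t. ennreal ((f t)\<^sup>2 / 2) * (\<integral>\<^sup>+ s. ennreal (?G t s) \<partial>lborel) \<partial>lborel)
     = (\<integral>\<^sup>+ s. ennreal ((f s)\<^sup>2 / 2) + ennreal ((f s)\<^sup>2 / 2) \<partial>lborel) * ennreal (sqrt (2 * pi) / c)"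
    unfolding nn_integral_gaussian[OF c]
    by (simp add: nn_integral_multc nn_integral_add distrib_right)
  also have "(\<integral>\<^sup>+ s. ennreal ((f s)\<^sup>2 / 2) + ennreal ((f s)\<^sup>2 / 2) \<partial>lborel) = (\<integral>\<^sup>+ s. ennreal ((f s)\<^sup>2) \<partial>lborel)"
    by (simp add: ennreal_plus[symmetric] del: ennreal_plus)
  finally show ?thesis
    by (simp add: mult.commute)
qed

definition plancherel_const :: real where
  "plancherel_const = 2 * pi * exp (1 / 2)"

text \<open>
  Only the inequality is proved, so the constant may be generous: on \<open>{-c..c}\<close> the Lebesgue measure is
  dominated by a multiple of the Gaussian measure of width \<open>c\<close>, with a factor proportional to \<open>c\<close>, and
  this factor cancels against the \<open>1 / c\<close> in the bound for the Gaussian mean. Then \<open>c\<close> tends to infinity.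
\<close>

lemma plancherel_inequality:
  assumes f: "integrable lborel f"
  shows "(\<integral>\<^sup>+ u. ennreal ((cmod (fourier f u))\<^sup>2) \<partial>lborel)
     \<le> ennreal plancherel_const * (\<integral>\<^sup>+ s. ennreal ((f s)\<^sup>2) \<partial>lborel)"
proof -
  have [measurable]: "f \<in> borel_measurable borel"
    using f by simp
  let ?g = "\<lambda>u. ennreal ((cmod (fourier f u))\<^sup>2)"
  define S where "S = (\<integral>\<^sup>+ s. ennreal ((f s)\<^sup>2) \<partial>lborel)"
  define A where "A = (LINT s|lborel. \<bar>f s\<bar>)"
  interpret N: prob_space std_normal_distribution
    by (simp add: prob_space_normal_density)
  have loc: "(\<integral>\<^sup>+ u. ?g u * indicator {-c..c} u \<partial>lborel) \<le> ennreal plancherel_const * S" if c: "c > 0" for c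
  proof -
    have int: "integrable std_normal_distribution (\<lambda>x. (cmod (fourier f (c * x)))\<^sup>2)"
    proof (rule N.integrable_const_bound[where B="A\<^sup>2"])
      show "AE x in std_normal_distribution. norm ((cmod (fourier f (c * x)))\<^sup>2) \<le> A\<^sup>2"
        using fourier_bound[OF f] by (auto simp: A_def intro!: power_mono)
    qed measurable
    have "(\<integral>\<^sup>+ x. ennreal (std_normal_density x) * ?g (c * x) \<partial>lborel)
        = (\<integral>\<^sup>+ x. ?g (c * x) \<partial>std_normal_distribution)"
      by (subst nn_integral_density) auto
    also have "\<dots> = ennreal (LINT x|std_normal_distribution. (cmod (fourier f (c * x)))\<^sup>2)"
      by (rule nn_integral_eq_integral[OF int]) auto
    also have "(LINT x|std_normal_distribution. (cmod (fourier f (c * x)))\<^sup>2)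
        = cmod (LINT x|std_normal_distribution. complex_of_real ((cmod (fourier f (c * x)))\<^sup>2))"
      by (subst integral_complex_of_real) (simp add: norm_of_real del: of_real_power)
    also have "\<dots> = cmod (LINT x|std_normal_distribution. fourier f (c * x) * cnj (fourier f (c * x)))"
      by (simp add: complex_norm_square del: of_real_power)
    also have "ennreal \<dots> \<le> ennreal (sqrt (2 * pi) / c) * S"
      unfolding gaussian_mean_fourier_square[OF f] S_def by (rule gaussian_form_bound[OF f c])
    finally have up: "(\<integral>\<^sup>+ x. ennreal (std_normal_density x) * ?g (c * x) \<partial>lborel)
        \<le> ennreal (sqrt (2 * pi) / c) * S" .
    define k where "k = sqrt (2 * pi) * exp (1 / 2)"
    have k0: "0 \<le> k"
      by (simp add: k_def)
    have "(\<integral>\<^sup>+ u. ?g u * indicator {-c..c} u \<partial>lborel)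
        = ennreal c * (\<integral>\<^sup>+ x. ?g (c * x) * indicator {-c..c} (c * x) \<partial>lborel)"
      using nn_integral_real_affine[of "\<lambda>u. ?g u * indicator {-c..c} u" c 0] c by simp
    also have "\<dots> \<le> ennreal c * (\<integral>\<^sup>+ x. ennreal k * (ennreal (std_normal_density x) * ?g (c * x)) \<partial>lborel)"
    proof (intro mult_left_mono nn_integral_mono)
      fix x
      show "?g (c * x) * indicator {-c..c} (c * x) \<le> ennreal k * (ennreal (std_normal_density x) * ?g (c * x))"
      proof (cases "c * x \<in> {-c..c}")
        case True
        then have "c * \<bar>x\<bar> \<le> c * 1"
          using c abs_le_iff[of "c * x" c] by (auto simp: abs_mult)
        then have "\<bar>x\<bar> \<le> 1"
          using c by (simp only: mult_le_cancel_left_pos)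
        then have "x\<^sup>2 \<le> 1"
          using abs_square_le_1 by blast
        \<comment> \<open>The Gaussian density is at least \<open>exp (- 1 / 2)\<close> times its maximum within one standard deviation.\<close>
        then have "1 \<le> exp (1 / 2) * exp (- x\<^sup>2 / 2)"
          unfolding exp_add[symmetric] by (simp add: field_simps)
        then have "1 \<le> k * std_normal_density x"
          by (simp add: std_normal_density_def k_def mult_ac)
        then have "1 * (cmod (fourier f (c * x)))\<^sup>2 \<le> k * std_normal_density x * (cmod (fourier f (c * x)))\<^sup>2"
          by (rule mult_right_mono) simp
        then show ?thesis
          using True k0 by (simp add: ennreal_mult[symmetric] normal_density_nonneg mult.assoc ennreal_leI)
      next
        case False
        then show ?thesis by simp
      qed
    qed simp
    also have "\<dots> = ennreal c * (ennreal k * (\<integral>\<^sup>+ x. ennreal (std_normal_density x) * ?g (c * x) \<partial>lborel))"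
      by (subst nn_integral_cmult) auto
    also have "\<dots> \<le> ennreal c * (ennreal k * (ennreal (sqrt (2 * pi) / c) * S))"
      by (intro mult_left_mono up) auto
    also have "\<dots> = ennreal (c * (k * (sqrt (2 * pi) / c))) * S"
    proof -
      have e: "ennreal (c * (k * d)) = ennreal c * (ennreal k * ennreal d)" if "0 \<le> d" for d
        using c k0 that by (simp add: ennreal_mult)
      show ?thesis
        using c by (subst e) (simp_all add: mult.assoc)
    qed
    also have "c * (k * (sqrt (2 * pi) / c)) = plancherel_const"
      using c by (simp add: plancherel_const_def k_def field_simps)
    finally show ?thesis .
  qed
  have "(\<integral>\<^sup>+ u. ?g u \<partial>lborel) = (\<integral>\<^sup>+ u. (SUP n. ?g u * indicator {- real (Suc n)..real (Suc n)} u) \<partial>lborel)"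
  proof (intro nn_integral_cong antisym SUP_least)
    fix u :: real
    obtain n :: nat where "\<bar>u\<bar> \<le> real n"
      using real_arch_simple by blast
    then have "u \<in> {- real (Suc n)..real (Suc n)}"
      by auto
    then show "?g u \<le> (SUP n. ?g u * indicator {- real (Suc n)..real (Suc n)} u)"
      by (intro SUP_upper2[of n]) auto
  qed (auto simp: indicator_def)
  also have "\<dots> = (SUP n. \<integral>\<^sup>+ u. ?g u * indicator {- real (Suc n)..real (Suc n)} u \<partial>lborel)"
  proof (rule nn_integral_monotone_convergence_SUP)
    show "incseq (\<lambda>n u. ?g u * indicator {- real (Suc n)..real (Suc n)} u)"
      by (auto simp: incseq_def le_fun_def indicator_def)
  qed measurable
  also have "\<dots> \<le> ennreal plancherel_const * S"
    by (intro SUP_least loc) simp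
  finally show ?thesis
    unfolding S_def .
qed


section \<open>Averaging the oscillatory integrals over the frequency\<close>

text \<open>
  The mean value theorem makes the terms of the series below telescope.
\<close>

lemma powr_step:
  fixes x p :: real
  assumes p: "p > 0" and x: "x > 0"
  shows "(x + 2) powr (- 1 - p) \<le> (1 / p) * (x powr (- p) - (x + 2) powr (- p))"
proof -
  have "\<exists>\<xi>>x. \<xi> < x + 2 \<and> (x + 2) powr (- p) - x powr (- p) = (x + 2 - x) * (- p * \<xi> powr (- p - 1))"
    by (rule MVT2) (use x in \<open>auto intro!: derivative_eq_intros\<close>)
  then obtain \<xi> where \<xi>: "x < \<xi>" "\<xi> < x + 2"
    and eq: "(x + 2) powr (- p) - x powr (- p) = (x + 2 - x) * (- p * \<xi> powr (- p - 1))"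
    by blast
  have "(x + 2) powr (- 1 - p) \<le> \<xi> powr (- 1 - p)"
    using \<xi> x p by (intro powr_mono2') auto
  also have "\<dots> \<le> 2 * \<xi> powr (- p - 1)"
  proof -
    have "- p - 1 = - 1 - p"
      by simp
    then show ?thesis
      by (simp only:) simp
  qed
  also have "\<dots> = (1 / p) * (x powr (- p) - (x + 2) powr (- p))"
  proof -
    have "x powr (- p) - (x + 2) powr (- p) = p * (2 * \<xi> powr (- p - 1))"
      using eq by simp
    then show ?thesis
      using p by simp
  qed
  finally show ?thesis .
qed

lemma odd_powr_sum_le:
  fixes p :: real
  assumes p: "p > 0" and "n0 \<le> r"
  shows "(\<Sum>n=n0..r. real (2 * n + 1) powr (- 1 - p))
     \<le> (1 + 1 / p) * real (2 * n0 + 1) powr (- p) - (1 / p) * real (2 * r + 1) powr (- p)"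
  using assms(2)
proof (induction r rule: dec_induct)
  case base
  have "real (2 * n0 + 1) powr (- 1 - p) \<le> real (2 * n0 + 1) powr (- p)"
    by (intro powr_mono) auto
  then show ?case
    by (simp add: distrib_right)
next
  case (step r)
  have "real (2 * Suc r + 1) = real (2 * r + 1) + 2"
    by simp
  then have "real (2 * Suc r + 1) powr (- 1 - p)
      \<le> (1 / p) * (real (2 * r + 1) powr (- p) - real (2 * Suc r + 1) powr (- p))"
    using powr_step[OF p, of "real (2 * r + 1)"] by (simp only:)
  then show ?case
    using step by (simp add: right_diff_distrib del: of_nat_Suc of_nat_add of_nat_mult)
qed

text \<open>
  The indicator keeps the indices with \<open>2n+1 > |u| / B\<close>. The tail of \<open>\<Sum> (2n+1)^(-1-p)\<close> beyond that is of
  size \<open>(|u| / B)^(-p)\<close>, which cancels the growth of \<open>|u|^p\<close>.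
\<close>

lemma odd_series_bound:
  fixes p B u :: real
  assumes p: "p > 0" and B: "B > 0"
  shows "(\<Sum>n. ennreal ((\<bar>u\<bar> / real (2 * n + 1)) powr p / real (2 * n + 1)) * indicator {x. \<bar>x\<bar> < B} (u / real (2 * n + 1)))
     \<le> ennreal (B powr p * (1 + 1 / p))"
  unfolding suminf_eq_SUP
proof (rule SUP_least)
  fix M :: nat
  define m where "m n = real (2 * n + 1)" for n :: nat
  have m0: "m n > 0" for n
    by (simp add: m_def)
  have ind: "\<bar>u / m n\<bar> < B \<longleftrightarrow> \<bar>u\<bar> < B * m n" for n
    using m0[of n] by (simp add: field_simps)
  have "\<exists>n. \<bar>u\<bar> < B * m n"
  proof -
    obtain n :: nat where "\<bar>u\<bar> / B < real n"
      using reals_Archimedean2 by blast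
    then have "\<bar>u\<bar> < B * real n"
      using B by (simp add: field_simps)
    also have "\<dots> \<le> B * m n"
      using B by (intro mult_left_mono) (auto simp: m_def)
    finally show ?thesis by blast
  qed
  define n0 where "n0 = (LEAST n. \<bar>u\<bar> < B * m n)"
  have n0: "\<bar>u\<bar> < B * m n0"
    unfolding n0_def by (rule LeastI_ex) fact
  have small: "\<not> \<bar>u\<bar> < B * m n" if "n < n0" for n
    using not_less_Least[of n "\<lambda>n. \<bar>u\<bar> < B * m n"] that unfolding n0_def by blast
  have "(\<Sum>n<M. ennreal ((\<bar>u\<bar> / m n) powr p / m n) * indicator {x. \<bar>x\<bar> < B} (u / m n))
     = (\<Sum>n\<in>{n0..<M}. ennreal ((\<bar>u\<bar> / m n) powr p / m n) * indicator {x. \<bar>x\<bar> < B} (u / m n))"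
  proof (rule sum.mono_neutral_right)
    have "indicator {x. \<bar>x\<bar> < B} (u / m n) = (0 :: ennreal)" if "n < n0" for n
      using small[OF that] unfolding ind[symmetric] by (simp add: indicator_def del: abs_divide)
    then show "\<forall>n\<in>{..<M} - {n0..<M}. ennreal ((\<bar>u\<bar> / m n) powr p / m n) * indicator {x. \<bar>x\<bar> < B} (u / m n) = 0"
      by auto
  qed auto
  also have "\<dots> \<le> (\<Sum>n\<in>{n0..<M}. ennreal ((B * m n0) powr p * m n powr (- 1 - p)))"
  proof (rule sum_mono)
    fix n assume n: "n \<in> {n0..<M}"
    have "(\<bar>u\<bar> / m n) powr p / m n = \<bar>u\<bar> powr p * m n powr (- 1 - p)"
      using m0[of n] by (simp add: powr_divide powr_diff powr_minus field_simps)
    also have "\<dots> \<le> (B * m n0) powr p * m n powr (- 1 - p)"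
      using n0 p by (intro mult_right_mono powr_mono2) auto
    finally show "ennreal ((\<bar>u\<bar> / m n) powr p / m n) * indicator {x. \<bar>x\<bar> < B} (u / m n)
       \<le> ennreal ((B * m n0) powr p * m n powr (- 1 - p))"
      by (auto simp: indicator_def intro: ennreal_leI)
  qed
  also have "\<dots> = ennreal ((B * m n0) powr p * (\<Sum>n\<in>{n0..<M}. m n powr (- 1 - p)))"
    by (simp add: sum_distrib_left)
  also have "\<dots> \<le> ennreal (B powr p * (1 + 1 / p))"
  proof (rule ennreal_leI)
    have "(\<Sum>n\<in>{n0..<M}. m n powr (- 1 - p)) \<le> (\<Sum>n=n0..max n0 M. m n powr (- 1 - p))"
      by (rule sum_mono2) auto
    also have "\<dots> \<le> (1 + 1 / p) * m n0 powr (- p) - (1 / p) * m (max n0 M) powr (- p)"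
      using odd_powr_sum_le[OF p, of n0 "max n0 M"] unfolding m_def by simp
    also have "\<dots> \<le> (1 + 1 / p) * m n0 powr (- p)"
      using p by simp
    finally have "(B * m n0) powr p * (\<Sum>n\<in>{n0..<M}. m n powr (- 1 - p))
        \<le> (B * m n0) powr p * ((1 + 1 / p) * m n0 powr (- p))"
      by (rule mult_left_mono) simp
    also have "\<dots> = B powr p * (1 + 1 / p)"
      using B m0[of n0] by (simp add: powr_mult powr_minus field_simps)
    finally show "(B * m n0) powr p * (\<Sum>n\<in>{n0..<M}. m n powr (- 1 - p)) \<le> B powr p * (1 + 1 / p)" .
  qed
  finally show "(\<Sum>n<M. ennreal ((\<bar>u\<bar> / real (2 * n + 1)) powr p / real (2 * n + 1)) * indicator {x. \<bar>x\<bar> < B} (u / real (2 * n + 1)))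
     \<le> ennreal (B powr p * (1 + 1 / p))"
    unfolding m_def .
qed

text \<open>
  The substitution \<open>u = (2n+1) k\<close> in the term with index \<open>n\<close> moves the summation over \<open>n\<close> onto an explicit
  weight, which is bounded uniformly in \<open>u\<close>. For \<open>p = 0\<close> the weight would be a divergent harmonic series.
\<close>

lemma odd_dilates_average:
  fixes p B :: real and g :: "real \<Rightarrow> ennreal"
  assumes p: "p > 0" and B: "B > 0" and g [measurable]: "g \<in> borel_measurable borel"
  shows "(\<integral>\<^sup>+ k. (\<Sum>n. ennreal (\<bar>k\<bar> powr p) * g (real (2 * n + 1) * k)) * indicator {x. \<bar>x\<bar> < B} k \<partial>lborel)
     \<le> ennreal (B powr p * (1 + 1 / p)) * (\<integral>\<^sup>+ u. g u \<partial>lborel)"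
proof -
  have scale: "(\<integral>\<^sup>+ k. ennreal (\<bar>k\<bar> powr p) * g (real (2 * n + 1) * k) * indicator {x. \<bar>x\<bar> < B} k \<partial>lborel)
     = (\<integral>\<^sup>+ u. ennreal ((\<bar>u\<bar> / real (2 * n + 1)) powr p / real (2 * n + 1)) * indicator {x. \<bar>x\<bar> < B} (u / real (2 * n + 1)) * g u \<partial>lborel)"
    for n :: nat
  proof -
    define m where "m = real (2 * n + 1)"
    have m: "m > 0"
      by (simp add: m_def)
    have "(\<integral>\<^sup>+ u. ennreal ((\<bar>u\<bar> / m) powr p / m) * indicator {x. \<bar>x\<bar> < B} (u / m) * g u \<partial>lborel)
        = ennreal m * (\<integral>\<^sup>+ k. ennreal (\<bar>k\<bar> powr p / m) * indicator {x. \<bar>x\<bar> < B} k * g (m * k) \<partial>lborel)"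
      using nn_integral_real_affine[of "\<lambda>u. ennreal ((\<bar>u\<bar> / m) powr p / m) * indicator {x. \<bar>x\<bar> < B} (u / m) * g u" m 0] m
      by (simp add: abs_mult)
    also have "\<dots> = (\<integral>\<^sup>+ k. ennreal m * (ennreal (\<bar>k\<bar> powr p / m) * indicator {x. \<bar>x\<bar> < B} k * g (m * k)) \<partial>lborel)"
      by (rule nn_integral_cmult[symmetric]) measurable
    also have "\<dots> = (\<integral>\<^sup>+ k. ennreal (\<bar>k\<bar> powr p) * g (m * k) * indicator {x. \<bar>x\<bar> < B} k \<partial>lborel)"
    proof (rule nn_integral_cong)
      fix k :: real
      have "ennreal (\<bar>k\<bar> powr p) = ennreal m * ennreal (\<bar>k\<bar> powr p / m)"
        using m by (simp add: ennreal_mult[symmetric])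
      then show "ennreal m * (ennreal (\<bar>k\<bar> powr p / m) * indicator {x. \<bar>x\<bar> < B} k * g (m * k))
          = ennreal (\<bar>k\<bar> powr p) * g (m * k) * indicator {x. \<bar>x\<bar> < B} k"
        by (simp add: mult_ac)
    qed
    finally show ?thesis
      unfolding m_def by simp
  qed
  have "(\<integral>\<^sup>+ k. (\<Sum>n. ennreal (\<bar>k\<bar> powr p) * g (real (2 * n + 1) * k)) * indicator {x. \<bar>x\<bar> < B} k \<partial>lborel)
      = (\<Sum>n. \<integral>\<^sup>+ k. ennreal (\<bar>k\<bar> powr p) * g (real (2 * n + 1) * k) * indicator {x. \<bar>x\<bar> < B} k \<partial>lborel)"
    by (subst nn_integral_suminf[symmetric]) (auto simp: ennreal_suminf_multc)
  also have "\<dots> = (\<integral>\<^sup>+ u. (\<Sum>n. ennreal ((\<bar>u\<bar> / real (2 * n + 1)) powr p / real (2 * n + 1)) * indicator {x. \<bar>x\<bar> < B} (u / real (2 * n + 1)) * g u) \<partial>lborel)"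
    unfolding scale by (subst nn_integral_suminf[symmetric]) auto
  also have "\<dots> \<le> (\<integral>\<^sup>+ u. ennreal (B powr p * (1 + 1 / p)) * g u \<partial>lborel)"
  proof (rule nn_integral_mono)
    fix u
    show "(\<Sum>n. ennreal ((\<bar>u\<bar> / real (2 * n + 1)) powr p / real (2 * n + 1)) * indicator {x. \<bar>x\<bar> < B} (u / real (2 * n + 1)) * g u)
       \<le> ennreal (B powr p * (1 + 1 / p)) * g u"
      unfolding ennreal_suminf_multc by (rule mult_right_mono[OF odd_series_bound[OF p B]]) simp
  qed
  also have "\<dots> = ennreal (B powr p * (1 + 1 / p)) * (\<integral>\<^sup>+ u. g u \<partial>lborel)"
    by (rule nn_integral_cmult) simp
  finally show ?thesis .
qed

definition window_transform :: "(real \<Rightarrow> real) \<Rightarrow> real \<Rightarrow> real \<Rightarrow> real \<Rightarrow> complex" where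
  "window_transform v a b u = integral {a..b} (\<lambda>\<tau>. complex_of_real (v \<tau>) * cis (u * \<tau>))"

text \<open>
  The window transform is the Fourier transform of a Borel function that agrees with \<open>v\<close> almost
  everywhere on \<open>{a..b}\<close>; the bound in \<open>L\<^sup>2\<close> comes from the decay of \<open>v\<close>, integrated from \<open>a\<close> to infinity,
  and therefore does not depend on \<open>b\<close>.
\<close>

lemma window_transform_L2:
  fixes v :: "real \<Rightarrow> real"
  assumes v: "v absolutely_integrable_on {a..b}" and a: "a > 0" and g: "\<gamma> > 1 / 2"
    and decay: "\<And>t. t \<in> {a..b} \<Longrightarrow> \<bar>v t\<bar> \<le> K * t powr (- \<gamma>)"
  shows "window_transform v a b \<in> borel_measurable borel"
    and "(\<integral>\<^sup>+ u. ennreal ((cmod (window_transform v a b u))\<^sup>2) \<partial>lborel)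
       \<le> ennreal (plancherel_const * K\<^sup>2 / (2 * \<gamma> - 1) * a powr (1 - 2 * \<gamma>))"
proof -
  let ?w = "\<lambda>t. indicator {a..b} t *\<^sub>R v t"
  have wint: "integrable lebesgue ?w"
    using v by (simp add: set_integrable_def)
  obtain f where f [measurable]: "f \<in> borel_measurable lborel" and ae: "AE t in lborel. ?w t = f t"
    using completion_ex_borel_measurable_real[of ?w lborel] wint by auto
  have ae': "AE t in lebesgue. ?w t = f t"
    by (rule AE_completion[OF ae])
  have fm: "f \<in> borel_measurable borel"
    using f by simp
  have fint: "integrable lborel f"
  proof -
    have "integrable lebesgue f"
      by (rule integrable_cong_AE_imp[OF wint]) (use ae' in \<open>auto intro: measurable_completion elim: eventually_mono\<close>)
    then show ?thesis
      using integrable_completion[OF f] by simp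
  qed
  have eq: "fourier f = window_transform v a b"
  proof
    fix u
    have ic: "(\<lambda>t. complex_of_real (v t) * cis (u * t)) absolutely_integrable_on {a..b}"
    proof (rule absolutely_integrable_mult_continuous(2))
      show "continuous_on {a..b} (\<lambda>t. cis (u * t))"
        by (intro continuous_intros)
      show "(\<lambda>t. complex_of_real (v t)) absolutely_integrable_on {a..b}"
        by (rule absolutely_integrable_of_real[OF v])
    qed
    have "fourier f u = (LINT t|lebesgue. complex_of_real (f t) * iexp (u * t))"
      unfolding fourier_def by (rule integral_completion[symmetric]) measurable
    also have "\<dots> = (LINT t|lebesgue. indicator {a..b} t *\<^sub>R (complex_of_real (v t) * cis (u * t)))"
    proof (rule integral_cong_AE)
      show "(\<lambda>t. complex_of_real (f t) * iexp (u * t)) \<in> borel_measurable lebesgue"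
        by (rule measurable_completion) measurable
      show "(\<lambda>t. indicator {a..b} t *\<^sub>R (complex_of_real (v t) * cis (u * t))) \<in> borel_measurable lebesgue"
        using ic unfolding set_integrable_def by (rule borel_measurable_integrable)
      show "AE t in lebesgue. complex_of_real (f t) * iexp (u * t)
          = indicator {a..b} t *\<^sub>R (complex_of_real (v t) * cis (u * t))"
        using ae'
      proof eventually_elim
        case (elim t)
        show ?case
          unfolding elim[symmetric] by (simp add: cis_conv_exp scaleR_conv_of_real)
      qed
    qed
    also have "\<dots> = window_transform v a b u"
      unfolding window_transform_def set_lebesgue_integral_eq_integral(2)[OF ic, symmetric] set_lebesgue_integral_def ..
    finally show "fourier f u = window_transform v a b u" .
  qed
  show "window_transform v a b \<in> borel_measurable borel"
    unfolding eq[symmetric] by (rule fourier_measurable[OF fm])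
  have pc: "0 \<le> plancherel_const"
    by (simp add: plancherel_const_def)
  have "(\<integral>\<^sup>+ s. ennreal ((f s)\<^sup>2) \<partial>lborel) \<le> (\<integral>\<^sup>+ s. ennreal (K\<^sup>2) * (ennreal (s powr (- 2 * \<gamma>)) * indicator {a..} s) \<partial>lborel)"
  proof (rule nn_integral_mono_AE)
    show "AE s in lborel. ennreal ((f s)\<^sup>2) \<le> ennreal (K\<^sup>2) * (ennreal (s powr (- 2 * \<gamma>)) * indicator {a..} s)"
      using ae
    proof eventually_elim
      case (elim s)
      show ?case
      proof (cases "s \<in> {a..b}")
        case True
        have "(v s)\<^sup>2 \<le> (K * s powr (- \<gamma>))\<^sup>2"
          using decay[OF True] by (intro abs_le_square_iff[THEN iffD1]) simp
        also have "\<dots> = K\<^sup>2 * s powr (- 2 * \<gamma>)"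
          using a True by (simp add: power_mult_distrib power2_eq_square powr_add[symmetric])
        finally show ?thesis
          using True elim by (simp add: ennreal_mult[symmetric] ennreal_leI)
      next
        case False
        then show ?thesis
          using elim by simp
      qed
    qed
  qed
  also have "\<dots> = ennreal (K\<^sup>2) * (\<integral>\<^sup>+ s. ennreal (s powr (- 2 * \<gamma>)) * indicator {a..} s \<partial>lborel)"
    by (rule nn_integral_cmult) measurable
  also have "(\<integral>\<^sup>+ s. ennreal (s powr (- 2 * \<gamma>)) * indicator {a..} s \<partial>lborel)
      = ennreal (- (a powr (- 2 * \<gamma> + 1)) / (- 2 * \<gamma> + 1))"
    using g a by (intro nn_integral_has_integral_lebesgue' has_integral_powr_to_inf) auto
  also have "- (a powr (- 2 * \<gamma> + 1)) / (- 2 * \<gamma> + 1) = a powr (1 - 2 * \<gamma>) / (2 * \<gamma> - 1)"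
    using g by (simp add: field_simps)
  finally have L2: "(\<integral>\<^sup>+ s. ennreal ((f s)\<^sup>2) \<partial>lborel) \<le> ennreal (K\<^sup>2) * ennreal (a powr (1 - 2 * \<gamma>) / (2 * \<gamma> - 1))" .
  have "(\<integral>\<^sup>+ u. ennreal ((cmod (fourier f u))\<^sup>2) \<partial>lborel)
      \<le> ennreal plancherel_const * (ennreal (K\<^sup>2) * ennreal (a powr (1 - 2 * \<gamma>) / (2 * \<gamma> - 1)))"
    by (rule order_trans[OF plancherel_inequality[OF fint] mult_left_mono[OF L2]]) simp
  also have "\<dots> = ennreal (plancherel_const * K\<^sup>2 / (2 * \<gamma> - 1) * a powr (1 - 2 * \<gamma>))"
    using g pc by (simp add: ennreal_mult[symmetric] mult_ac)
  finally show "(\<integral>\<^sup>+ u. ennreal ((cmod (window_transform v a b u))\<^sup>2) \<partial>lborel)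
       \<le> ennreal (plancherel_const * K\<^sup>2 / (2 * \<gamma> - 1) * a powr (1 - 2 * \<gamma>))"
    unfolding eq .
qed

text \<open>
  The squares of all the tails at frequency \<open>k\<close>. The factor \<open>(j\<^sup>2 |k|)^p\<close> is at least \<open>1\<close> on the blocks
  that are used for this \<open>k\<close>, and makes the sum over \<open>n\<close> integrable near \<open>k = 0\<close>.
\<close>

definition resonance_sum :: "real \<Rightarrow> (real \<Rightarrow> real) \<Rightarrow> nat \<Rightarrow> real \<Rightarrow> ennreal" where
  "resonance_sum p v N k = (\<Sum>j=1..N. \<Sum>n. ennreal (((real j)\<^sup>2 * \<bar>k\<bar>) powr p
      * (cmod (window_transform v ((real j)\<^sup>2) ((real N)\<^sup>2) (real (2 * n + 1) * k)))\<^sup>2))"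

text \<open>
  The terms with index \<open>j\<close> contribute \<open>j^(2p)\<close> times \<open>(j\<^sup>2)^(1 - 2\<gamma>)\<close>, that is \<open>j^(1/2 - 2\<gamma>)\<close> for this
  \<open>p\<close>, and this exponent is below \<open>-1\<close>. The bound is uniform in \<open>N\<close>.
\<close>

lemma resonance_sum_average:
  fixes v :: "real \<Rightarrow> real"
  assumes v: "\<And>T. v absolutely_integrable_on {0..T}" and g: "\<gamma> > 3 / 4" and B: "B > 0"
    and decay: "\<And>t. t > 0 \<Longrightarrow> \<bar>v t\<bar> \<le> K * t powr (- \<gamma>)"
  defines "p \<equiv> \<gamma> - 3 / 4"
  shows "resonance_sum p v N \<in> borel_measurable borel"
    and "(\<integral>\<^sup>+ k. resonance_sum p v N k * indicator {x. \<bar>x\<bar> < B} k \<partial>lborel)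
       \<le> ennreal (B powr p * (1 + 1 / p) * (plancherel_const * K\<^sup>2 / (2 * \<gamma> - 1)) * (\<Sum>j. real j powr (1 / 2 - 2 * \<gamma>)))"
proof -
  have p: "p > 0"
    using g by (simp add: p_def)
  define W where "W j u = ennreal ((cmod (window_transform v ((real j)\<^sup>2) ((real N)\<^sup>2) u))\<^sup>2)" for j u
  define C where "C = plancherel_const * K\<^sup>2 / (2 * \<gamma> - 1)"
  define D where "D = B powr p * (1 + 1 / p)"
  have C: "0 \<le> C"
    using g by (simp add: C_def plancherel_const_def)
  have D: "0 \<le> D"
    using p by (simp add: D_def)
  have sub: "v absolutely_integrable_on {(real j)\<^sup>2..(real N)\<^sup>2}" for j
    by (rule absolutely_integrable_on_subinterval[OF v[of "(real N)\<^sup>2"]]) auto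
  have decay': "\<bar>v t\<bar> \<le> K * t powr (- \<gamma>)" if "1 \<le> j" "t \<in> {(real j)\<^sup>2..(real N)\<^sup>2}" for j :: nat and t
  proof (rule decay)
    have "0 < (real j)\<^sup>2"
      using that(1) by simp
    then show "0 < t"
      by (rule less_le_trans) (use that(2) in simp)
  qed
  have Wm: "W j \<in> borel_measurable borel" if j: "1 \<le> j" for j
  proof -
    have [measurable]: "window_transform v ((real j)\<^sup>2) ((real N)\<^sup>2) \<in> borel_measurable borel"
      by (rule window_transform_L2(1)[OF sub, where \<gamma>=\<gamma> and K=K]) (use j g decay'[OF j] in auto)
    show ?thesis
      unfolding W_def by measurable
  qed
  have WI: "(\<integral>\<^sup>+ u. W j u \<partial>lborel) \<le> ennreal (C * ((real j)\<^sup>2) powr (1 - 2 * \<gamma>))" if j: "1 \<le> j" for j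
    unfolding W_def C_def
    by (rule window_transform_L2(2)[OF sub]) (use j g decay'[OF j] in auto)
  have rs: "resonance_sum p v N k = (\<Sum>j=1..N. ennreal ((real j) powr (2 * p)) * (\<Sum>n. ennreal (\<bar>k\<bar> powr p) * W j (real (2 * n + 1) * k)))" for k
  proof -
    have "((real j)\<^sup>2 * \<bar>k\<bar>) powr p = real j powr (2 * p) * \<bar>k\<bar> powr p" for j
    proof (cases "j = 0")
      case False
      then have "(real j)\<^sup>2 = real j powr 2"
        by (simp add: powr_numeral)
      then have "((real j)\<^sup>2) powr p = real j powr (2 * p)"
        by (simp only: powr_powr)
      then show ?thesis
        by (simp add: powr_mult)
    qed (use p in auto)
    then show ?thesis
      by (simp add: resonance_sum_def W_def ennreal_mult mult.assoc)
  qed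
  have meas: "(\<lambda>k. \<Sum>n. ennreal (\<bar>k\<bar> powr p) * W j (real (2 * n + 1) * k)) \<in> borel_measurable borel" if "1 \<le> j" for j
  proof -
    have [measurable]: "W j \<in> borel_measurable borel"
      by (rule Wm[OF that])
    show ?thesis by measurable
  qed
  have meas': "(\<lambda>k. (\<Sum>n. ennreal (\<bar>k\<bar> powr p) * W j (real (2 * n + 1) * k)) * indicator {x. \<bar>x\<bar> < B} k) \<in> borel_measurable lborel"
    if "1 \<le> j" for j
  proof -
    have [measurable]: "(\<lambda>k. \<Sum>n. ennreal (\<bar>k\<bar> powr p) * W j (real (2 * n + 1) * k)) \<in> borel_measurable borel"
      by (rule meas[OF that])
    show ?thesis by measurable
  qed
  show "resonance_sum p v N \<in> borel_measurable borel"
    unfolding rs[abs_def] by (intro borel_measurable_sum borel_measurable_times_ennreal borel_measurable_const meas) auto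
  have "(\<integral>\<^sup>+ k. resonance_sum p v N k * indicator {x. \<bar>x\<bar> < B} k \<partial>lborel)
      = (\<integral>\<^sup>+ k. (\<Sum>j=1..N. ennreal ((real j) powr (2 * p)) * ((\<Sum>n. ennreal (\<bar>k\<bar> powr p) * W j (real (2 * n + 1) * k)) * indicator {x. \<bar>x\<bar> < B} k)) \<partial>lborel)"
    unfolding rs sum_distrib_right by (simp only: mult.assoc)
  also have "\<dots> = (\<Sum>j=1..N. \<integral>\<^sup>+ k. ennreal ((real j) powr (2 * p)) * ((\<Sum>n. ennreal (\<bar>k\<bar> powr p) * W j (real (2 * n + 1) * k)) * indicator {x. \<bar>x\<bar> < B} k) \<partial>lborel)"
    by (rule nn_integral_sum, rule borel_measurable_times_ennreal[OF borel_measurable_const meas']) simp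
  also have "\<dots> = (\<Sum>j=1..N. ennreal ((real j) powr (2 * p)) * (\<integral>\<^sup>+ k. (\<Sum>n. ennreal (\<bar>k\<bar> powr p) * W j (real (2 * n + 1) * k)) * indicator {x. \<bar>x\<bar> < B} k \<partial>lborel))"
    by (rule sum.cong[OF refl], rule nn_integral_cmult[OF meas']) simp
  also have "\<dots> \<le> (\<Sum>j=1..N. ennreal ((real j) powr (2 * p)) * (ennreal D * ennreal (C * ((real j)\<^sup>2) powr (1 - 2 * \<gamma>))))"
  proof (intro sum_mono mult_left_mono)
    fix j assume j: "j \<in> {1..N}"
    have "(\<integral>\<^sup>+ k. (\<Sum>n. ennreal (\<bar>k\<bar> powr p) * W j (real (2 * n + 1) * k)) * indicator {x. \<bar>x\<bar> < B} k \<partial>lborel)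
        \<le> ennreal D * (\<integral>\<^sup>+ u. W j u \<partial>lborel)"
      unfolding D_def by (rule odd_dilates_average[OF p B Wm]) (use j in auto)
    also have "\<dots> \<le> ennreal D * ennreal (C * ((real j)\<^sup>2) powr (1 - 2 * \<gamma>))"
      by (intro mult_left_mono WI) (use j in auto)
    finally show "(\<integral>\<^sup>+ k. (\<Sum>n. ennreal (\<bar>k\<bar> powr p) * W j (real (2 * n + 1) * k)) * indicator {x. \<bar>x\<bar> < B} k \<partial>lborel)
        \<le> ennreal D * ennreal (C * ((real j)\<^sup>2) powr (1 - 2 * \<gamma>))" .
  qed simp
  also have "\<dots> = ennreal (\<Sum>j=1..N. D * C * real j powr (1 / 2 - 2 * \<gamma>))"
  proof -
    have "ennreal ((real j) powr (2 * p)) * (ennreal D * ennreal (C * ((real j)\<^sup>2) powr (1 - 2 * \<gamma>)))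
        = ennreal (D * C * real j powr (1 / 2 - 2 * \<gamma>))" if j: "j \<in> {1..N}" for j
    proof -
      have "((real j)\<^sup>2) powr (1 - 2 * \<gamma>) = (real j powr 2) powr (1 - 2 * \<gamma>)"
        using j by (simp add: powr_numeral)
      also have "\<dots> = real j powr (2 - 4 * \<gamma>)"
        unfolding powr_powr by (simp add: algebra_simps)
      finally have "real j powr (2 * p) * ((real j)\<^sup>2) powr (1 - 2 * \<gamma>) = real j powr (2 * p + (2 - 4 * \<gamma>))"
        by (simp add: powr_add)
      also have "2 * p + (2 - 4 * \<gamma>) = 1 / 2 - 2 * \<gamma>"
        by (simp add: p_def)
      finally have "real j powr (2 * p) * (D * (C * ((real j)\<^sup>2) powr (1 - 2 * \<gamma>))) = D * C * real j powr (1 / 2 - 2 * \<gamma>)"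
        by (simp add: mult_ac)
      then show ?thesis
        using C D by (simp add: ennreal_mult[symmetric])
    qed
    then show ?thesis
      using C D by (subst sum_ennreal[symmetric]) (auto intro!: sum.cong)
  qed
  also have "\<dots> \<le> ennreal (D * C * (\<Sum>j. real j powr (1 / 2 - 2 * \<gamma>)))"
  proof (rule ennreal_leI)
    have "summable (\<lambda>j. real j powr (1 / 2 - 2 * \<gamma>))"
      using g by (simp add: summable_real_powr_iff)
    then have "(\<Sum>j=1..N. real j powr (1 / 2 - 2 * \<gamma>)) \<le> (\<Sum>j. real j powr (1 / 2 - 2 * \<gamma>))"
      by (rule sum_le_suminf) auto
    then show "(\<Sum>j=1..N. D * C * real j powr (1 / 2 - 2 * \<gamma>)) \<le> D * C * (\<Sum>j. real j powr (1 / 2 - 2 * \<gamma>))"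
      unfolding sum_distrib_left[symmetric] using C D by (intro mult_left_mono) auto
  qed
  finally show "(\<integral>\<^sup>+ k. resonance_sum p v N k * indicator {x. \<bar>x\<bar> < B} k \<partial>lborel)
       \<le> ennreal (B powr p * (1 + 1 / p) * (plancherel_const * K\<^sup>2 / (2 * \<gamma> - 1)) * (\<Sum>j. real j powr (1 / 2 - 2 * \<gamma>)))"
    unfolding C_def D_def .
qed


section \<open>The evolution equation in the interaction picture\<close>

lemma ell2_diff:
  assumes "f \<in> ell2" "g \<in> ell2"
  shows "(\<lambda>n. f n - g n) \<in> ell2"
proof -
  have s: "summable (\<lambda>n. 2 * (cmod (f n))\<^sup>2 + 2 * (cmod (g n))\<^sup>2)"
    using assms by (intro summable_add summable_mult) (auto simp: ell2_def)
  have b: "norm ((cmod (f n - g n))\<^sup>2) \<le> 2 * (cmod (f n))\<^sup>2 + 2 * (cmod (g n))\<^sup>2" for n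
  proof -
    have "(cmod (f n - g n))\<^sup>2 \<le> (cmod (f n) + cmod (g n))\<^sup>2"
      by (intro power_mono norm_triangle_ineq4) simp
    also have "\<dots> \<le> 2 * (cmod (f n))\<^sup>2 + 2 * (cmod (g n))\<^sup>2"
      using sum_squares_bound[of "cmod (f n)" "cmod (g n)"] by (simp add: power2_sum)
    finally show ?thesis by simp
  qed
  have "summable (\<lambda>n. (cmod (f n - g n))\<^sup>2)"
    by (rule summable_comparison_test'[OF s b])
  then show ?thesis
    by (simp add: ell2_def)
qed

lemma cmod_le_ell2_norm:
  assumes "f \<in> ell2"
  shows "cmod (f n) \<le> ell2_norm f"
  unfolding ell2_norm_def
proof (rule real_le_rsqrt)
  have "(\<Sum>i\<in>{n}. (cmod (f i))\<^sup>2) \<le> (\<Sum>i. (cmod (f i))\<^sup>2)"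
    by (rule sum_le_suminf) (use assms in \<open>auto simp: ell2_def\<close>)
  then show "(cmod (f n))\<^sup>2 \<le> (\<Sum>i. (cmod (f i))\<^sup>2)"
    by simp
qed

lemma ell2_continuous_coordinate:
  assumes X: "ell2_continuous_on S X"
  shows "continuous_on S (\<lambda>t. X t n)"
  unfolding continuous_on
proof
  fix t assume t: "t \<in> S"
  have lim: "((\<lambda>\<tau>. ell2_norm (\<lambda>n. X \<tau> n - X t n)) \<longlongrightarrow> 0) (at t within S)"
    using X t by (simp add: ell2_continuous_on_def)
  have "((\<lambda>\<tau>. X \<tau> n - X t n) \<longlongrightarrow> 0) (at t within S)"
  proof (rule Lim_null_comparison[OF _ lim])
    show "\<forall>\<^sub>F \<tau> in at t within S. norm (X \<tau> n - X t n) \<le> ell2_norm (\<lambda>n. X \<tau> n - X t n)"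
      unfolding eventually_at_filter
    proof (intro always_eventually allI impI)
      fix \<tau> assume "\<tau> \<in> S"
      then have "(\<lambda>n. X \<tau> n - X t n) \<in> ell2"
        using X t by (intro ell2_diff) (auto simp: ell2_continuous_on_def)
      then show "norm (X \<tau> n - X t n) \<le> ell2_norm (\<lambda>n. X \<tau> n - X t n)"
        by (rule cmod_le_ell2_norm)
    qed
  qed
  then show "((\<lambda>t. X t n) \<longlongrightarrow> X t n) (at t within S)"
    by (rule LIM_zero_cancel)
qed

text \<open>
  Norm continuity bounds all coordinates near each point by one constant; compactness does the rest.
\<close>

lemma ell2_continuous_bounded:
  assumes X: "ell2_continuous_on S X" and "compact K" "K \<subseteq> S"
  shows "\<exists>B. \<forall>t\<in>K. \<forall>n. cmod (X t n) \<le> B"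
proof (rule ccontr)
  assume "\<nexists>B. \<forall>t\<in>K. \<forall>n. cmod (X t n) \<le> B"
  then have "\<forall>m::nat. \<exists>t\<in>K. \<exists>n. real m < cmod (X t n)"
    by (meson not_le)
  then obtain t n where tK: "\<And>m. t m \<in> K" and big: "\<And>m::nat. real m < cmod (X (t m) (n m))"
    by metis
  obtain l r where l: "l \<in> K" and r: "strict_mono (r :: nat \<Rightarrow> nat)" and lim: "(t \<circ> r) \<longlonglongrightarrow> l"
    using \<open>compact K\<close> tK unfolding compact_def by metis
  have lS: "l \<in> S"
    using l assms(3) by auto
  have "((\<lambda>\<tau>. ell2_norm (\<lambda>n. X \<tau> n - X l n)) \<longlongrightarrow> 0) (at l within S)"
    using X lS by (simp add: ell2_continuous_on_def)
  then have "\<forall>\<^sub>F \<tau> in at l within S. ell2_norm (\<lambda>n. X \<tau> n - X l n) < 1"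
    by (rule order_tendstoD(2)) simp
  then obtain d where d: "d > 0"
    and near: "\<And>\<tau>. \<tau> \<in> S \<Longrightarrow> \<tau> \<noteq> l \<Longrightarrow> dist \<tau> l < d \<Longrightarrow> ell2_norm (\<lambda>n. X \<tau> n - X l n) < 1"
    unfolding eventually_at by blast
  have le: "cmod (X \<tau> i) \<le> ell2_norm (X l) + 1" if \<tau>: "\<tau> \<in> S" "dist \<tau> l < d" for \<tau> i
  proof (cases "\<tau> = l")
    case True
    then show ?thesis
      using cmod_le_ell2_norm[of "X l" i] X lS by (auto simp: ell2_continuous_on_def)
  next
    case False
    have "(\<lambda>n. X \<tau> n - X l n) \<in> ell2"
      using X lS \<tau> by (intro ell2_diff) (auto simp: ell2_continuous_on_def)
    from cmod_le_ell2_norm[OF this, of i] near[OF \<tau>(1) False \<tau>(2)]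
    have "cmod (X \<tau> i - X l i) \<le> 1" by simp
    moreover have "cmod (X l i) \<le> ell2_norm (X l)"
      using X lS by (intro cmod_le_ell2_norm) (auto simp: ell2_continuous_on_def)
    moreover have "cmod (X \<tau> i) \<le> cmod (X l i) + cmod (X \<tau> i - X l i)"
      using norm_triangle_ineq[of "X l i" "X \<tau> i - X l i"] by simp
    ultimately show ?thesis by linarith
  qed
  have "\<forall>\<^sub>F m in sequentially. dist ((t \<circ> r) m) l < d"
    using lim d by (rule tendstoD)
  moreover have "\<forall>\<^sub>F m in sequentially. ell2_norm (X l) + 1 < real m"
    by (rule filterlim_at_top_dense[THEN iffD1, rule_format, OF filterlim_real_sequentially])
  ultimately have "\<forall>\<^sub>F m in sequentially. False"
  proof eventually_elim
    case (elim m)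
    have "real m \<le> real (r m)"
      using r by (simp add: seq_suble)
    also have "\<dots> < cmod (X (t (r m)) (n (r m)))"
      by (rule big)
    also have "\<dots> \<le> ell2_norm (X l) + 1"
      using elim(1) tK[of "r m"] assms(3) by (intro le) auto
    finally show ?case
      using elim(2) by simp
  qed
  then show False by simp
qed

text \<open>
  The gaps \<open>(n+1)\<^sup>2 - n\<^sup>2 = 2n+1\<close> between neighbouring eigenvalues become the frequencies of the couplings.
\<close>

lemma duhamel_imp_jacobi_flow:
  assumes v: "\<And>T. v absolutely_integrable_on {0..T}"
    and sol: "duhamel_solution v k X"
  shows "jacobi_flow v (\<lambda>n t. complex_of_real (v t) * cis (real (2 * n + 1) * k * t))
           (\<lambda>n t. cis (- (k * t * (real n)\<^sup>2)) * X t n)"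
proof (rule jacobi_flow.intro)
  let ?z = "\<lambda>n t. complex_of_real (v t) * cis (real (2 * n + 1) * k * t)"
  let ?y = "\<lambda>n t. cis (- (k * t * (real n)\<^sup>2)) * X t n"
  note solD = sol[unfolded duhamel_solution_def]
  have X: "ell2_continuous_on {0..} X"
    by (rule conjunct1[OF solD])
  have duh: "X t n = free_evol k t delta0 n +
        \<i> * (LINT \<tau>:{0..t}|lebesgue. free_evol k (t - \<tau>) (toeplitz (v \<tau>) (X \<tau>)) n)" if "0 \<le> t" for t n
    by (rule conjunct2[OF solD, rule_format, OF that])
  note vc = absolutely_integrable_of_real[OF v]
  have Xc: "continuous_on {0..T} (\<lambda>t. X t n)" for T n
    by (rule continuous_on_subset[OF ell2_continuous_coordinate[OF X]]) auto
  show "v absolutely_integrable_on {0..T}" for T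
    by (rule v)
  show "?z n absolutely_integrable_on {0..T}" for n T
    by (rule absolutely_integrable_mult_continuous(2)[OF _ vc]) (intro continuous_intros)
  show "cmod (?z n t) \<le> \<bar>v t\<bar>" for n t
    by (simp add: norm_mult)
  show "continuous_on {0..} (?y n)" for n
    by (intro continuous_intros ell2_continuous_coordinate[OF X])
  show "summable (\<lambda>n. (cmod (?y n t))\<^sup>2)" if "0 \<le> t" for t
    using X that by (simp add: norm_mult ell2_continuous_on_def ell2_def)
  show "\<exists>B. \<forall>t\<in>{0..T}. \<forall>n. cmod (?y n t) \<le> B" for T
    using ell2_continuous_bounded[OF X, of "{0..T}"] by (simp add: norm_mult)
  show "?y n t = of_bool (n = 0) + integral {0..t}
      (\<lambda>s. \<i> * ((if n = 0 then 0 else cnj (?z (n - 1) s) * ?y (n - 1) s) + ?z n s * ?y (Suc n) s))"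
    if t: "0 \<le> t" for t n
  proof -
    define h where "h s = (if n = 0 then 0 else X s (n - 1)) + X s (n + 1)" for s
    have hc: "continuous_on {0..t} h"
      unfolding h_def by (cases "n = 0") (auto intro!: continuous_intros Xc)
    have ai: "(\<lambda>s. complex_of_real (v s) * (cis (k * (t - s) * (real n)\<^sup>2) * h s)) absolutely_integrable_on {0..t}"
      by (rule absolutely_integrable_mult_continuous(2)[OF _ vc]) (intro continuous_intros hc)
    have fe: "free_evol k (t - s) (toeplitz (v s) (X s)) n = complex_of_real (v s) * (cis (k * (t - s) * (real n)\<^sup>2) * h s)" for s
      by (simp add: free_evol_def toeplitz_def h_def cis_conv_exp mult_ac)
    have "?y n t = cis (- (k * t * (real n)\<^sup>2)) * free_evol k t delta0 n
        + \<i> * (cis (- (k * t * (real n)\<^sup>2)) * integral {0..t} (\<lambda>s. complex_of_real (v s) * (cis (k * (t - s) * (real n)\<^sup>2) * h s)))"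
      unfolding duh[OF t, of n] fe set_lebesgue_integral_eq_integral(2)[OF ai]
      by (simp add: algebra_simps)
    also have "cis (- (k * t * (real n)\<^sup>2)) * free_evol k t delta0 n = of_bool (n = 0)"
      by (simp add: free_evol_def delta0_def)
    also have "cis (- (k * t * (real n)\<^sup>2)) * integral {0..t} (\<lambda>s. complex_of_real (v s) * (cis (k * (t - s) * (real n)\<^sup>2) * h s))
        = integral {0..t} (\<lambda>s. cis (- (k * t * (real n)\<^sup>2)) * (complex_of_real (v s) * (cis (k * (t - s) * (real n)\<^sup>2) * h s)))"
      by simp
    also have "\<i> * \<dots> = integral {0..t} (\<lambda>s. \<i> * (cis (- (k * t * (real n)\<^sup>2)) * (complex_of_real (v s) * (cis (k * (t - s) * (real n)\<^sup>2) * h s))))"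
      by simp
    also have "(\<lambda>s. \<i> * (cis (- (k * t * (real n)\<^sup>2)) * (complex_of_real (v s) * (cis (k * (t - s) * (real n)\<^sup>2) * h s))))
      = (\<lambda>s. \<i> * ((if n = 0 then 0 else cnj (?z (n - 1) s) * ?y (n - 1) s) + ?z n s * ?y (Suc n) s))"
    proof
      fix s
      have c1: "cis (- (k * t * (real n)\<^sup>2)) * cis (k * (t - s) * (real n)\<^sup>2) = cis (- (k * s * (real n)\<^sup>2))"
        by (simp add: cis_mult algebra_simps)
      have c2: "cis (real (2 * n + 1) * k * s) * cis (- (k * s * (real (Suc n))\<^sup>2)) = cis (- (k * s * (real n)\<^sup>2))"
        by (simp add: cis_mult power2_eq_square algebra_simps)
      have c3: "cnj (cis (real (2 * (n - 1) + 1) * k * s)) * cis (- (k * s * (real (n - 1))\<^sup>2)) = cis (- (k * s * (real n)\<^sup>2))" if "n \<noteq> 0"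
        using that by (cases n) (simp_all add: cis_cnj cis_mult power2_eq_square algebra_simps)
      have "\<i> * (cis (- (k * t * (real n)\<^sup>2)) * (complex_of_real (v s) * (cis (k * (t - s) * (real n)\<^sup>2) * h s)))
          = \<i> * (complex_of_real (v s) * ((cis (- (k * t * (real n)\<^sup>2)) * cis (k * (t - s) * (real n)\<^sup>2)) * h s))"
        by (simp add: mult_ac)
      also have "\<dots> = \<i> * (complex_of_real (v s) * (cis (- (k * s * (real n)\<^sup>2)) * h s))"
        unfolding c1 ..
      also have "\<dots> = \<i> * ((if n = 0 then 0 else cnj (?z (n - 1) s) * ?y (n - 1) s) + ?z n s * ?y (Suc n) s)"
      proof -
        have e1: "?z n s * ?y (Suc n) s = complex_of_real (v s) * (cis (- (k * s * (real n)\<^sup>2)) * X s (Suc n))"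
          unfolding c2[symmetric] by (simp only: mult_ac)
        have e2: "cnj (?z (n - 1) s) * ?y (n - 1) s = complex_of_real (v s) * (cis (- (k * s * (real n)\<^sup>2)) * X s (n - 1))" if "n \<noteq> 0"
          unfolding c3[OF that, symmetric] complex_cnj_mult complex_cnj_complex_of_real by (simp only: mult_ac)
        show ?thesis
        proof (cases "n = 0")
          case True
          show ?thesis
            unfolding e1 by (simp add: True h_def)
        next
          case False
          show ?thesis
            unfolding e1 if_not_P[OF False] e2[OF False] by (simp add: h_def False distrib_left)
        qed
      qed
      finally show "\<i> * (cis (- (k * t * (real n)\<^sup>2)) * (complex_of_real (v s) * (cis (k * (t - s) * (real n)\<^sup>2) * h s)))
        = \<i> * ((if n = 0 then 0 else cnj (?z (n - 1) s) * ?y (n - 1) s) + ?z n s * ?y (Suc n) s)" .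
    qed
    finally show ?thesis .
  qed
qed


section \<open>A pointwise bound for the moments\<close>

text \<open>
  The block has length \<open>2j+1 \<le> 3j\<close>, and \<open>|v|\<close> is at most \<open>K j^(-2\<gamma>)\<close> there.
\<close>

lemma action_block:
  fixes v :: "real \<Rightarrow> real"
  assumes v: "\<And>T. v absolutely_integrable_on {0..T}" and g: "\<gamma> > 3 / 4"
    and decay: "\<And>t. t > 0 \<Longrightarrow> \<bar>v t\<bar> \<le> K * t powr (- \<gamma>)" and j: "1 \<le> j"
  shows "integral {(real j)\<^sup>2..(real (Suc j))\<^sup>2} (\<lambda>t. \<bar>v t\<bar>) \<le> 3 * K * real j powr (1 - 2 * \<gamma>)"
proof -
  have j0: "0 < real j"
    using j by simp
  have K: "0 \<le> K"
    using decay[of 1] abs_ge_zero[of "v 1"] by simp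
  let ?c = "K * ((real j)\<^sup>2) powr (- \<gamma>)"
  have pw: "((real j)\<^sup>2) powr (- \<gamma>) = real j powr (- 2 * \<gamma>)"
  proof -
    have "((real j)\<^sup>2) powr (- \<gamma>) = (real j powr 2) powr (- \<gamma>)"
      using j0 by (simp only: powr_numeral)
    then show ?thesis
      unfolding powr_powr by simp
  qed
  have "(\<lambda>t. \<bar>v t\<bar>) absolutely_integrable_on {0..(real (Suc j))\<^sup>2}"
    using absolutely_integrable_norm[OF v] by (simp add: comp_def)
  then have "(\<lambda>t. \<bar>v t\<bar>) absolutely_integrable_on {(real j)\<^sup>2..(real (Suc j))\<^sup>2}"
    by (rule absolutely_integrable_on_subinterval) auto
  then have int: "(\<lambda>t. \<bar>v t\<bar>) integrable_on {(real j)\<^sup>2..(real (Suc j))\<^sup>2}"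
    by (rule set_lebesgue_integral_eq_integral(1))
  have "integral {(real j)\<^sup>2..(real (Suc j))\<^sup>2} (\<lambda>t. \<bar>v t\<bar>) \<le> integral {(real j)\<^sup>2..(real (Suc j))\<^sup>2} (\<lambda>t. ?c)"
  proof (rule integral_le[OF int])
    fix t assume t: "t \<in> {(real j)\<^sup>2..(real (Suc j))\<^sup>2}"
    have j2: "0 < (real j)\<^sup>2"
      using j0 by simp
    have "0 < t"
      by (rule less_le_trans[OF j2]) (use t in simp)
    then have "\<bar>v t\<bar> \<le> K * t powr (- \<gamma>)"
      by (rule decay)
    also have "\<dots> \<le> ?c"
      using t j2 g K by (intro mult_left_mono powr_mono2') auto
    finally show "\<bar>v t\<bar> \<le> ?c" .
  qed (rule integrable_const_ivl)
  also have "\<dots> = (2 * real j + 1) * ?c"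
    by (simp add: power2_eq_square algebra_simps)
  also have "\<dots> \<le> (3 * real j) * ?c"
    using j K by (intro mult_right_mono) auto
  also have "\<dots> = 3 * K * (real j powr 1 * real j powr (- 2 * \<gamma>))"
    unfolding pw using j0 by simp
  also have "\<dots> = 3 * K * real j powr (1 - 2 * \<gamma>)"
    unfolding powr_add[symmetric] by simp
  finally show ?thesis .
qed

text \<open>
  By Cauchy-Schwarz over the blocks before \<open>J\<close>; the interval \<open>{0..1}\<close>, where \<open>v\<close> may be unbounded, is set
  apart.
\<close>

lemma action_initial:
  fixes v :: "real \<Rightarrow> real" and b :: "nat \<Rightarrow> real"
  assumes v: "\<And>T. v absolutely_integrable_on {0..T}"
    and b: "\<And>j. 1 \<le> j \<Longrightarrow> integral {(real j)\<^sup>2..(real (Suc j))\<^sup>2} (\<lambda>t. \<bar>v t\<bar>) \<le> b j"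
    and \<beta>: "\<And>J. (\<Sum>j=1..<J. (b j)\<^sup>2) \<le> \<beta>" and J: "1 \<le> J"
  shows "integral {0..(real J)\<^sup>2} (\<lambda>t. \<bar>v t\<bar>) \<le> integral {0..1} (\<lambda>t. \<bar>v t\<bar>) + sqrt (real J * \<beta>)"
proof -
  have int: "(\<lambda>t. \<bar>v t\<bar>) integrable_on {0..T}" for T
    using absolutely_integrable_norm[OF v, of T]
    by (intro set_lebesgue_integral_eq_integral(1)) (simp add: comp_def)
  have "integral {0..(real J)\<^sup>2} (\<lambda>t. \<bar>v t\<bar>) \<le> integral {0..1} (\<lambda>t. \<bar>v t\<bar>) + (\<Sum>j=1..<J. b j)"
    using J
  proof (induction J rule: dec_induct)
    case base
    then show ?case by simp
  next
    case (step J)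
    have le: "(real J)\<^sup>2 \<le> (real (Suc J))\<^sup>2"
      by (intro power_mono) auto
    have "integral {0..(real (Suc J))\<^sup>2} (\<lambda>t. \<bar>v t\<bar>)
       = integral {0..(real J)\<^sup>2} (\<lambda>t. \<bar>v t\<bar>) + integral {(real J)\<^sup>2..(real (Suc J))\<^sup>2} (\<lambda>t. \<bar>v t\<bar>)"
      using Henstock_Kurzweil_Integration.integral_combine[OF zero_le_power2 le int] by simp
    then show ?case
      using step.IH b[of J] step.hyps by (simp add: sum.atLeastLessThan_Suc)
  qed
  also have "(\<Sum>j=1..<J. b j) \<le> sqrt (real J * \<beta>)"
  proof (rule real_le_rsqrt)
    have "(\<Sum>j=1..<J. 1 * b j)\<^sup>2 \<le> (\<Sum>j=1..<J. 1\<^sup>2) * (\<Sum>j=1..<J. (b j)\<^sup>2)"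
      by (rule Cauchy_Schwarz_ineq_sum)
    also have "\<dots> \<le> real J * \<beta>"
      using \<beta>[of J] by (intro mult_mono sum_nonneg) auto
    finally show "(\<Sum>j=1..<J. b j)\<^sup>2 \<le> real J * \<beta>"
      by simp
  qed
  finally show ?thesis by simp
qed

text \<open>
  The truncation is removed: the first \<open>M\<close> weights with \<open>L = M\<close> are not truncated.
\<close>

lemma (in jacobi_flow) weighted_series_le:
  assumes t: "0 \<le> t" and B: "\<And>L. 0 < L \<Longrightarrow> moment L m t \<le> B"
  shows "(\<Sum>n. ennreal (real (Suc n) ^ m * (cmod (y n t))\<^sup>2)) \<le> ennreal B"
  unfolding suminf_eq_SUP
proof (rule SUP_least)
  fix M :: nat
  show "(\<Sum>n<M. ennreal (real (Suc n) ^ m * (cmod (y n t))\<^sup>2)) \<le> ennreal B"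
  proof (cases "M = 0")
    case False
    have "(\<Sum>n<M. ennreal (real (Suc n) ^ m * (cmod (y n t))\<^sup>2)) = ennreal (\<Sum>n<M. weight M m n * (cmod (y n t))\<^sup>2)"
      by (subst sum_ennreal[symmetric]) (auto simp: weight_def min_def intro!: sum.cong)
    also have "\<dots> \<le> ennreal (moment M m t)"
      unfolding moment_def
      by (intro ennreal_leI sum_le_suminf moment_summable t) (auto simp: weight_nonneg)
    also have "\<dots> \<le> ennreal B"
      using False by (intro ennreal_leI B) simp
    finally show ?thesis .
  qed simp
qed

text \<open>
  A majorant, up to a constant, of the square of the factor gained with each order of the moments at
  frequency \<open>k\<close> up to time \<open>N\<^sup>2\<close>. The power of \<open>|k|\<close> accounts for the time before the first block.
\<close>

definition growth_square :: "real \<Rightarrow> (real \<Rightarrow> real) \<Rightarrow> nat \<Rightarrow> real \<Rightarrow> ennreal" where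
  "growth_square \<gamma> v N k = ennreal (1 + \<bar>k\<bar> powr (- 1 / 2)) + resonance_sum (\<gamma> - 3 / 4) v N k"

text \<open>
  The constant \<open>A\<close> is the same for all frequencies, times and orders; the dependence on the frequency is
  carried by \<open>growth_square\<close> alone.
\<close>

lemma moments_le_growth:
  fixes v :: "real \<Rightarrow> real"
  assumes v: "\<And>T. v absolutely_integrable_on {0..T}" and g: "\<gamma> > 3 / 4"
    and decay: "\<And>t. t > 0 \<Longrightarrow> \<bar>v t\<bar> \<le> K * t powr (- \<gamma>)"
  shows "\<exists>A\<ge>1. \<forall>k X N t m. k \<noteq> 0 \<longrightarrow> duhamel_solution v k X \<longrightarrow> growth_square \<gamma> v N k < top \<longrightarrow>
     t \<in> {0..(real N)\<^sup>2} \<longrightarrow>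
     (\<Sum>n. ennreal (real (Suc n) ^ m * (cmod (X t n))\<^sup>2))
       \<le> ennreal (moment_const m * sqrt (A * enn2real (growth_square \<gamma> v N k)) ^ m)"
proof -
  define p where "p = \<gamma> - 3 / 4"
  have p: "0 < p"
    using g by (simp add: p_def)
  define b where "b j = 3 * K * real j powr (1 - 2 * \<gamma>)" for j :: nat
  define \<beta> where "\<beta> = (\<Sum>j. (b j)\<^sup>2)"
  have bsum: "summable (\<lambda>j. (b j)\<^sup>2)"
  proof -
    have "(b j)\<^sup>2 = (3 * K)\<^sup>2 * real j powr (2 - 4 * \<gamma>)" for j
    proof -
      have "(real j powr (1 - 2 * \<gamma>))\<^sup>2 = real j powr (2 - 4 * \<gamma>)"
        unfolding power2_eq_square powr_add[symmetric] by simp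
      then show ?thesis
        by (simp add: b_def power_mult_distrib)
    qed
    moreover have "summable (\<lambda>j. real j powr (2 - 4 * \<gamma>))"
      using g by (simp add: summable_real_powr_iff)
    ultimately show ?thesis
      by (simp add: summable_mult)
  qed
  have b\<beta>: "(\<Sum>j\<in>S. (b j)\<^sup>2) \<le> \<beta>" if "finite S" for S
    unfolding \<beta>_def by (rule sum_le_suminf[OF bsum that]) auto
  have \<beta>0: "0 \<le> \<beta>"
    using b\<beta>[of "{}"] by simp
  have blk: "integral {(real j)\<^sup>2..(real (Suc j))\<^sup>2} (\<lambda>t. \<bar>v t\<bar>) \<le> b j" if "1 \<le> j" for j
    unfolding b_def by (rule action_block[OF v g decay that])
  define V where "V = integral {0..1} (\<lambda>t. \<bar>v t\<bar>)"
  define a where "a = 1 + V + sqrt \<beta> + \<beta>"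
  define c where "c = 2 + sqrt \<beta>"
  define A where "A = 3 * a\<^sup>2 + 6 * \<beta> + 3 * c\<^sup>2 + 1"
  have A1: "1 \<le> A"
    using \<beta>0 by (simp add: A_def)
  have main: "(\<Sum>n. ennreal (real (Suc n) ^ m * (cmod (X t n))\<^sup>2))
       \<le> ennreal (moment_const m * sqrt (A * enn2real (growth_square \<gamma> v N k)) ^ m)"
    if k: "k \<noteq> 0" and sol: "duhamel_solution v k X" and fin: "growth_square \<gamma> v N k < top"
      and t: "t \<in> {0..(real N)\<^sup>2}" for k X N t m
  proof -
    let ?z = "\<lambda>n t. complex_of_real (v t) * cis (real (2 * n + 1) * k * t)"
    let ?y = "\<lambda>n t. cis (- (k * t * (real n)\<^sup>2)) * X t n"
    interpret jacobi_flow v ?z ?y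
      by (rule duhamel_imp_jacobi_flow[OF v sol])
    define \<Phi> where "\<Phi> = enn2real (resonance_sum p v N k)"
    have rfin: "resonance_sum p v N k < top"
      using fin by (auto simp: growth_square_def p_def)
    have rs\<Phi>: "resonance_sum p v N k = ennreal \<Phi>"
      using rfin by (simp add: \<Phi>_def)
    have \<Phi>0: "0 \<le> \<Phi>"
      by (simp add: \<Phi>_def)
    define W where "W j = (\<Sum>n. ennreal (((real j)\<^sup>2 * \<bar>k\<bar>) powr p
      * (cmod (window_transform v ((real j)\<^sup>2) ((real N)\<^sup>2) (real (2 * n + 1) * k)))\<^sup>2))" for j
    have rsW: "resonance_sum p v N k = (\<Sum>j=1..N. W j)"
      by (simp add: resonance_sum_def W_def)
    have Wfin: "W j < top" if "j \<in> {1..N}" for j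
      by (rule le_less_trans[OF member_le_sum rfin[unfolded rsW]]) (use that in auto)
    define F where "F j = sqrt (enn2real (W j))" for j
    \<comment> \<open>The first block that is used: from here on \<open>j\<^sup>2 |k| \<ge> 1\<close>, and the weight in \<open>resonance_sum\<close> is at least \<open>1\<close>.\<close>
    define J where "J = nat \<lceil>\<bar>k\<bar> powr (- 1 / 2)\<rceil> + 1"
    have J1: "1 \<le> J"
      by (simp add: J_def)
    have Jlow: "\<bar>k\<bar> powr (- 1 / 2) \<le> real J"
      unfolding J_def by linarith
    have Jup: "real J \<le> \<bar>k\<bar> powr (- 1 / 2) + 2"
    proof -
      have "0 \<le> \<bar>k\<bar> powr (- 1 / 2)" by simp
      then show ?thesis
        unfolding J_def by linarith
    qed
    have res: "1 \<le> (real j)\<^sup>2 * \<bar>k\<bar>" if "J \<le> j" for j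
    proof -
      have "(\<bar>k\<bar> powr (- 1 / 2))\<^sup>2 \<le> (real j)\<^sup>2"
        using Jlow that by (intro power_mono) auto
      also have "(\<bar>k\<bar> powr (- 1 / 2))\<^sup>2 = \<bar>k\<bar> powr (- 1)"
        unfolding power2_eq_square powr_add[symmetric] by simp
      finally have "\<bar>k\<bar> powr (- 1) * \<bar>k\<bar> \<le> (real j)\<^sup>2 * \<bar>k\<bar>"
        by (rule mult_right_mono) simp
      moreover have "\<bar>k\<bar> powr (- 1) * \<bar>k\<bar> = 1"
        using k by (simp add: powr_minus)
      ultimately show ?thesis by simp
    qed
    \<comment> \<open>The supremum over \<open>n\<close> of the tails is estimated by the root of their sum of squares.\<close>
    have FW: "cmod (integral {(real j)\<^sup>2..(real N)\<^sup>2} (?z n)) \<le> F j" if j: "J \<le> j" "j \<le> N" for j n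
      unfolding F_def
    proof (rule real_le_rsqrt)
      let ?E = "\<lambda>n. cmod (window_transform v ((real j)\<^sup>2) ((real N)\<^sup>2) (real (2 * n + 1) * k))"
      have jN: "j \<in> {1..N}"
        using j J1 by simp
      have "integral {(real j)\<^sup>2..(real N)\<^sup>2} (?z n) = window_transform v ((real j)\<^sup>2) ((real N)\<^sup>2) (real (2 * n + 1) * k)"
        by (simp only: window_transform_def)
      moreover have "ennreal ((?E n)\<^sup>2) \<le> W j"
      proof -
        have "1 \<le> ((real j)\<^sup>2 * \<bar>k\<bar>) powr p"
          by (rule ge_one_powr_ge_zero[OF res[OF j(1)]]) (use p in simp)
        then have "1 * (?E n)\<^sup>2 \<le> ((real j)\<^sup>2 * \<bar>k\<bar>) powr p * (?E n)\<^sup>2"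
          by (rule mult_right_mono) simp
        then have "ennreal ((?E n)\<^sup>2) \<le> ennreal (((real j)\<^sup>2 * \<bar>k\<bar>) powr p * (?E n)\<^sup>2)"
          by (intro ennreal_leI) simp
        also have "\<dots> = (\<Sum>i\<in>{n}. ennreal (((real j)\<^sup>2 * \<bar>k\<bar>) powr p * (?E i)\<^sup>2))"
          by simp
        also have "\<dots> \<le> W j"
          unfolding W_def by (rule sum_le_suminf) auto
        finally show ?thesis .
      qed
      then have "ennreal ((?E n)\<^sup>2) \<le> ennreal (enn2real (W j))"
        using Wfin[OF jN] by simp
      then have "(?E n)\<^sup>2 \<le> enn2real (W j)"
        by (simp only: ennreal_le_iff[OF enn2real_nonneg])
      ultimately show "(cmod (integral {(real j)\<^sup>2..(real N)\<^sup>2} (?z n)))\<^sup>2 \<le> enn2real (W j)"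
        by simp
    qed
    have F\<Phi>: "(\<Sum>j=J..N. (F j)\<^sup>2) \<le> \<Phi>"
    proof -
      have "ennreal (\<Sum>j=J..N. (F j)\<^sup>2) = (\<Sum>j=J..N. ennreal (enn2real (W j)))"
        by (simp add: F_def)
      also have "\<dots> = (\<Sum>j=J..N. W j)"
        by (rule sum.cong) (use J1 Wfin in auto)
      also have "\<dots> \<le> (\<Sum>j=1..N. W j)"
        by (rule sum_mono2) (use J1 in auto)
      also have "\<dots> = ennreal \<Phi>"
        using rsW rs\<Phi> by simp
      finally show ?thesis
        using \<Phi>0 by simp
    qed
    have init: "integral {0..(real J)\<^sup>2} (\<lambda>t. \<bar>v t\<bar>) \<le> V + sqrt (real J * \<beta>)"
      unfolding V_def by (rule action_initial[OF v blk b\<beta> J1]) auto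
    define R where "R = 1 + (integral {0..(real J)\<^sup>2} (\<lambda>t. \<bar>v t\<bar>) + sqrt \<beta> + \<beta> + (2 + sqrt \<beta>) * sqrt \<Phi>)"
    have R0: "0 \<le> R"
      unfolding R_def using \<beta>0 \<Phi>0 action_nonneg[of 0 "(real J)\<^sup>2"]
      by (intro add_nonneg_nonneg mult_nonneg_nonneg) auto
    have gs: "enn2real (growth_square \<gamma> v N k) = 1 + \<bar>k\<bar> powr (- 1 / 2) + \<Phi>"
      using \<Phi>0 by (simp add: growth_square_def p_def[symmetric] rs\<Phi> ennreal_plus[symmetric] add_nonneg_nonneg del: ennreal_plus)
    have RA: "R \<le> sqrt (A * enn2real (growth_square \<gamma> v N k))"
    proof (rule real_le_rsqrt)
      let ?q = "sqrt (real J * \<beta>)" and ?f = "c * sqrt \<Phi>" and ?\<kappa> = "\<bar>k\<bar> powr (- 1 / 2)"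
      have "R \<le> a + ?q + ?f"
        using init by (simp add: R_def a_def c_def)
      then have "R\<^sup>2 \<le> (a + ?q + ?f)\<^sup>2"
        using R0 by (intro power_mono) auto
      also have "\<dots> \<le> 3 * (a\<^sup>2 + ?q\<^sup>2 + ?f\<^sup>2)"
        using sum_squares_bound[of a ?q] sum_squares_bound[of a ?f] sum_squares_bound[of ?q ?f]
        by (simp add: power2_eq_square algebra_simps)
      also have "?q\<^sup>2 = real J * \<beta>"
        using \<beta>0 by simp
      also have "?f\<^sup>2 = c\<^sup>2 * \<Phi>"
        using \<Phi>0 by (simp add: power_mult_distrib)
      also have "3 * (a\<^sup>2 + real J * \<beta> + c\<^sup>2 * \<Phi>) \<le> 3 * (a\<^sup>2 + (?\<kappa> + 2) * \<beta> + c\<^sup>2 * \<Phi>)"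
        using Jup \<beta>0 by (intro mult_left_mono add_mono mult_right_mono) auto
      also have "\<dots> \<le> A * (1 + ?\<kappa> + \<Phi>)"
      proof -
        have \<kappa>0: "0 \<le> ?\<kappa>" by simp
        have "A * (1 + ?\<kappa> + \<Phi>) - 3 * (a\<^sup>2 + (?\<kappa> + 2) * \<beta> + c\<^sup>2 * \<Phi>)
            = (3 * a\<^sup>2) * (?\<kappa> + \<Phi>) + 3 * \<beta> * ?\<kappa> + 6 * \<beta> * \<Phi> + 3 * c\<^sup>2 * (1 + ?\<kappa>) + (1 + ?\<kappa> + \<Phi>)"
          by (simp add: A_def algebra_simps)
        moreover have "\<dots> \<ge> 0"
          using \<kappa>0 \<beta>0 \<Phi>0 by (intro add_nonneg_nonneg mult_nonneg_nonneg) auto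
        ultimately show ?thesis by linarith
      qed
      finally show "R\<^sup>2 \<le> A * enn2real (growth_square \<gamma> v N k)"
        unfolding gs .
    qed
    have mom: "moment L m t \<le> moment_const m * sqrt (A * enn2real (growth_square \<gamma> v N k)) ^ m" if L: "0 < L" for L
    proof -
      have "moment L m t \<le> moment_const m * R ^ m"
        unfolding R_def
      proof (rule moment_bound[where \<tau> = "\<lambda>j. (real j)\<^sup>2" and N = N and b = b and F = F])
        show "mono (\<lambda>j. (real j)\<^sup>2)"
          by (intro monoI power_mono) auto
        show "integral {(real j)\<^sup>2..(real (Suc j))\<^sup>2} (\<lambda>r. \<bar>v r\<bar>) \<le> b j" if "J \<le> j" "j < N" for j
          by (rule blk) (use that J1 in simp)
        show "cmod (integral {(real j)\<^sup>2..(real N)\<^sup>2} (?z n)) \<le> F j" if "J \<le> j" "j \<le> N" for j n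
          by (rule FW[OF that])
        show "(\<Sum>j = J..<N. (b j)\<^sup>2) \<le> \<beta>"
          by (rule b\<beta>) simp
      qed (use F\<Phi> L t in auto)
      also have "\<dots> \<le> moment_const m * sqrt (A * enn2real (growth_square \<gamma> v N k)) ^ m"
        using moment_const_ge_1[of m] R0 RA by (intro mult_left_mono power_mono) auto
      finally show ?thesis .
    qed
    have "(\<Sum>n. ennreal (real (Suc n) ^ m * (cmod (?y n t))\<^sup>2))
        \<le> ennreal (moment_const m * sqrt (A * enn2real (growth_square \<gamma> v N k)) ^ m)"
      using t by (intro weighted_series_le mom) auto
    then show ?thesis
      by (simp add: norm_mult)
  qed
  show ?thesis
    using A1 main by blast
qed

lemma growth_square_average:
  fixes v :: "real \<Rightarrow> real"
  assumes v: "\<And>T. v absolutely_integrable_on {0..T}" and g: "\<gamma> > 3 / 4" and B: "B > 0"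
    and decay: "\<And>t. t > 0 \<Longrightarrow> \<bar>v t\<bar> \<le> K * t powr (- \<gamma>)"
  shows "growth_square \<gamma> v N \<in> borel_measurable borel"
    and "\<exists>C\<ge>0. \<forall>N. (\<integral>\<^sup>+ k. growth_square \<gamma> v N k * indicator {x. \<bar>x\<bar> < B} k \<partial>lborel) \<le> ennreal C"
proof -
  have [measurable]: "resonance_sum (\<gamma> - 3 / 4) v N \<in> borel_measurable borel" for N
    by (rule resonance_sum_average(1)[OF v g B decay])
  show meas: "growth_square \<gamma> v N \<in> borel_measurable borel"
    unfolding growth_square_def[abs_def] by measurable
  define R1 where "R1 = B powr (\<gamma> - 3 / 4) * (1 + 1 / (\<gamma> - 3 / 4)) * (plancherel_const * K\<^sup>2 / (2 * \<gamma> - 1)) * (\<Sum>j. real j powr (1 / 2 - 2 * \<gamma>))"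
  have R1: "(\<integral>\<^sup>+ k. resonance_sum (\<gamma> - 3 / 4) v N k * indicator {x. \<bar>x\<bar> < B} k \<partial>lborel) \<le> ennreal R1" for N
    unfolding R1_def by (rule resonance_sum_average(2)[OF v g B decay])
  define R2 where "R2 = 2 * (B + 2 * B powr (1 / 2))"
  have half: "(\<integral>\<^sup>+ k. ennreal (1 + k powr (- 1 / 2)) * indicator {0..B} k \<partial>lborel) = ennreal (B + 2 * B powr (1 / 2))"
  proof (rule nn_integral_has_integral_lebesgue')
    have "((\<lambda>k. k powr (- 1 / 2)) has_integral (B powr (- 1 / 2 + 1) / (- 1 / 2 + 1))) {0..B}"
      using B by (intro has_integral_powr_from_0) auto
    moreover have "((\<lambda>k. 1) has_integral B) {0..B}"
      using has_integral_const_real[of "1::real" 0 B] B by simp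
    ultimately have "((\<lambda>k. 1 + k powr (- 1 / 2)) has_integral (B + B powr (- 1 / 2 + 1) / (- 1 / 2 + 1))) {0..B}"
      by (intro has_integral_add)
    then show "((\<lambda>k. 1 + k powr (- 1 / 2)) has_integral B + 2 * B powr (1 / 2)) {0..B}"
      by (simp add: mult.commute)
  qed simp
  have neg: "(\<integral>\<^sup>+ k. ennreal (1 + (- k) powr (- 1 / 2)) * indicator {0..B} (- k) \<partial>lborel) = ennreal (B + 2 * B powr (1 / 2))"
    using nn_integral_real_affine[of "\<lambda>k. ennreal (1 + k powr (- 1 / 2)) * indicator {0..B} k" "- 1" 0] half by simp
  have "(\<integral>\<^sup>+ k. ennreal (1 + \<bar>k\<bar> powr (- 1 / 2)) * indicator {x. \<bar>x\<bar> < B} k \<partial>lborel)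
     \<le> (\<integral>\<^sup>+ k. ennreal (1 + k powr (- 1 / 2)) * indicator {0..B} k + ennreal (1 + (- k) powr (- 1 / 2)) * indicator {0..B} (- k) \<partial>lborel)"
    by (rule nn_integral_mono) (auto simp: indicator_def abs_if)
  also have "\<dots> = ennreal (B + 2 * B powr (1 / 2)) + ennreal (B + 2 * B powr (1 / 2))"
    by (subst nn_integral_add) (measurable, simp only: half neg)
  also have "\<dots> = ennreal R2"
    using B by (simp add: R2_def ennreal_plus[symmetric] del: ennreal_plus)
  finally have R2: "(\<integral>\<^sup>+ k. ennreal (1 + \<bar>k\<bar> powr (- 1 / 2)) * indicator {x. \<bar>x\<bar> < B} k \<partial>lborel) \<le> ennreal R2" .
  have "(\<integral>\<^sup>+ k. growth_square \<gamma> v N k * indicator {x. \<bar>x\<bar> < B} k \<partial>lborel) \<le> ennreal (\<bar>R2\<bar> + \<bar>R1\<bar>)" for N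
  proof -
    have "(\<integral>\<^sup>+ k. growth_square \<gamma> v N k * indicator {x. \<bar>x\<bar> < B} k \<partial>lborel)
        = (\<integral>\<^sup>+ k. ennreal (1 + \<bar>k\<bar> powr (- 1 / 2)) * indicator {x. \<bar>x\<bar> < B} k \<partial>lborel)
         + (\<integral>\<^sup>+ k. resonance_sum (\<gamma> - 3 / 4) v N k * indicator {x. \<bar>x\<bar> < B} k \<partial>lborel)"
      unfolding growth_square_def distrib_right by (rule nn_integral_add) measurable
    also have "\<dots> \<le> ennreal \<bar>R2\<bar> + ennreal \<bar>R1\<bar>"
      by (intro add_mono order_trans[OF R2] order_trans[OF R1] ennreal_leI) auto
    finally show ?thesis
      by (simp add: ennreal_plus[symmetric] del: ennreal_plus)
  qed
  then show "\<exists>C\<ge>0. \<forall>N. (\<integral>\<^sup>+ k. growth_square \<gamma> v N k * indicator {x. \<bar>x\<bar> < B} k \<partial>lborel) \<le> ennreal C"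
    by (intro exI[of _ "\<bar>R2\<bar> + \<bar>R1\<bar>"]) auto
qed

text \<open>
  Interpolation with the mass: \<open>x^s \<le> \<rho>^s + \<rho>^(s-m) x^m\<close>, by the first summand for \<open>x \<le> \<rho>\<close> and by the
  second one for \<open>x > \<rho>\<close>.
\<close>

lemma fractional_moment:
  fixes a :: "nat \<Rightarrow> real"
  assumes a: "\<And>n. 0 \<le> a n" and mass: "(\<Sum>n. ennreal (a n)) \<le> 1"
    and mom: "(\<Sum>n. ennreal (real (Suc n) ^ m * a n)) \<le> ennreal (\<rho> ^ m)"
    and \<rho>: "0 < \<rho>" and s: "0 \<le> s" "s \<le> real m"
  shows "(\<Sum>n. ennreal (real (Suc n) powr s * a n)) \<le> ennreal (2 * \<rho> powr s)"
proof -
  have pt: "x powr s \<le> \<rho> powr s + \<rho> powr (s - real m) * x ^ m" if x: "0 < x" for x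
  proof (cases "x \<le> \<rho>")
    case True
    have "x powr s \<le> \<rho> powr s"
      using True x s by (intro powr_mono2) auto
    moreover have "0 \<le> \<rho> powr (s - real m) * x ^ m"
      using x by simp
    ultimately show ?thesis by linarith
  next
    case False
    have "x powr s = x powr (s - real m) * x powr (real m)"
      by (simp add: powr_add[symmetric])
    also have "\<dots> = x powr (s - real m) * x ^ m"
      using x by (simp add: powr_realpow)
    also have "\<dots> \<le> \<rho> powr (s - real m) * x ^ m"
      using False x s \<rho> by (intro mult_right_mono powr_mono2') auto
    finally show ?thesis
      using powr_ge_zero[of \<rho> s] by linarith
  qed
  have "(\<Sum>n. ennreal (real (Suc n) powr s * a n))
     \<le> (\<Sum>n. ennreal (\<rho> powr s) * ennreal (a n) + ennreal (\<rho> powr (s - real m)) * ennreal (real (Suc n) ^ m * a n))"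
  proof (rule suminf_le)
    fix n
    have "real (Suc n) powr s * a n \<le> (\<rho> powr s + \<rho> powr (s - real m) * real (Suc n) ^ m) * a n"
      by (intro mult_right_mono pt a) simp
    then have "ennreal (real (Suc n) powr s * a n) \<le> ennreal (\<rho> powr s * a n + \<rho> powr (s - real m) * (real (Suc n) ^ m * a n))"
      by (intro ennreal_leI) (simp add: algebra_simps)
    then show "ennreal (real (Suc n) powr s * a n)
        \<le> ennreal (\<rho> powr s) * ennreal (a n) + ennreal (\<rho> powr (s - real m)) * ennreal (real (Suc n) ^ m * a n)"
      using a by (simp add: ennreal_mult[symmetric] ennreal_plus[symmetric] del: ennreal_plus)
  qed auto
  also have "\<dots> = ennreal (\<rho> powr s) * (\<Sum>n. ennreal (a n)) + ennreal (\<rho> powr (s - real m)) * (\<Sum>n. ennreal (real (Suc n) ^ m * a n))"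
    by (subst suminf_add[symmetric]) (auto simp: ennreal_suminf_cmult)
  also have "\<dots> \<le> ennreal (\<rho> powr s) * 1 + ennreal (\<rho> powr (s - real m)) * ennreal (\<rho> ^ m)"
    by (intro add_mono mult_left_mono mass mom) auto
  also have "\<dots> = ennreal (\<rho> powr s + \<rho> powr (s - real m) * \<rho> ^ m)"
    using \<rho> by (simp add: ennreal_mult)
  also have "\<rho> powr (s - real m) * \<rho> ^ m = \<rho> powr s"
    using \<rho> by (simp add: powr_diff powr_realpow)
  finally show ?thesis by simp
qed


section \<open>Growth of the Sobolev norms\<close>

lemma ennreal_powr_mono:
  assumes "x \<le> y" "0 \<le> p"
  shows "ennreal_powr x p \<le> ennreal_powr y p"
proof (cases "y = top")
  case False
  then have "x \<noteq> top"
    using assms(1) by (auto simp: top_unique)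
  moreover have "enn2real x \<le> enn2real y"
    using False assms(1) by (intro enn2real_mono) (auto simp: less_top)
  ultimately show ?thesis
    using False assms(2) by (auto simp: ennreal_powr_def intro!: ennreal_leI powr_mono2)
qed (simp add: ennreal_powr_def)

lemma ennreal_powr_ennreal: "0 \<le> y \<Longrightarrow> ennreal_powr (ennreal y) p = ennreal (y powr p)"
  by (simp add: ennreal_powr_def)

lemma suminf_shift_le:
  fixes f :: "nat \<Rightarrow> ennreal"
  shows "(\<Sum>n. f (Suc n)) \<le> (\<Sum>n. f n)"
  unfolding suminf_eq_SUP[of "\<lambda>n. f (Suc n)"]
proof (rule SUP_least)
  fix M
  have "(\<Sum>n<M. f (Suc n)) \<le> (\<Sum>n<Suc M. f n)"
    unfolding sum.lessThan_Suc_shift by simp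
  also have "\<dots> \<le> (\<Sum>n. f n)"
    by (rule sum_le_suminf) auto
  finally show "(\<Sum>n<M. f (Suc n)) \<le> (\<Sum>n. f n)" .
qed

lemma frequently_bounded_of_liminf:
  fixes u :: "nat \<Rightarrow> ennreal"
  assumes "liminf u < top"
  obtains c where "c < top" "\<And>n. \<exists>N\<ge>n. u N < c"
proof
  show "liminf u + 1 < top"
    using assms by (simp add: ennreal_add_less_top)
  fix n
  have "(INF N\<in>{n..}. u N) \<le> liminf u"
    unfolding liminf_SUP_INF by (rule SUP_upper) simp
  also have "\<dots> < liminf u + 1"
    using assms ennreal_add_left_cancel_less[of "liminf u" 0 1] by simp
  finally show "\<exists>N\<ge>n. u N < liminf u + 1"
    by (auto simp: INF_less_iff)
qed

text \<open>
  The tails end at \<open>N\<^sup>2\<close>, so \<open>growth_square\<close> need not be monotone in \<open>N\<close>; Fatou's lemma gives the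
  bound along a subsequence that depends on \<open>k\<close>, which suffices since the moments up to the time \<open>N\<^sup>2\<close>
  are controlled for each \<open>N\<close> separately.
\<close>

lemma AE_growth_square_frequently_bounded:
  fixes v :: "real \<Rightarrow> real"
  assumes v: "\<And>T. v absolutely_integrable_on {0..T}" and g: "\<gamma> > 3 / 4"
    and decay: "\<And>t. t > 0 \<Longrightarrow> \<bar>v t\<bar> \<le> K * t powr (- \<gamma>)"
  shows "AE k in lborel. \<exists>c<top. \<forall>n. \<exists>N\<ge>n. growth_square \<gamma> v N k < c"
proof -
  have [measurable]: "growth_square \<gamma> v N \<in> borel_measurable borel" for N
    by (rule growth_square_average(1)[OF v g zero_less_one decay])
  have "AE k in lborel. liminf (\<lambda>N. growth_square \<gamma> v N k * indicator {x. \<bar>x\<bar> < real (Suc M)} k) < top" for M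
  proof -
    obtain C where C: "\<And>N. (\<integral>\<^sup>+ k. growth_square \<gamma> v N k * indicator {x. \<bar>x\<bar> < real (Suc M)} k \<partial>lborel) \<le> ennreal C"
      using growth_square_average(2)[OF v g _ decay, of "real (Suc M)"] by auto
    have "(\<integral>\<^sup>+ k. liminf (\<lambda>N. growth_square \<gamma> v N k * indicator {x. \<bar>x\<bar> < real (Suc M)} k) \<partial>lborel)
        \<le> liminf (\<lambda>N. \<integral>\<^sup>+ k. growth_square \<gamma> v N k * indicator {x. \<bar>x\<bar> < real (Suc M)} k \<partial>lborel)"
      by (rule nn_integral_liminf) measurable
    also have "\<dots> \<le> liminf (\<lambda>N. ennreal C)"
      by (intro Liminf_mono always_eventually allI C)
    also have "\<dots> < top"
      by (simp add: Liminf_const)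
    finally have "(\<integral>\<^sup>+ k. liminf (\<lambda>N. growth_square \<gamma> v N k * indicator {x. \<bar>x\<bar> < real (Suc M)} k) \<partial>lborel) \<noteq> \<infinity>"
      by simp
    from nn_integral_PInf_AE[OF _ this] show ?thesis
      by (simp add: less_top)
  qed
  then have "AE k in lborel. \<forall>M. liminf (\<lambda>N. growth_square \<gamma> v N k * indicator {x. \<bar>x\<bar> < real (Suc M)} k) < top"
    by (simp add: AE_all_countable)
  then show ?thesis
  proof eventually_elim
    case (elim k)
    obtain M :: nat where "\<bar>k\<bar> < real M"
      using reals_Archimedean2 by blast
    then have "indicator {x. \<bar>x\<bar> < real (Suc M)} k = (1 :: ennreal)"
      by (simp add: indicator_def)
    then have "liminf (\<lambda>N. growth_square \<gamma> v N k) < top"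
      using elim[rule_format, of M] by simp
    from frequently_bounded_of_liminf[OF this] show ?case
      by metis
  qed
qed

theorem theorem5p1:
  fixes \<gamma> :: real and v :: "real \<Rightarrow> real" and x :: "real \<Rightarrow> real \<Rightarrow> nat \<Rightarrow> complex"
  assumes gamma: "\<gamma> > 3 / 4"
    and v_locally_integrable: "\<And>T. T > 0 \<Longrightarrow> v absolutely_integrable_on {0..T}"
    and v_decay: "\<exists>K. \<forall>t>0. \<bar>v t\<bar> \<le> K * t powr (- \<gamma>)"
    and solution: "\<And>k. duhamel_solution v k (\<lambda>t. x t k)"
  shows "(AE k in lebesgue. \<forall>s::nat.
            (SUP t\<in>{0<..}. \<Sum>n. ennreal (real n ^ s * (cmod (x t k n))\<^sup>2)) < \<infinity>) \<and>
         (\<forall>a b s \<alpha> :: real.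
            a < b \<longrightarrow> 0 \<notin> {a<..<b} \<longrightarrow> s \<ge> 1 \<longrightarrow>
            1 - \<gamma> < \<alpha> \<longrightarrow> \<alpha> < \<gamma> - 1 / 2 \<longrightarrow> \<alpha> \<ge> 0 \<longrightarrow>
            (\<exists>C>0. \<forall>T>0.
               Lp_quasinorm (2 / s) (lebesgue_on {a<..<b})
                 (\<lambda>k. SUP t\<in>{0..T}. \<Sum>n. ennreal (real (Suc n) powr s * (cmod (x t k (Suc n)))\<^sup>2))
               \<le> ennreal C *
                  (ennreal_powr (C1 \<alpha> v T) s * ennreal_powr (C2 \<alpha> v T) s + 1)))"
proof -
  obtain K where decay: "\<And>t. t > 0 \<Longrightarrow> \<bar>v t\<bar> \<le> K * t powr (- \<gamma>)"
    using v_decay by blast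
  have v: "v absolutely_integrable_on {0..T}" for T
    by (rule absolutely_integrable_on_subinterval[OF v_locally_integrable[of "\<bar>T\<bar> + 1"]]) auto
  let ?G = "growth_square \<gamma> v"
  obtain A where A1: "1 \<le> A"
    and A: "\<And>k X N t m. k \<noteq> 0 \<Longrightarrow> duhamel_solution v k X \<Longrightarrow> ?G N k < top \<Longrightarrow>
     t \<in> {0..(real N)\<^sup>2} \<Longrightarrow>
     (\<Sum>n. ennreal (real (Suc n) ^ m * (cmod (X t n))\<^sup>2))
       \<le> ennreal (moment_const m * sqrt (A * enn2real (?G N k)) ^ m)"
    using moments_le_growth[OF v gamma decay] by blast
  define \<rho> where "\<rho> m c = moment_const m * sqrt (A * c)" for m :: nat and c :: real
  have Gge: "1 \<le> enn2real (?G N k)" if "?G N k < top" for N k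
  proof -
    have "ennreal 1 \<le> ?G N k"
      unfolding growth_square_def by (intro add_increasing2 ennreal_leI) auto
    then have "enn2real (ennreal 1) \<le> enn2real (?G N k)"
      using that by (intro enn2real_mono)
    then show ?thesis by simp
  qed
  have \<rho>0: "0 < \<rho> m (enn2real (?G N k))" if "?G N k < top" for m N k
    using Gge[OF that] A1 moment_const_ge_1[of m] by (simp add: \<rho>_def zero_less_mult_iff)
  \<comment> \<open>Absorbing the constant into \<open>\<rho>\<close> turns the bound for order \<open>m\<close> into an exact power, ready for interpolation.\<close>
  have key: "(\<Sum>n. ennreal (real (Suc n) powr s * (cmod (x t k n))\<^sup>2)) \<le> ennreal (2 * \<rho> m (enn2real (?G N k)) powr s)"
    if k: "k \<noteq> 0" and fin: "?G N k < top" and t: "t \<in> {0..(real N)\<^sup>2}"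
      and s: "0 \<le> s" "s \<le> real m" "1 \<le> m" for k N t m and s :: real
  proof (rule fractional_moment[OF _ _ _ \<rho>0[OF fin] s(1,2)])
    show "(\<Sum>n. ennreal ((cmod (x t k n))\<^sup>2)) \<le> 1"
      using A[OF k solution fin t, of 0] by simp
    have "moment_const m * sqrt (A * enn2real (?G N k)) ^ m \<le> moment_const m ^ m * sqrt (A * enn2real (?G N k)) ^ m"
      using A1 Gge[OF fin] moment_const_ge_1[of m] s(3) by (intro mult_right_mono self_le_power) auto
    then show "(\<Sum>n. ennreal (real (Suc n) ^ m * (cmod (x t k n))\<^sup>2)) \<le> ennreal (\<rho> m (enn2real (?G N k)) ^ m)"
      unfolding \<rho>_def power_mult_distrib
      by (intro order_trans[OF A[OF k solution fin t, of m]] ennreal_leI)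
  qed simp

  have "AE k in lborel. k \<noteq> (0::real)"
    by (rule AE_lborel_singleton)
  moreover have "AE k in lborel. \<exists>c<top. \<forall>n. \<exists>N\<ge>n. ?G N k < c"
    by (rule AE_growth_square_frequently_bounded[OF v gamma decay])
  ultimately have "AE k in lborel. \<forall>s::nat. (SUP t\<in>{0<..}. \<Sum>n. ennreal (real n ^ s * (cmod (x t k n))\<^sup>2)) < \<infinity>"
  proof eventually_elim
    case (elim k)
    then obtain c where c: "c < top" and freq: "\<And>n. \<exists>N\<ge>n. ?G N k < c"
      by blast
    show ?case
    proof
      fix s :: nat
      have "(SUP t\<in>{0<..}. \<Sum>n. ennreal (real n ^ s * (cmod (x t k n))\<^sup>2))
          \<le> ennreal (2 * \<rho> (Suc s) (enn2real c) powr real s)"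
      proof (rule SUP_least)
        fix t :: real assume t: "t \<in> {0<..}"
        obtain N where N: "N \<ge> nat \<lceil>t\<rceil> + 1" and GN: "?G N k < c"
          using freq by blast
        have "t \<le> real N"
          using N by linarith
        also have "\<dots> \<le> (real N)\<^sup>2"
          using N by (intro self_le_power) auto
        finally have tN: "t \<in> {0..(real N)\<^sup>2}"
          using t by simp
        have fin: "?G N k < top"
          using GN c by (rule less_trans)
        have "(\<Sum>n. ennreal (real n ^ s * (cmod (x t k n))\<^sup>2)) \<le> (\<Sum>n. ennreal (real (Suc n) powr real s * (cmod (x t k n))\<^sup>2))"
          by (intro suminf_le ennreal_leI mult_right_mono) (auto simp: powr_realpow intro!: power_mono)
        also have "\<dots> \<le> ennreal (2 * \<rho> (Suc s) (enn2real (?G N k)) powr real s)"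
          by (rule key[OF elim(1) fin tN]) auto
        also have "\<dots> \<le> ennreal (2 * \<rho> (Suc s) (enn2real c) powr real s)"
        proof (intro ennreal_leI mult_left_mono powr_mono2)
          have "enn2real (?G N k) \<le> enn2real c"
            using GN c by (intro enn2real_mono) auto
          then show "\<rho> (Suc s) (enn2real (?G N k)) \<le> \<rho> (Suc s) (enn2real c)"
            unfolding \<rho>_def using A1 moment_const_ge_1[of "Suc s"]
            by (intro mult_left_mono real_sqrt_le_mono) auto
        qed (use \<rho>0[OF fin, of "Suc s"] in auto)
        finally show "(\<Sum>n. ennreal (real n ^ s * (cmod (x t k n))\<^sup>2)) \<le> ennreal (2 * \<rho> (Suc s) (enn2real c) powr real s)" .
      qed
      also have "\<dots> < \<infinity>" by simp
      finally show "(SUP t\<in>{0<..}. \<Sum>n. ennreal (real n ^ s * (cmod (x t k n))\<^sup>2)) < \<infinity>" .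
    qed
  qed
  then have part1: "AE k in lebesgue. \<forall>s::nat. (SUP t\<in>{0<..}. \<Sum>n. ennreal (real n ^ s * (cmod (x t k n))\<^sup>2)) < \<infinity>"
    by (rule AE_completion)

  have part2: "\<exists>C>0. \<forall>T>0.
               Lp_quasinorm (2 / s) (lebesgue_on {a<..<b})
                 (\<lambda>k. SUP t\<in>{0..T}. \<Sum>n. ennreal (real (Suc n) powr s * (cmod (x t k (Suc n)))\<^sup>2))
               \<le> ennreal C *
                  (ennreal_powr (C1 \<alpha> v T) s * ennreal_powr (C2 \<alpha> v T) s + 1)"
    if ab: "a < b" "0 \<notin> {a<..<b}" and s: "1 \<le> s" for a b s \<alpha> :: real
  proof -
    define m where "m = nat \<lceil>s\<rceil>"
    have m: "s \<le> real m" "1 \<le> m"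
      using s unfolding m_def by linarith+
    define B where "B = \<bar>a\<bar> + \<bar>b\<bar> + 1"
    have B: "0 < B"
      by (simp add: B_def)
    obtain E where E0: "0 \<le> E"
      and E: "\<And>N. (\<integral>\<^sup>+ k. ?G N k * indicator {x. \<bar>x\<bar> < B} k \<partial>lborel) \<le> ennreal E"
      using growth_square_average(2)[OF v gamma B decay] by blast
    have Gm [measurable]: "?G N \<in> borel_measurable borel" for N
      by (rule growth_square_average(1)[OF v gamma B decay])
    define D where "D = 4 * ((moment_const m)\<^sup>2 * A)"
    have D: "0 < D"
      using A1 moment_const_ge_1[of m] by (simp add: D_def zero_less_mult_iff)
    define C where "C = 1 + (D * E) powr (s / 2)"
    have C: "0 < C"
      using powr_ge_zero[of "D * E" "s / 2"] unfolding C_def by linarith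
    have bound: "Lp_quasinorm (2 / s) (lebesgue_on {a<..<b})
         (\<lambda>k. SUP t\<in>{0..T}. \<Sum>n. ennreal (real (Suc n) powr s * (cmod (x t k (Suc n)))\<^sup>2)) \<le> ennreal C"
      if T: "0 < T" for T
    proof -
      define S where "S k = (SUP t\<in>{0..T}. \<Sum>n. ennreal (real (Suc n) powr s * (cmod (x t k (Suc n)))\<^sup>2))" for k
      define N where "N = nat \<lceil>T\<rceil> + 1"
      have "T \<le> real N"
        unfolding N_def by linarith
      also have "\<dots> \<le> (real N)\<^sup>2"
        by (intro self_le_power) (auto simp: N_def)
      finally have TN: "T \<le> (real N)\<^sup>2" .
      \<comment> \<open>The power \<open>2/s\<close> turns the bound of order \<open>\<rho>^s\<close> into one of order \<open>\<rho>\<^sup>2\<close>, which \<open>growth_square\<close> controls; \<open>4\<close> bounds \<open>2 powr (2 / s)\<close>.\<close>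
      have pt: "ennreal_powr (S k) (2 / s) \<le> ennreal D * ?G N k" if k: "k \<in> {a<..<b}" for k
      proof (cases "?G N k < top")
        case False
        then have "?G N k = top"
          by (simp add: less_top[symmetric])
        then show ?thesis
          using D by (simp add: ennreal_mult_top)
      next
        case True
        have k0: "k \<noteq> 0"
          using k ab(2) by auto
        let ?r = "\<rho> m (enn2real (?G N k))"
        have r: "0 < ?r"
          by (rule \<rho>0[OF True])
        have "S k \<le> ennreal (2 * ?r powr s)"
          unfolding S_def
        proof (rule SUP_least)
          fix t assume t: "t \<in> {0..T}"
          let ?f = "\<lambda>n. ennreal (real (Suc n) powr s * (cmod (x t k n))\<^sup>2)"
          have "(\<Sum>n. ennreal (real (Suc n) powr s * (cmod (x t k (Suc n)))\<^sup>2)) \<le> (\<Sum>n. ?f (Suc n))"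
            using s by (intro suminf_le ennreal_leI mult_right_mono powr_mono2) auto
          also have "\<dots> \<le> (\<Sum>n. ?f n)"
            by (rule suminf_shift_le)
          also have "\<dots> \<le> ennreal (2 * ?r powr s)"
            by (rule key[OF k0 True]) (use t TN s m in auto)
          finally show "(\<Sum>n. ennreal (real (Suc n) powr s * (cmod (x t k (Suc n)))\<^sup>2)) \<le> ennreal (2 * ?r powr s)" .
        qed
        then have "ennreal_powr (S k) (2 / s) \<le> ennreal_powr (ennreal (2 * ?r powr s)) (2 / s)"
          using s by (intro ennreal_powr_mono) auto
        also have "\<dots> = ennreal ((2 * ?r powr s) powr (2 / s))"
          by (rule ennreal_powr_ennreal) simp
        also have "\<dots> \<le> ennreal (D * enn2real (?G N k))"
        proof (rule ennreal_leI)
          have "(2 * ?r powr s) powr (2 / s) = 2 powr (2 / s) * ?r powr 2"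
            using s by (simp add: powr_mult powr_powr)
          also have "\<dots> \<le> 2 powr 2 * ?r powr 2"
            using s by (intro mult_right_mono powr_mono) (auto simp: field_simps)
          also have "\<dots> = 4 * ?r\<^sup>2"
            using r by simp
          also have "\<dots> = D * enn2real (?G N k)"
            using A1 by (simp add: \<rho>_def D_def power_mult_distrib)
          finally show "(2 * ?r powr s) powr (2 / s) \<le> D * enn2real (?G N k)" .
        qed
        also have "\<dots> = ennreal D * ?G N k"
          using D True by (simp add: ennreal_mult)
        finally show ?thesis .
      qed
      have "(\<integral>\<^sup>+ k. ennreal_powr (S k) (2 / s) \<partial>lebesgue_on {a<..<b})
          = (\<integral>\<^sup>+ k. ennreal_powr (S k) (2 / s) * indicator {a<..<b} k \<partial>lborel)"
        by (simp add: nn_integral_restrict_space nn_integral_completion)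
      also have "\<dots> \<le> (\<integral>\<^sup>+ k. ennreal D * (?G N k * indicator {x. \<bar>x\<bar> < B} k) \<partial>lborel)"
      proof (rule nn_integral_mono)
        fix k
        show "ennreal_powr (S k) (2 / s) * indicator {a<..<b} k \<le> ennreal D * (?G N k * indicator {x. \<bar>x\<bar> < B} k)"
        proof (cases "k \<in> {a<..<b}")
          case True
          then have "\<bar>k\<bar> < B"
            by (auto simp: B_def)
          then show ?thesis
            using pt[OF True] True by simp
        qed simp
      qed
      also have "\<dots> = ennreal D * (\<integral>\<^sup>+ k. ?G N k * indicator {x. \<bar>x\<bar> < B} k \<partial>lborel)"
        by (rule nn_integral_cmult) measurable
      also have "\<dots> \<le> ennreal D * ennreal E"
        by (intro mult_left_mono E) simp
      also have "\<dots> = ennreal (D * E)"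
        using D E0 by (simp add: ennreal_mult)
      finally have "Lp_quasinorm (2 / s) (lebesgue_on {a<..<b}) S \<le> ennreal_powr (ennreal (D * E)) (1 / (2 / s))"
        unfolding Lp_quasinorm_def using s by (intro ennreal_powr_mono) auto
      also have "\<dots> = ennreal ((D * E) powr (s / 2))"
        using D E0 by (simp add: ennreal_powr_ennreal)
      also have "\<dots> \<le> ennreal C"
        by (intro ennreal_leI) (simp add: C_def)
      finally show ?thesis
        unfolding S_def .
    qed
    have "ennreal C \<le> ennreal C * (ennreal_powr (C1 \<alpha> v T) s * ennreal_powr (C2 \<alpha> v T) s + 1)" for T
    proof -
      have "ennreal C * 1 \<le> ennreal C * (ennreal_powr (C1 \<alpha> v T) s * ennreal_powr (C2 \<alpha> v T) s + 1)"
        by (intro mult_left_mono) auto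
      then show ?thesis by simp
    qed
    then show ?thesis
      using C bound order_trans by blast
  qed
  show ?thesis
    using part1 part2 by blast
qed

end
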